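(* Let $E$ be a smooth manifold of dimension $n+m$ ($n,m\ge1$). Two torsion-free linear connections $\Gamma$ and $\Gamma'$ on $TE\to E$ are $n$-Grassmannian equivalent if and only if $\ddot\Gamma=\ddot\Gamma'$.
   Context: Two $n$-dimensional embedded submanifolds of $E$ through $p$, written locally as $u^i=f^i(u^\lambda)$ and $u^i=f'^i(u^\lambda)$, have contact of order $r$ at $p$ if the Taylor expansion of $f-f'$ vanishes at $p$ up to order $r$. $[L]^r_p$ is the class of $L$ and $J^r(E,n)$ the manifold of all such classes, with charts $(u^\lambda,u^i_\sigma)$, $|\sigma|\le r$, $u^i_\sigma([L]^r_p)=\partial^{|\sigma|}f^i/\partial u^\sigma$; $\pi_{k,h}\colon J^k(E,n)\to J^h(E,n)$ are the projections. Greek indices run in $1..n$, lower-case Latin in $n+1..n+m$, capital in $1..n+m$. With $L^{(r)}=\{[L]^r_p:p\in L\}$, the $R$-plane of $\theta_{r+1}=[L]^{r+1}_p$ is $R_{\theta_{r+1}}=T_{[L]^r_p}L^{(r)}$. $\Gamma_A{}^C{}_B$ denote Christoffel symbols ($\nabla_{\partial_A}\partial_B=\Gamma_A{}^C{}_B\partial_C$). The equation $\mathcal S=\mathcal S_\Gamma$ of $n$-dimensional (unparametrized) totally geodesic submanifolds of $\Gamma$ is the submanifold of $J^2(E,n)$ of those $[L]^2_p$ for which the second fundamental form $(X,Y)\mapsto\nabla_XY\bmod T_pL$, $X,Y\in T_pL$, vanishes; locally $$u^k_{\lambda\xi}+\Gamma_\lambda{}^k{}_\xi+\Gamma_\lambda{}^k{}_iu^i_\xi+\Gamma_j{}^k{}_\xi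 u^j_\lambda+\Gamma_j{}^k{}_iu^j_\lambda u^i_\xi-u^k_\beta\big(\Gamma_\lambda{}^\beta{}_\xi+\Gamma_\lambda{}^\beta{}_iu^i_\xi+\Gamma_j{}^\beta{}_\xi u^j_\lambda+\Gamma_j{}^\beta{}_iu^j_\lambda u^i_\xi\big)=0.$$ Two torsion-free linear connections are $n$-Grassmannian equivalent if they have the same equation of $n$-dimensional totally geodesic submanifolds, i.e. $\mathcal S_\Gamma=\mathcal S_{\Gamma'}$. $\dot\Gamma$ is the connection on $\pi_{1,0}$ associated with $\Gamma$, with vertical projection $$\upsilon_{\dot\Gamma}=(du^k_\xi+\dot\Gamma_A{}^k{}_\xi\,du^A)\otimes\partial_{u^k_\xi},\qquad \dot\Gamma_A{}^k{}_\xi=\Gamma_A{}^k{}_\xi+\Gamma_A{}^k{}_iu^i_\xi-u^k_\beta(\Gamma_A{}^\beta{}_\xi+\Gamma_A{}^\beta{}_iu^i_\xi).$$ $\ddot\Gamma\colon J^1(E,n)\to J^2(E,n)$ is the unique section of $\pi_{2,1}$ such that, for every $\theta_1$, $R_{\ddot\Gamma(\theta_1)}$ is the $\dot\Gamma$-horizontal lift at $\theta_1$ of $R_{\theta_1}\subset T_{\pi_{1,0}(\theta_1)}E$. $\ddot\Gamma'$ is constructed in the same way from $\Gamma'$. *)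

theory Defs
  imports "HOL-Analysis.Analysis"
begin

section \<open>Smooth maps, manifolds and tangent vectors\<close>

text \<open>These notions are meant for open sets \<open>S\<close>: the derivatives are taken in the full space.\<close>

fun Ck_on :: "nat \<Rightarrow> 'a::real_normed_vector set \<Rightarrow> ('a \<Rightarrow> 'b::real_normed_vector) \<Rightarrow> bool" where
  "Ck_on 0 S f \<longleftrightarrow> continuous_on S f"
| "Ck_on (Suc k) S f \<longleftrightarrow>
     (\<forall>x\<in>S. f differentiable (at x)) \<and> (\<forall>v. Ck_on k S (\<lambda>x. frechet_derivative f (at x) v))"

definition smooth_on :: "'a::real_normed_vector set \<Rightarrow> ('a \<Rightarrow> 'b::real_normed_vector) \<Rightarrow> bool" where
  "smooth_on S f \<longleftrightarrow> (\<forall>k. Ck_on k S f)"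

text \<open>A chart is a pair of a domain and a coordinate map; values of the map off the domain are
  irrelevant.\<close>

type_synonym ('p, 'e) chart = "'p set \<times> ('p \<Rightarrow> 'e)"

definition chart_inv :: "('p, 'e) chart \<Rightarrow> 'e \<Rightarrow> 'p" where
  "chart_inv c = inv_into (fst c) (snd c)"

definition topological_chart :: "'p topology \<Rightarrow> ('p, 'e::euclidean_space) chart \<Rightarrow> bool" where
  "topological_chart T c \<longleftrightarrow> openin T (fst c) \<and> open (snd c ` fst c) \<and>
     homeomorphic_map (subtopology T (fst c)) (top_of_set (snd c ` fst c)) (snd c)"

definition compatible :: "('p, 'e::euclidean_space) chart \<Rightarrow> ('p, 'e) chart \<Rightarrow> bool" where
  "compatible c d \<longleftrightarrow>
     smooth_on (snd c ` (fst c \<inter> fst d)) (\<lambda>x. snd d (chart_inv c x)) \<and>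
     smooth_on (snd d ` (fst c \<inter> fst d)) (\<lambda>x. snd c (chart_inv d x))"

text \<open>The atlas of a manifold is the maximal one.\<close>

definition smooth_manifold :: "'p topology \<Rightarrow> ('p, 'e::euclidean_space) chart set \<Rightarrow> bool" where
  "smooth_manifold T A \<longleftrightarrow>
     Hausdorff_space T \<and> second_countable T \<and>
     \<Union>(fst ` A) = topspace T \<and>
     (\<forall>c\<in>A. topological_chart T c) \<and>
     (\<forall>c\<in>A. \<forall>d\<in>A. compatible c d) \<and>
     (\<forall>c. topological_chart T c \<and> (\<forall>d\<in>A. compatible c d) \<longrightarrow> c \<in> A)"

text \<open>Smoothness on an open subset \<open>S\<close> of the source. The coordinate maps in \<open>B\<close> may also take
  values in a proper linear subspace of \<open>'f\<close>, as happens for the charts on second order jets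
  below.\<close>

definition smooth_map ::
  "('p, 'e::real_normed_vector) chart set \<Rightarrow> ('q, 'f::real_normed_vector) chart set \<Rightarrow>
   'p set \<Rightarrow> ('p \<Rightarrow> 'q) \<Rightarrow> bool" where
  "smooth_map A B S f \<longleftrightarrow>
     (\<forall>p\<in>S. \<exists>c\<in>A. \<exists>d\<in>B. \<exists>W. p \<in> fst c \<and> open W \<and> snd c p \<in> W \<and> W \<subseteq> snd c ` fst c \<and>
        (\<forall>x\<in>W. f (chart_inv c x) \<in> fst d) \<and> smooth_on W (\<lambda>x. snd d (f (chart_inv c x))))"

abbreviation real_chart :: "(real, real) chart" where
  "real_chart \<equiv> (UNIV, \<lambda>x. x)"

text \<open>A tangent vector at \<open>p\<close> is given by its components in all charts around \<open>p\<close>, which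
  transform by the Jacobians of the changes of coordinates; it is extended by zero to the other
  charts.\<close>

type_synonym ('p, 'e) tvec = "('p, 'e) chart \<Rightarrow> 'e"

definition tangent_space ::
  "('p, 'e::real_normed_vector) chart set \<Rightarrow> 'p \<Rightarrow> ('p, 'e) tvec set" where
  "tangent_space A p = {v.
     (\<forall>c\<in>A. \<forall>d\<in>A. p \<in> fst c \<and> p \<in> fst d \<longrightarrow>
        v d = frechet_derivative (\<lambda>x. snd d (chart_inv c x)) (at (snd c p)) (v c)) \<and>
     (\<forall>c. \<not> (c \<in> A \<and> p \<in> fst c) \<longrightarrow> v c = 0)}"

text \<open>The differential at \<open>p\<close> of a map \<open>f\<close>; the result does not depend on the source chart
  \<open>c\<close>.\<close>

definition differential ::
  "('p, 'e::real_normed_vector) chart set \<Rightarrow> ('q, 'f::real_normed_vector) chart set \<Rightarrow>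
   ('p \<Rightarrow> 'q) \<Rightarrow> 'p \<Rightarrow> ('p, 'e) tvec \<Rightarrow> ('q, 'f) tvec" where
  "differential A B f p v = (\<lambda>d.
     if d \<in> B \<and> f p \<in> fst d then
       (let c = (SOME c. c \<in> A \<and> p \<in> fst c)
        in frechet_derivative (\<lambda>x. snd d (f (chart_inv c x))) (at (snd c p)) (v c))
     else 0)"

definition apply_tvec ::
  "('p, 'e::real_normed_vector) chart set \<Rightarrow> 'p \<Rightarrow> ('p, 'e) tvec \<Rightarrow> ('p \<Rightarrow> real) \<Rightarrow> real" where
  "apply_tvec A p v f = differential A {real_chart} f p v real_chart"

definition velocity :: "('p, 'e::real_normed_vector) chart set \<Rightarrow> (real \<Rightarrow> 'p) \<Rightarrow> ('p, 'e) tvec" where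
  "velocity A \<gamma> = (\<lambda>c. if c \<in> A \<and> \<gamma> 0 \<in> fst c
                        then vector_derivative (\<lambda>t. snd c (\<gamma> t)) (at 0) else 0)"

text \<open>The tangent space at \<open>q\<close> of an embedded submanifold with underlying set \<open>S\<close>, inside the
  tangent space of the ambient manifold.\<close>

definition tangent_to ::
  "('p, 'e::real_normed_vector) chart set \<Rightarrow> 'p set \<Rightarrow> 'p \<Rightarrow> ('p, 'e) tvec set" where
  "tangent_to A S q = {velocity A \<gamma> | \<gamma>. \<gamma> 0 = q \<and>
     (\<exists>\<epsilon>>0. \<gamma> ` {-\<epsilon><..<\<epsilon>} \<subseteq> S \<and>
        smooth_map {({-\<epsilon><..<\<epsilon>}, \<lambda>t. t)} A {-\<epsilon><..<\<epsilon>} \<gamma>)}"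


section \<open>Linear connections\<close>

definition smooth_vector_field ::
  "'p topology \<Rightarrow> ('p, 'e::real_normed_vector) chart set \<Rightarrow> 'p set \<Rightarrow> ('p \<Rightarrow> ('p, 'e) tvec) \<Rightarrow> bool"
  where
  "smooth_vector_field T A U X \<longleftrightarrow> openin T U \<and> (\<forall>p\<in>U. X p \<in> tangent_space A p) \<and>
     (\<forall>c\<in>A. smooth_on (snd c ` (U \<inter> fst c)) (\<lambda>x. X (chart_inv c x) c))"

text \<open>\<open>D p v Y\<close> is the covariant derivative of the vector field \<open>Y\<close>, defined near \<open>p\<close>, along the
  tangent vector \<open>v\<close> at \<open>p\<close>. Connections act on local fields, and by the locality clause
  \<open>D p v Y\<close> only depends on the germ of \<open>Y\<close> at \<open>p\<close>.\<close>

type_synonym ('p, 'e) covariant_derivative =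
  "'p \<Rightarrow> ('p, 'e) tvec \<Rightarrow> ('p \<Rightarrow> ('p, 'e) tvec) \<Rightarrow> ('p, 'e) tvec"

definition linear_connection ::
  "'p topology \<Rightarrow> ('p, 'e::real_normed_vector) chart set \<Rightarrow> ('p, 'e) covariant_derivative \<Rightarrow> bool"
  where
  "linear_connection T A D \<longleftrightarrow>
     (\<forall>U X Y. smooth_vector_field T A U X \<and> smooth_vector_field T A U Y \<longrightarrow>
        smooth_vector_field T A U (\<lambda>p. D p (X p) Y)) \<and>
     (\<forall>p U Y. p \<in> U \<and> smooth_vector_field T A U Y \<longrightarrow>
        (\<forall>v\<in>tangent_space A p. D p v Y \<in> tangent_space A p) \<and>
        (\<forall>v\<in>tangent_space A p. \<forall>w\<in>tangent_space A p. \<forall>a b.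
           D p (\<lambda>c. a *\<^sub>R v c + b *\<^sub>R w c) Y = (\<lambda>c. a *\<^sub>R D p v Y c + b *\<^sub>R D p w Y c)) \<and>
        (\<forall>Z. \<forall>v\<in>tangent_space A p. smooth_vector_field T A U Z \<longrightarrow>
           D p v (\<lambda>q c. Y q c + Z q c) = (\<lambda>c. D p v Y c + D p v Z c)) \<and>
        (\<forall>f. \<forall>v\<in>tangent_space A p. smooth_map A {real_chart} U f \<longrightarrow>
           D p v (\<lambda>q c. f q *\<^sub>R Y q c) = (\<lambda>c. apply_tvec A p v f *\<^sub>R Y p c + f p *\<^sub>R D p v Y c)) \<and>
        (\<forall>Z. \<forall>v\<in>tangent_space A p. smooth_vector_field T A U Z \<and> (\<forall>q\<in>U. Y q = Z q) \<longrightarrow>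
           D p v Y = D p v Z))"

definition lie_bracket ::
  "('p, 'e::real_normed_vector) chart set \<Rightarrow> ('p \<Rightarrow> ('p, 'e) tvec) \<Rightarrow> ('p \<Rightarrow> ('p, 'e) tvec) \<Rightarrow>
   'p \<Rightarrow> ('p, 'e) tvec" where
  "lie_bracket A X Y p = (\<lambda>c. if c \<in> A \<and> p \<in> fst c then
       frechet_derivative (\<lambda>x. Y (chart_inv c x) c) (at (snd c p)) (X p c)
     - frechet_derivative (\<lambda>x. X (chart_inv c x) c) (at (snd c p)) (Y p c) else 0)"

definition torsion_free ::
  "'p topology \<Rightarrow> ('p, 'e::real_normed_vector) chart set \<Rightarrow> ('p, 'e) covariant_derivative \<Rightarrow> bool"
  where
  "torsion_free T A D \<longleftrightarrow>
     (\<forall>U X Y. smooth_vector_field T A U X \<and> smooth_vector_field T A U Y \<longrightarrow>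
        (\<forall>p\<in>U. (\<lambda>c. D p (X p) Y c - D p (Y p) X c) = lie_bracket A X Y p))"

definition coord_field ::
  "('p, real^'k::finite) chart set \<Rightarrow> ('p, real^'k) chart \<Rightarrow> 'k \<Rightarrow> 'p \<Rightarrow> ('p, real^'k) tvec" where
  "coord_field A c a p = (\<lambda>d. if d \<in> A \<and> p \<in> fst d
     then frechet_derivative (\<lambda>x. snd d (chart_inv c x)) (at (snd c p)) (axis a 1) else 0)"

text \<open>\<open>christoffel A D c a k b p\<close> is \<open>\<Gamma>\<^sub>a\<^sup>k\<^sub>b\<close> at \<open>p\<close> in the chart \<open>c\<close>.\<close>

definition christoffel ::
  "('p, real^'k::finite) chart set \<Rightarrow> ('p, real^'k) covariant_derivative \<Rightarrow> ('p, real^'k) chart \<Rightarrow>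
   'k \<Rightarrow> 'k \<Rightarrow> 'k \<Rightarrow> 'p \<Rightarrow> real" where
  "christoffel A D c a k b p = D p (coord_field A c a p) (coord_field A c b) c $ k"


section \<open>Jets of submanifolds\<close>

text \<open>The coordinates are indexed by \<open>'n + 'm\<close>, with \<open>n = CARD('n)\<close> and \<open>m = CARD('m)\<close>; \<open>Inl\<close> marks
  the Greek indices and \<open>Inr\<close> the lower-case Latin ones.\<close>

type_synonym ('p, 'n, 'm) echart = "('p, real^('n + 'm)) chart"

definition greek :: "real^('n::finite + 'm::finite) \<Rightarrow> real^'n" where
  "greek x = (\<chi> l. x $ Inl l)"

definition latin :: "real^('n::finite + 'm::finite) \<Rightarrow> real^'m" where
  "latin x = (\<chi> i. x $ Inr i)"

text \<open>In the chart \<open>c\<close> and near \<open>p\<close>, the set \<open>L\<close> is the graph \<open>u\<^sup>i = f\<^sup>i(u\<^sup>\<lambda>)\<close>.\<close>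

definition local_graph ::
  "('p, 'n::finite, 'm::finite) echart set \<Rightarrow> ('p, 'n, 'm) echart \<Rightarrow> (real^'n \<Rightarrow> real^'m) \<Rightarrow>
   'p set \<Rightarrow> 'p \<Rightarrow> bool" where
  "local_graph A c f L p \<longleftrightarrow> c \<in> A \<and> p \<in> fst c \<and> p \<in> L \<and>
     (\<exists>W. open W \<and> snd c p \<in> W \<and> W \<subseteq> snd c ` fst c \<and> smooth_on (greek ` W) f \<and>
        (\<forall>x\<in>W. chart_inv c x \<in> L \<longleftrightarrow> latin x = f (greek x)))"

text \<open>Embedded submanifolds of dimension \<open>n\<close>.\<close>

definition submanifold :: "('p, 'n::finite, 'm::finite) echart set \<Rightarrow> 'p set \<Rightarrow> bool" where
  "submanifold A L \<longleftrightarrow> (\<forall>p\<in>L. \<exists>c f. local_graph A c f L p)"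

text \<open>Multi-indices are lists of Greek indices, whose order is immaterial for smooth functions.\<close>

fun partial :: "'n list \<Rightarrow> (real^'n::finite \<Rightarrow> real) \<Rightarrow> real^'n \<Rightarrow> real" where
  "partial [] g = g"
| "partial (l # \<sigma>) g = (\<lambda>x. frechet_derivative (partial \<sigma> g) (at x) (axis l 1))"

definition contact ::
  "('p, 'n::finite, 'm::finite) echart set \<Rightarrow> nat \<Rightarrow> 'p \<Rightarrow> 'p set \<Rightarrow> 'p set \<Rightarrow> bool" where
  "contact A r p L L' \<longleftrightarrow> (\<exists>c f f'. local_graph A c f L p \<and> local_graph A c f' L' p \<and>
     (\<forall>\<sigma> i. length \<sigma> \<le> r \<longrightarrow>
        partial \<sigma> (\<lambda>x. f x $ i) (greek (snd c p)) = partial \<sigma> (\<lambda>x. f' x $ i) (greek (snd c p))))"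

text \<open>The class \<open>[L]\<^sup>r\<^sub>p\<close>, as a set of submanifolds pointed at \<open>p\<close>.\<close>

type_synonym 'p jet = "('p set \<times> 'p) set"

definition jet ::
  "('p, 'n::finite, 'm::finite) echart set \<Rightarrow> nat \<Rightarrow> 'p set \<Rightarrow> 'p \<Rightarrow> 'p jet" where
  "jet A r L p = {(L', p'). p' = p \<and> submanifold A L' \<and> contact A r p L L'}"

definition jets :: "('p, 'n::finite, 'm::finite) echart set \<Rightarrow> nat \<Rightarrow> 'p jet set" where
  "jets A r = {jet A r L p | L p. submanifold A L \<and> p \<in> L}"

text \<open>Operations on classes are taken over all representatives, in the style of quotients. The
  projection onto \<open>J\<^sup>h\<close>, for \<open>h\<close> not above the order of the jet; \<open>J\<^sup>0\<close> is identified with the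
  manifold itself, with \<open>base_point\<close> as projection.\<close>

definition jet_proj :: "('p, 'n::finite, 'm::finite) echart set \<Rightarrow> nat \<Rightarrow> 'p jet \<Rightarrow> 'p jet" where
  "jet_proj A h \<theta> = (\<Union>(L, p)\<in>\<theta>. jet A h L p)"

definition base_point :: "'p jet \<Rightarrow> 'p" where
  "base_point \<theta> = (THE p. \<exists>L. (L, p) \<in> \<theta>)"

definition jet_dom ::
  "('p, 'n::finite, 'm::finite) echart set \<Rightarrow> nat \<Rightarrow> ('p, 'n, 'm) echart \<Rightarrow> 'p jet set" where
  "jet_dom A r c = {\<theta> \<in> jets A r. \<exists>L p f. (L, p) \<in> \<theta> \<and> local_graph A c f L p}"

text \<open>The coordinate \<open>u\<^sup>i\<^sub>\<sigma>\<close>.\<close>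

definition jet_coord ::
  "('p, 'n::finite, 'm::finite) echart set \<Rightarrow> ('p, 'n, 'm) echart \<Rightarrow> 'm \<Rightarrow> 'n list \<Rightarrow>
   'p jet \<Rightarrow> real" where
  "jet_coord A c i \<sigma> \<theta> = (THE y. \<exists>L p f. (L, p) \<in> \<theta> \<and> local_graph A c f L p \<and>
     y = partial \<sigma> (\<lambda>x. f x $ i) (greek (snd c p)))"

type_synonym ('n, 'm) coord1 = "(real^('n + 'm)) \<times> (real^'n^'m)"
type_synonym ('n, 'm) coord2 = "(real^('n + 'm)) \<times> (real^'n^'m) \<times> (real^'n^'n^'m)"

definition jet1_chart ::
  "('p, 'n::finite, 'm::finite) echart set \<Rightarrow> ('p, 'n, 'm) echart \<Rightarrow>
   ('p jet, ('n, 'm) coord1) chart" where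
  "jet1_chart A c = (jet_dom A 1 c,
     \<lambda>\<theta>. (snd c (base_point \<theta>), \<chi> i l. jet_coord A c i [l] \<theta>))"

definition jet1_atlas ::
  "('p, 'n::finite, 'm::finite) echart set \<Rightarrow> ('p jet, ('n, 'm) coord1) chart set" where
  "jet1_atlas A = jet1_chart A ` A"

text \<open>All \<open>u\<^sup>i\<^sub>\<lambda>\<^sub>\<xi>\<close> are listed, so the coordinates lie in the linear subspace symmetric in \<open>\<lambda>\<close> and
  \<open>\<xi>\<close>. These charts are only used as targets of smooth maps.\<close>

definition jet2_chart ::
  "('p, 'n::finite, 'm::finite) echart set \<Rightarrow> ('p, 'n, 'm) echart \<Rightarrow>
   ('p jet, ('n, 'm) coord2) chart" where
  "jet2_chart A c = (jet_dom A 2 c,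
     \<lambda>\<theta>. (snd c (base_point \<theta>), \<chi> i l. jet_coord A c i [l] \<theta>, \<chi> i l \<xi>. jet_coord A c i [l, \<xi>] \<theta>))"

definition jet2_atlas ::
  "('p, 'n::finite, 'm::finite) echart set \<Rightarrow> ('p jet, ('n, 'm) coord2) chart set" where
  "jet2_atlas A = jet2_chart A ` A"

definition prolongation ::
  "('p, 'n::finite, 'm::finite) echart set \<Rightarrow> nat \<Rightarrow> 'p set \<Rightarrow> 'p jet set" where
  "prolongation A r L = jet A r L ` L"

text \<open>The \<open>R\<close>-planes of first order jets (with \<open>L\<^sup>(\<^sup>0\<^sup>) = L\<close>) and of second order jets.\<close>

definition R_plane1 ::
  "('p, 'n::finite, 'm::finite) echart set \<Rightarrow> 'p jet \<Rightarrow> ('p, real^('n + 'm)) tvec set" where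
  "R_plane1 A \<theta> = (\<Union>(L, p)\<in>\<theta>. tangent_to A L p)"

definition R_plane2 ::
  "('p, 'n::finite, 'm::finite) echart set \<Rightarrow> 'p jet \<Rightarrow> ('p jet, ('n, 'm) coord1) tvec set" where
  "R_plane2 A \<theta> = (\<Union>(L, p)\<in>\<theta>. tangent_to (jet1_atlas A) (prolongation A 1 L) (jet A 1 L p))"


section \<open>The equation of totally geodesic submanifolds\<close>

text \<open>The value at \<open>X, Y \<in> T\<^sub>pL\<close> of the second fundamental form, as an element of \<open>T\<^sub>pE / T\<^sub>pL\<close>,
  i.e. as a coset of \<open>T\<^sub>pL\<close>; \<open>Z\<close> ranges over the local extensions of \<open>Y\<close> tangent to \<open>L\<close>.\<close>

definition second_fundamental_form ::
  "'p topology \<Rightarrow> ('p, 'n::finite, 'm::finite) echart set \<Rightarrow>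
   ('p, real^('n + 'm)) covariant_derivative \<Rightarrow> 'p set \<Rightarrow> 'p \<Rightarrow>
   ('p, real^('n + 'm)) tvec \<Rightarrow> ('p, real^('n + 'm)) tvec \<Rightarrow> ('p, real^('n + 'm)) tvec set" where
  "second_fundamental_form T A D L p X Y = {w \<in> tangent_space A p.
     \<exists>U Z. p \<in> U \<and> smooth_vector_field T A U Z \<and> (\<forall>q\<in>U \<inter> L. Z q \<in> tangent_to A L q) \<and> Z p = Y \<and>
       (\<lambda>c. w c - D p X Z c) \<in> tangent_to A L p}"

definition totally_geodesic_equation ::
  "'p topology \<Rightarrow> ('p, 'n::finite, 'm::finite) echart set \<Rightarrow>
   ('p, real^('n + 'm)) covariant_derivative \<Rightarrow> 'p jet set" where
  "totally_geodesic_equation T A D = {jet A 2 L p | L p. submanifold A L \<and> p \<in> L \<and>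
     (\<forall>X\<in>tangent_to A L p. \<forall>Y\<in>tangent_to A L p.
        second_fundamental_form T A D L p X Y = tangent_to A L p)}"

definition grassmannian_equivalent ::
  "'p topology \<Rightarrow> ('p, 'n::finite, 'm::finite) echart set \<Rightarrow>
   ('p, real^('n + 'm)) covariant_derivative \<Rightarrow>
   ('p, real^('n + 'm)) covariant_derivative \<Rightarrow> bool" where
  "grassmannian_equivalent T A D D' \<longleftrightarrow>
     totally_geodesic_equation T A D = totally_geodesic_equation T A D'"


section \<open>The associated connection on first order jets and its section\<close>

definition dot_coeff ::
  "('p, 'n::finite, 'm::finite) echart set \<Rightarrow> ('p, real^('n + 'm)) covariant_derivative \<Rightarrow>
   ('p, 'n, 'm) echart \<Rightarrow> 'n + 'm \<Rightarrow> 'm \<Rightarrow> 'n \<Rightarrow> 'p jet \<Rightarrow> real" where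
  "dot_coeff A D c a k \<xi> \<theta> =
     (let \<Gamma> = (\<lambda>s b. christoffel A D c a s b (base_point \<theta>)); u = (\<lambda>i l. jet_coord A c i [l] \<theta>)
      in \<Gamma> (Inr k) (Inl \<xi>) + (\<Sum>i\<in>UNIV. \<Gamma> (Inr k) (Inr i) * u i \<xi>)
         - (\<Sum>\<beta>\<in>UNIV. u k \<beta> * (\<Gamma> (Inl \<beta>) (Inl \<xi>) + (\<Sum>i\<in>UNIV. \<Gamma> (Inl \<beta>) (Inr i) * u i \<xi>))))"

text \<open>The components along the \<open>\<partial>/\<partial>u\<^sup>k\<^sub>\<xi>\<close> of the vertical projection of a tangent vector \<open>W\<close> at
  \<open>\<theta>\<close>, in the chart on \<open>J\<^sup>1\<close> induced by \<open>c\<close>.\<close>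

definition vertical_projection ::
  "('p, 'n::finite, 'm::finite) echart set \<Rightarrow> ('p, real^('n + 'm)) covariant_derivative \<Rightarrow>
   ('p, 'n, 'm) echart \<Rightarrow> 'p jet \<Rightarrow> ('p jet, ('n, 'm) coord1) tvec \<Rightarrow> real^'n^'m" where
  "vertical_projection A D c \<theta> W = (\<chi> k \<xi>. snd (W (jet1_chart A c)) $ k $ \<xi> +
     (\<Sum>a\<in>UNIV. dot_coeff A D c a k \<xi> \<theta> * fst (W (jet1_chart A c)) $ a))"

definition horizontal_space ::
  "('p, 'n::finite, 'm::finite) echart set \<Rightarrow> ('p, real^('n + 'm)) covariant_derivative \<Rightarrow>
   'p jet \<Rightarrow> ('p jet, ('n, 'm) coord1) tvec set" where
  "horizontal_space A D \<theta> = {W \<in> tangent_space (jet1_atlas A) \<theta>.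
     \<forall>c\<in>A. \<theta> \<in> fst (jet1_chart A c) \<longrightarrow> vertical_projection A D c \<theta> W = 0}"

definition horizontal_lift ::
  "('p, 'n::finite, 'm::finite) echart set \<Rightarrow> ('p, real^('n + 'm)) covariant_derivative \<Rightarrow>
   'p jet \<Rightarrow> ('p, real^('n + 'm)) tvec set \<Rightarrow> ('p jet, ('n, 'm) coord1) tvec set" where
  "horizontal_lift A D \<theta> P =
     {W \<in> horizontal_space A D \<theta>. differential (jet1_atlas A) A base_point \<theta> W \<in> P}"

definition smooth_section21 ::
  "('p, 'n::finite, 'm::finite) echart set \<Rightarrow> ('p jet \<Rightarrow> 'p jet) \<Rightarrow> bool" where
  "smooth_section21 A s \<longleftrightarrow> s \<in> jets A 1 \<rightarrow>\<^sub>E jets A 2 \<and>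
     (\<forall>\<theta>\<in>jets A 1. jet_proj A 1 (s \<theta>) = \<theta>) \<and>
     smooth_map (jet1_atlas A) (jet2_atlas A) (jets A 1) s"

definition ddot ::
  "('p, 'n::finite, 'm::finite) echart set \<Rightarrow> ('p, real^('n + 'm)) covariant_derivative \<Rightarrow>
   'p jet \<Rightarrow> 'p jet" where
  "ddot A D = (THE s. smooth_section21 A s \<and>
     (\<forall>\<theta>\<in>jets A 1. R_plane2 A (s \<theta>) = horizontal_lift A D \<theta> (R_plane1 A \<theta>)))"

end

theory Submission
  imports Defs
begin

text \<open>
  Both sides of the equivalence are governed by the same object. In a chart, write a submanifold
  \<open>L\<close> through \<open>p\<close> as a graph \<open>u\<^sup>k = f\<^sup>k(u\<^sup>\<lambda>)\<close>. The second fundamental form of \<open>L\<close> vanishes at \<open>p\<close>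
  iff the second derivatives of \<open>f\<close> are \<open>- G\<^sup>k\<^sub>\<lambda>\<^sub>\<xi>(p, u)\<close>, where \<open>u\<close> is the slope of \<open>T\<^sub>pL\<close> and \<open>G\<close>
  is built from the Christoffel symbols (\<open>normal_form\<close>, \<open>geodesic_at_iff\<close>). The right-hand side only
  involves the first order jet, and it is symmetric in \<open>\<lambda>\<close> and \<open>\<xi>\<close> because the connection is
  torsion-free, so every first order jet \<open>\<theta>\<close> carries exactly one second order jet on which the
  equation holds: the class \<open>solutions \<theta>\<close>.

  On the other hand, a vector tangent to the prolongation of \<open>L\<close> over the direction \<open>\<xi>\<close> has vertical
  components \<open>\<partial>\<^sub>\<xi>\<partial>\<^sub>\<lambda>f\<^sup>k\<close>, while the contraction of the coefficients \<open>dot_coeff\<close> with that direction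
  is \<open>G\<^sup>k\<^sub>\<xi>\<^sub>\<lambda>\<close> (\<open>dot_coeff_sum\<close>). Hence the prolongation is tangent to the horizontal space at \<open>\<theta>\<close> iff
  \<open>L\<close> solves the equation (\<open>tangent_to_prolongation_geodesic\<close>, \<open>geodesic_at_if_horizontal\<close>). This
  identifies \<open>ddot A D\<close> with \<open>solutions\<close> (\<open>ddot_eq\<close>), and the equation of totally geodesic
  submanifolds with the image of \<open>ddot A D\<close> (\<open>totally_geodesic_equation_eq\<close>). A section of a
  projection is determined by its image, and the theorem follows.

  The Christoffel symbols and the second derivatives of graphs are never transformed from one chart
  to another. The vanishing of the second fundamental form is chart-free, and each chart in turn is
  compared with it. What does have to be chart-independent is first order: contact of
  order 1 is equality of tangent spaces, and a submanifold whose tangent space is transverse to the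
  fibres of a chart is a graph in that chart (\<open>local_graph_if_transverse\<close>). This rests on a smooth
  inverse function theorem, and it also gives the changes of charts on first order jets.
\<close>

section \<open>Calculus of smooth maps on open sets\<close>

abbreviation Der :: "('a::real_normed_vector \<Rightarrow> 'b::real_normed_vector) \<Rightarrow> 'a \<Rightarrow> 'a \<Rightarrow> 'b" where
  "Der f x \<equiv> frechet_derivative f (at x)"

lemma Der_eq: "(f has_derivative f') (at x) \<Longrightarrow> Der f x = f'"
  by (metis frechet_derivative_at)

lemma has_derivative_Der: "f differentiable (at x) \<Longrightarrow> (f has_derivative Der f x) (at x)"
  by (simp add: frechet_derivative_works[symmetric])

lemma Ck_on_subset: "Ck_on k S f \<Longrightarrow> S' \<subseteq> S \<Longrightarrow> Ck_on k S' f"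
  by (induction k arbitrary: f) (auto intro: continuous_on_subset)

lemma Ck_on_cong:
  assumes "open S" "\<And>x. x \<in> S \<Longrightarrow> f x = g x" "Ck_on k S f"
  shows "Ck_on k S g"
  using assms(2,3)
proof (induction k arbitrary: f g)
  case 0
  then show ?case by (metis Ck_on.simps(1) continuous_on_cong)
next
  case (Suc k)
  have df: "f differentiable (at x)" if "x \<in> S" for x using Suc.prems that by simp
  have "Ck_on k S (\<lambda>x. Der g x v)" for v
  proof (rule Suc.IH)
    show "Ck_on k S (\<lambda>x. Der f x v)" using Suc.prems by simp
    show "Der f x v = Der g x v" if "x \<in> S" for x
      using frechet_derivative_transform_within_open[OF df[OF that] \<open>open S\<close> that] Suc.prems(1)
          by simp
  qed
  moreover have "g differentiable (at x)" if "x \<in> S" for x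
    using df[OF that] Suc.prems(1) \<open>open S\<close> that
    by (meson differentiable_def has_derivative_transform_within_open)
  ultimately show ?case by simp
qed

lemma Ck_on_SucI:
  assumes "open S" "\<And>x. x \<in> S \<Longrightarrow> (f has_derivative f' x) (at x)" "\<And>v. Ck_on k S (\<lambda>x. f' x v)"
  shows "Ck_on (Suc k) S f"
proof -
  have "Ck_on k S (\<lambda>x. Der f x v)" for v
    by (rule Ck_on_cong[OF assms(1) _ assms(3)[of v]]) (simp add: Der_eq[OF assms(2)])
  then show ?thesis using assms(2) by (auto simp: differentiable_def)
qed

lemma Ck_on_Suc_has_derivative:
  "Ck_on (Suc k) S f \<Longrightarrow> x \<in> S \<Longrightarrow> (f has_derivative Der f x) (at x)"
  using frechet_derivative_works by auto

lemma Ck_on_Suc_imp_Ck_on: "Ck_on (Suc k) S f \<Longrightarrow> Ck_on k S f"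
proof (induction k arbitrary: f)
  case 0
  then show ?case
    by (simp add: continuous_at_imp_continuous_on differentiable_imp_continuous_within)
next
  case (Suc k)
  have "Ck_on k S (\<lambda>x. Der f x v)" for v
    using Suc.IH Suc.prems Ck_on.simps(2)[of "Suc k" S f] by blast
  then show ?case using Suc.prems Ck_on.simps(2)[of "Suc k" S f] Ck_on.simps(2)[of k S f] by blast
qed

lemma Ck_on_const: "Ck_on k S (\<lambda>x. c)"
proof (induction k arbitrary: c)
  case (Suc k)
  show ?case by (simp add: Suc)
qed simp

lemma Ck_on_bounded_linear:
  assumes "open S" "bounded_linear h" "Ck_on k S f"
  shows "Ck_on k S (\<lambda>x. h (f x))"
  using assms(3)
proof (induction k arbitrary: f)
  case 0
  then show ?case
    by (simp add: bounded_linear.continuous_on[OF assms(2)])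
next
  case (Suc k)
  show ?case
  proof (rule Ck_on_SucI[OF assms(1)])
    show "((\<lambda>x. h (f x)) has_derivative (\<lambda>v. h (Der f x v))) (at x)" if "x \<in> S" for x
      using bounded_linear.has_derivative[OF assms(2) Ck_on_Suc_has_derivative[OF Suc.prems that]] .
    show "Ck_on k S (\<lambda>x. h (Der f x v))" for v
      using Suc.IH Suc.prems by simp
  qed
qed

lemma Ck_on_ident: "open S \<Longrightarrow> Ck_on k S (\<lambda>x. x)"
  by (cases k) (auto intro!: Ck_on_SucI[where f' = "\<lambda>x v. v"] Ck_on_const continuous_on_id)

lemma Ck_on_add:
  assumes "open S" "Ck_on k S f" "Ck_on k S g"
  shows "Ck_on k S (\<lambda>x. f x + g x)"
  using assms(2,3)
proof (induction k arbitrary: f g)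
  case 0
  then show ?case by (simp add: continuous_on_add)
next
  case (Suc k)
  show ?case
  proof (rule Ck_on_SucI[OF assms(1)])
    show "((\<lambda>x. f x + g x) has_derivative (\<lambda>v. Der f x v + Der g x v)) (at x)" if "x \<in> S" for x
      by (intro has_derivative_add Ck_on_Suc_has_derivative[OF _ that]; fact Suc.prems)
    show "Ck_on k S (\<lambda>x. Der f x v + Der g x v)" for v
      using Suc by simp
  qed
qed

lemma Ck_on_sum:
  assumes "open S" "\<And>i. i \<in> I \<Longrightarrow> Ck_on k S (f i)"
  shows "Ck_on k S (\<lambda>x. \<Sum>i\<in>I. f i x)"
  using assms(2)
  by (induction I rule: infinite_finite_induct) (auto intro: Ck_on_const Ck_on_add[OF assms(1)])

lemma Ck_on_bounded_bilinear:
  assumes "open S" "bounded_bilinear b" "Ck_on k S f" "Ck_on k S g"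
  shows "Ck_on k S (\<lambda>x. b (f x) (g x))"
  using assms(3,4)
proof (induction k arbitrary: f g)
  case 0
  then show ?case by (simp add: bounded_bilinear.continuous_on[OF assms(2)])
next
  case (Suc k)
  note c = Ck_on_Suc_imp_Ck_on[OF Suc.prems(1)] Ck_on_Suc_imp_Ck_on[OF Suc.prems(2)]
  show ?case
  proof (rule Ck_on_SucI[OF assms(1)])
    show "((\<lambda>x. b (f x) (g x)) has_derivative
        (\<lambda>v. b (f x) (Der g x v) + b (Der f x v) (g x))) (at x)"
      if "x \<in> S" for x
      by (intro bounded_bilinear.FDERIV[OF assms(2)] Ck_on_Suc_has_derivative[OF _ that]; fact
          Suc.prems)
    show "Ck_on k S (\<lambda>x. b (f x) (Der g x v) + b (Der f x v) (g x))" for v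
      using Suc c by (intro Ck_on_add[OF assms(1)] Suc.IH) auto
  qed
qed

lemmas Ck_on_scaleR = Ck_on_bounded_bilinear[OF _ bounded_bilinear_scaleR]
lemmas Ck_on_mult = Ck_on_bounded_bilinear[OF _ bounded_bilinear_mult]

lemma Ck_on_prod:
  fixes f :: "'i \<Rightarrow> 'a::real_normed_vector \<Rightarrow> real"
  assumes "open S" "\<And>i. i \<in> I \<Longrightarrow> Ck_on k S (f i)"
  shows "Ck_on k S (\<lambda>x. \<Prod>i\<in>I. f i x)"
  using assms(2)
  by (induction I rule: infinite_finite_induct) (auto intro: Ck_on_const Ck_on_mult[OF assms(1)])

lemma Ck_on_inverse:
  fixes f :: "'a::real_normed_vector \<Rightarrow> real"
  assumes "open S" "\<And>x. x \<in> S \<Longrightarrow> f x \<noteq> 0" "Ck_on k S f"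
  shows "Ck_on k S (\<lambda>x. inverse (f x))"
  using assms(3)
proof (induction k)
  case 0
  then show ?case using assms by (simp add: continuous_on_inverse)
next
  case (Suc k)
  have c: "Ck_on k S (\<lambda>x. inverse (f x))"
    using Suc Ck_on_Suc_imp_Ck_on by blast
  show ?case
  proof (rule Ck_on_SucI[OF assms(1)])
    show "((\<lambda>x. inverse (f x)) has_derivative
        (\<lambda>v. (- 1) * (inverse (f x) * Der f x v * inverse (f x)))) (at x)"
      if "x \<in> S" for x
      using Deriv.has_derivative_inverse[OF assms(2)[OF that] Ck_on_Suc_has_derivative[OF Suc.prems
          that]] by simp
    show "Ck_on k S (\<lambda>x. (- 1) * (inverse (f x) * Der f x v * inverse (f x)))" for v
      using Suc.prems by (intro Ck_on_mult[OF assms(1)] Ck_on_const c) auto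
  qed
qed

text \<open>The derivative of a composite is written in a basis of the intermediate space, so that the
  induction only meets directional derivatives.\<close>

lemma Ck_on_compose:
  fixes f :: "'a::real_normed_vector \<Rightarrow> 'b::euclidean_space" and g :: "'b \<Rightarrow> 'c::real_normed_vector"
  assumes "open S" "open R" "f ` S \<subseteq> R" "Ck_on k S f" "Ck_on k R g"
  shows "Ck_on k S (\<lambda>x. g (f x))"
  using assms(4,5)
proof (induction k arbitrary: g)
  case 0
  then show ?case using assms(3) by (auto intro: continuous_on_compose2)
next
  case (Suc k)
  have cf: "Ck_on k S f" using Suc.prems(1) by (rule Ck_on_Suc_imp_Ck_on)
  show ?case
  proof (rule Ck_on_SucI[OF assms(1)])
    fix x assume x: "x \<in> S"
    then have fx: "f x \<in> R" using assms(3) by auto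
    have dg: "(g has_derivative Der g (f x)) (at (f x))"
      using Ck_on_Suc_has_derivative[OF Suc.prems(2) fx] .
    interpret dg: bounded_linear "Der g (f x)" using dg by (rule has_derivative_bounded_linear)
    have chain: "((\<lambda>x. g (f x)) has_derivative (\<lambda>v. Der g (f x) (Der f x v))) (at x)"
      using diff_chain_at[OF Ck_on_Suc_has_derivative[OF Suc.prems(1) x] dg] by (simp add: o_def)
    have "Der g (f x) w = (\<Sum>b\<in>Basis. (w \<bullet> b) *\<^sub>R Der g (f x) b)" for w
    proof -
      have "Der g (f x) w = Der g (f x) (\<Sum>b\<in>Basis. (w \<bullet> b) *\<^sub>R b)"
        by (simp add: euclidean_representation)
      then show ?thesis by (simp add: dg.sum dg.scaleR)
    qed
    then have rep: "(\<lambda>v. Der g (f x) (Der f x v)) =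
        (\<lambda>v. \<Sum>b\<in>Basis. (Der f x v \<bullet> b) *\<^sub>R Der g (f x) b)"
      by (rule ext)
    show "((\<lambda>x. g (f x)) has_derivative
        (\<lambda>v. \<Sum>b\<in>Basis. (Der f x v \<bullet> b) *\<^sub>R Der g (f x) b)) (at x)"
      using chain unfolding rep .
  next
    fix v
    show "Ck_on k S (\<lambda>x. \<Sum>b\<in>Basis. (Der f x v \<bullet> b) *\<^sub>R Der g (f x) b)"
      using Suc.prems cf
      by (intro Ck_on_sum Ck_on_scaleR Suc.IH assms(1)
          Ck_on_bounded_linear[OF _ bounded_linear_inner_left]) auto
  qed
qed

lemma smooth_on_subset: "smooth_on S f \<Longrightarrow> S' \<subseteq> S \<Longrightarrow> smooth_on S' f"
  by (auto simp: smooth_on_def intro: Ck_on_subset)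

lemma smooth_on_cong:
  "open S \<Longrightarrow> (\<And>x. x \<in> S \<Longrightarrow> f x = g x) \<Longrightarrow> smooth_on S f \<Longrightarrow> smooth_on S g"
  unfolding smooth_on_def using Ck_on_cong by blast

lemma smooth_on_has_derivative:
  "smooth_on S f \<Longrightarrow> x \<in> S \<Longrightarrow> (f has_derivative Der f x) (at x)"
  unfolding smooth_on_def using Ck_on_Suc_has_derivative by blast

lemma smooth_on_differentiable: "smooth_on S f \<Longrightarrow> x \<in> S \<Longrightarrow> f differentiable (at x)"
  using smooth_on_has_derivative by (auto simp: differentiable_def)

lemma smooth_on_continuous_on: "smooth_on S f \<Longrightarrow> continuous_on S f"
  unfolding smooth_on_def by (metis Ck_on.simps(1))

lemma smooth_on_Der: "smooth_on S f \<Longrightarrow> smooth_on S (\<lambda>x. Der f x v)"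
  unfolding smooth_on_def by (metis Ck_on.simps(2))

lemma smooth_on_const: "smooth_on S (\<lambda>x. c)"
  by (simp add: smooth_on_def Ck_on_const)

lemma smooth_on_ident: "open S \<Longrightarrow> smooth_on S (\<lambda>x. x)"
  by (simp add: smooth_on_def Ck_on_ident)

lemma smooth_on_bounded_linear:
  "open S \<Longrightarrow> bounded_linear h \<Longrightarrow> smooth_on S f \<Longrightarrow> smooth_on S (\<lambda>x. h (f x))"
  by (simp add: smooth_on_def Ck_on_bounded_linear)

lemma smooth_on_add:
  "open S \<Longrightarrow> smooth_on S f \<Longrightarrow> smooth_on S g \<Longrightarrow> smooth_on S (\<lambda>x. f x + g x)"
  by (simp add: smooth_on_def Ck_on_add)

lemma smooth_on_sum:
  "open S \<Longrightarrow> (\<And>i. i \<in> I \<Longrightarrow> smooth_on S (f i)) \<Longrightarrow> smooth_on S (\<lambda>x. \<Sum>i\<in>I. f i x)"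
  by (simp add: smooth_on_def Ck_on_sum)

lemma smooth_on_mult:
  fixes f g :: "'a::real_normed_vector \<Rightarrow> real"
  shows "open S \<Longrightarrow> smooth_on S f \<Longrightarrow> smooth_on S g \<Longrightarrow> smooth_on S (\<lambda>x. f x * g x)"
  by (simp add: smooth_on_def Ck_on_mult)

lemma smooth_on_scaleR:
  "open S \<Longrightarrow> smooth_on S f \<Longrightarrow> smooth_on S g \<Longrightarrow> smooth_on S (\<lambda>x. f x *\<^sub>R g x)"
  by (simp add: smooth_on_def Ck_on_scaleR)

lemma smooth_on_minus:
  "open S \<Longrightarrow> smooth_on S f \<Longrightarrow> smooth_on S (\<lambda>x. - f x)"
  by (rule smooth_on_bounded_linear[OF _ bounded_linear_minus[OF bounded_linear_ident]])

lemma smooth_on_diff: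
  "open S \<Longrightarrow> smooth_on S f \<Longrightarrow> smooth_on S g \<Longrightarrow> smooth_on S (\<lambda>x. f x - g x)"
  using smooth_on_add[OF _ _ smooth_on_minus, of S f g] by simp

lemma smooth_on_compose:
  fixes f :: "'a::real_normed_vector \<Rightarrow> 'b::euclidean_space"
  shows "open S \<Longrightarrow> open R \<Longrightarrow> f ` S \<subseteq> R \<Longrightarrow> smooth_on S f \<Longrightarrow> smooth_on R g \<Longrightarrow> smooth_on S (\<lambda>x. g (f x))"
  by (simp add: smooth_on_def Ck_on_compose)

lemma smooth_on_divide:
  fixes f g :: "'a::real_normed_vector \<Rightarrow> real"
  assumes "open S" "smooth_on S f" "smooth_on S g" "\<And>x. x \<in> S \<Longrightarrow> g x \<noteq> 0"
  shows "smooth_on S (\<lambda>x. f x / g x)"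
  using assms by (simp add: smooth_on_def divide_inverse Ck_on_mult Ck_on_inverse)

lemma Ck_on_Pair:
  assumes "open S" "Ck_on k S f" "Ck_on k S g"
  shows "Ck_on k S (\<lambda>x. (f x, g x))"
proof -
  have "Ck_on k S (\<lambda>x. (f x, 0) + (0, g x))"
    by (intro Ck_on_add assms Ck_on_bounded_linear[where h = "\<lambda>y. (y, 0)"]
        Ck_on_bounded_linear[where h = "\<lambda>y. (0, y)"])
      (auto intro!: bounded_linear_Pair bounded_linear_ident bounded_linear_zero)
  then show ?thesis by simp
qed

lemma smooth_on_Pair:
  "open S \<Longrightarrow> smooth_on S f \<Longrightarrow> smooth_on S g \<Longrightarrow> smooth_on S (\<lambda>x. (f x, g x))"
  by (simp add: smooth_on_def Ck_on_Pair)

lemma bounded_linear_axis: "bounded_linear (\<lambda>y::'a::real_normed_vector. axis i y :: 'a^'k::finite)"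
proof
  have "norm (axis i x :: 'a^'k) = norm x" for x
    by (simp add: norm_vec_def L2_set_def axis_def if_distrib[of norm] if_distrib[of "\<lambda>x. x\<^sup>2"]
        cong: if_cong)
  then show "\<exists>K. \<forall>x. norm (axis i x :: 'a^'k) \<le> norm x * K"
    by (metis mult.right_neutral order_refl)
qed (auto simp: axis_def vec_eq_iff)

lemma Ck_on_vec:
  fixes f :: "'k::finite \<Rightarrow> 'a::real_normed_vector \<Rightarrow> 'b::real_normed_vector"
  assumes "open S" "\<And>i. Ck_on k S (f i)"
  shows "Ck_on k S (\<lambda>x. \<chi> i. f i x)"
proof -
  have "(\<lambda>x. \<chi> i. f i x) = (\<lambda>x. \<Sum>i\<in>UNIV. axis i (f i x))"
    by (auto simp: vec_eq_iff axis_def if_distrib cong: if_cong)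
  then show ?thesis
    using assms by (auto intro!: Ck_on_sum Ck_on_bounded_linear[OF _ bounded_linear_axis])
qed

lemma smooth_on_vec:
  fixes f :: "'k::finite \<Rightarrow> 'a::real_normed_vector \<Rightarrow> 'b::real_normed_vector"
  shows "open S \<Longrightarrow> (\<And>i. smooth_on S (f i)) \<Longrightarrow> smooth_on S (\<lambda>x. \<chi> i. f i x)"
  by (simp add: smooth_on_def Ck_on_vec)

lemma has_derivative_vec:
  fixes f :: "'k::finite \<Rightarrow> 'a::real_normed_vector \<Rightarrow> 'b::real_normed_vector"
  assumes "\<And>i. (f i has_derivative f' i) (at x)"
  shows "((\<lambda>x. \<chi> i. f i x) has_derivative (\<lambda>h. \<chi> i. f' i h)) (at x)"
proof -
  have *: "(\<lambda>x. \<chi> i. g i x) = (\<lambda>x. \<Sum>i\<in>UNIV. axis i (g i x))" for g :: "'k \<Rightarrow> 'a \<Rightarrow> 'b"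
    by (auto simp: vec_eq_iff axis_def if_distrib cong: if_cong)
  show ?thesis
    unfolding * by (intro has_derivative_sum bounded_linear.has_derivative[OF bounded_linear_axis]
        assms)
qed

lemma smooth_on_nth: "open S \<Longrightarrow> smooth_on S f \<Longrightarrow> smooth_on S (\<lambda>x. f x $ i)"
  by (rule smooth_on_bounded_linear[OF _ bounded_linear_vec_nth])

lemma Ck_on_det:
  fixes M :: "'a::real_normed_vector \<Rightarrow> 'k::finite \<Rightarrow> 'k \<Rightarrow> real"
  assumes "open S" "\<And>i j. Ck_on k S (\<lambda>x. M x i j)"
  shows "Ck_on k S (\<lambda>x. det (\<chi> i j. M x i j))"
  unfolding det_def using assms
  by (auto intro!: Ck_on_sum Ck_on_mult Ck_on_prod Ck_on_const)

lemma smooth_on_det: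
  fixes M :: "'a::real_normed_vector \<Rightarrow> 'k::finite \<Rightarrow> 'k \<Rightarrow> real"
  shows "open S \<Longrightarrow> (\<And>i j. smooth_on S (\<lambda>x. M x i j)) \<Longrightarrow> smooth_on S (\<lambda>x. det (\<chi> i j. M x i j))"
  by (simp add: smooth_on_def Ck_on_det)

lemma linear_Der: "f differentiable (at x) \<Longrightarrow> linear (Der f x)"
  by (rule linear_frechet_derivative)

lemma linear_axis_sum:
  fixes f :: "real^'k::finite \<Rightarrow> 'b::real_vector"
  assumes "linear f"
  shows "f v = (\<Sum>a\<in>UNIV. v $ a *\<^sub>R f (axis a 1))"
proof -
  have "f v = f (\<Sum>a\<in>UNIV. v $ a *\<^sub>R axis a 1)"
    by (metis basis_expansion scalar_mult_eq_scaleR)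
  then show ?thesis using assms by (simp add: linear_sum linear_cmul)
qed

section \<open>The smooth inverse function theorem\<close>

text \<open>By Cramer's rule the derivative of a local inverse \<open>g\<close> is a rational expression in the
  derivative of \<open>f\<close> along \<open>g\<close>, so \<open>g\<close> gains one order of differentiability over itself.\<close>

lemma smooth_on_local_inverse:
  fixes f :: "real^'k::finite \<Rightarrow> real^'k"
  assumes S: "open S" "smooth_on S f" and V: "open V"
    and hom: "g ` V \<subseteq> S" "\<And>y. y \<in> V \<Longrightarrow> f (g y) = y"
    and dg: "\<And>y. y \<in> V \<Longrightarrow> g differentiable (at y)"
  shows "smooth_on V g"
proof -
  define J where "J = (\<lambda>y. (\<chi> i j. Der f (g y) (axis j 1) $ i) :: real^'k^'k)"
  have J: "J y *v v = Der f (g y) v" if "y \<in> V" for y v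
  proof -
    have "f differentiable (at (g y))"
      using hom that S smooth_on_differentiable by blast
    then have "linear (Der f (g y))" by (rule linear_Der)
    then have "J y = matrix (Der f (g y))" by (simp add: J_def matrix_def)
    then show ?thesis using \<open>linear (Der f (g y))\<close> by (simp add: matrix_works)
  qed
  have inv: "J y *v Der g y v = v" if "y \<in> V" for y v
  proof -
    have "f differentiable (at (g y))"
      using hom that S smooth_on_differentiable by blast
    then have "((\<lambda>y. f (g y)) has_derivative (\<lambda>v. Der f (g y) (Der g y v))) (at y)"
      using diff_chain_at[of g "Der g y" y f "Der f (g y)"] dg[OF that] frechet_derivative_works
      by (auto simp: o_def)
    moreover have "((\<lambda>y. f (g y)) has_derivative (\<lambda>v. v)) (at y)"
      by (rule has_derivative_transform_within_open[of "\<lambda>x. x" _ _ _ V]) (auto simp: V that hom)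
    ultimately have "(\<lambda>v. Der f (g y) (Der g y v)) = (\<lambda>v. v)"
      by (rule has_derivative_unique)
    then show ?thesis by (simp add: J that fun_eq_iff)
  qed
  have det: "det (J y) \<noteq> 0" if "y \<in> V" for y
  proof -
    have "surj ((*v) (J y))" using inv[OF that] by (metis surj_def)
    then obtain B where "J y ** B = mat 1" using matrix_right_invertible_surjective by blast
    then show ?thesis by (metis det_I det_mul mult_zero_left zero_neq_one)
  qed
  have "Ck_on k V g" for k
  proof (induction k)
    case 0
    then show ?case using dg by (simp add: continuous_at_imp_continuous_on
        differentiable_imp_continuous_within)
  next
    case (Suc k)
    have "Ck_on k V (\<lambda>y. Der f (g y) (axis j 1) $ i)" for i j
      by (intro Ck_on_bounded_linear[OF V bounded_linear_vec_nth] Ck_on_compose[OF V S(1) hom(1)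
          Suc])
        (use smooth_on_Der[OF S(2)] in \<open>simp add: smooth_on_def\<close>)
    then have cJ: "Ck_on k V (\<lambda>y. J y $ i $ j)" for i j by (simp add: J_def)
    let ?d = "\<lambda>y v. \<chi> a. det (\<chi> i j. if j =
        a then v $ i else J y $ i $ j) * inverse (det (\<chi> i j. J y $ i $ j))"
    have "Der g y v = ?d y v" if "y \<in> V" for y v
      using cramer[OF det[OF that], of "Der g y v" v] inv[OF that, of v]
          by (simp add: divide_inverse)
    then have "(g has_derivative ?d y) (at y)" if "y \<in> V" for y
      using dg[OF that] that frechet_derivative_works by (metis (no_types, lifting) ext)
    moreover have "Ck_on k V (\<lambda>y. ?d y v)" for v
    proof (intro Ck_on_vec Ck_on_mult V Ck_on_inverse)
      show "Ck_on k V (\<lambda>y. det (\<chi> i j. if j = a then v $ i else J y $ i $ j))" for a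
      proof (rule Ck_on_det[OF V])
        show "Ck_on k V (\<lambda>y. if j = a then v $ i else J y $ i $ j)" for i j
          by (cases "j = a") (simp_all add: cJ Ck_on_const)
      qed
      show "Ck_on k V (\<lambda>y. det (\<chi> i j. J y $ i $ j))"
        by (rule Ck_on_det[OF V cJ])
      show "det (\<chi> i j. J y $ i $ j) \<noteq> 0" if "y \<in> V" for y
        using det[OF that] by simp
    qed
    ultimately show ?case by (rule Ck_on_SucI[OF V])
  qed
  then show ?thesis by (simp add: smooth_on_def)
qed

lemma smooth_inverse_function:
  fixes f :: "real^'k::finite \<Rightarrow> real^'k"
  assumes "open S" "smooth_on S f" "x \<in> S" and inj: "\<And>v. Der f x v = 0 \<Longrightarrow> v = 0"
  obtains U V g where "open U" "U \<subseteq> S" "x \<in> U" "open V" "homeomorphism U V f g" "smooth_on V g"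
proof -
  define F where "F = (\<lambda>y. Blinfun (Der f y))"
  have ap: "blinfun_apply (F y) = Der f y" if "y \<in> S" for y
    unfolding F_def
    by (rule bounded_linear_Blinfun_apply)
      (rule has_derivative_bounded_linear[OF smooth_on_has_derivative[OF assms(2) that]])
  have cF: "continuous_on S F"
  proof (rule continuous_on_blinfun_componentwise)
    fix i :: "real^'k" assume "i \<in> Basis"
    show "continuous_on S (\<lambda>y. F y i)"
      using smooth_on_continuous_on[OF smooth_on_Der[OF assms(2), of i]]
      by (rule continuous_on_eq) (simp add: ap)
  qed
  have lin: "linear (F x)" by (simp add: blinfun.bounded_linear_right bounded_linear.linear)
  have "inj (F x)"
    using inj lin by (simp add: ap assms(3) linear_injective_0)
  then obtain h where h: "linear h" "h \<circ> F x = id"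
    using linear_injective_left_inverse[OF lin] by blast
  have "Blinfun h o\<^sub>L F x = id_blinfun"
    using h by (intro blinfun_eqI)
      (simp add: bounded_linear_Blinfun_apply linear_conv_bounded_linear[symmetric] fun_eq_iff)
  moreover have "(f has_derivative blinfun_apply (F y)) (at y)" if "y \<in> S" for y
    using smooth_on_has_derivative[OF assms(2) that] by (simp add: ap that)
  ultimately obtain U V g g' where *: "open U" "U \<subseteq> S" "x \<in> U" "open V" "homeomorphism U V f g"
      "\<And>y. y \<in> V \<Longrightarrow> (g has_derivative (g' y)) (at y)"
    using inverse_function_theorem[OF assms(1) _ cF assms(3)] by metis
  have "smooth_on V g"
  proof (rule smooth_on_local_inverse[OF assms(1,2) *(4)])
    show "g ` V \<subseteq> S" "\<And>y. y \<in> V \<Longrightarrow> f (g y) = y"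
      using *(2,5) by (auto simp: homeomorphism_def)
    show "\<And>y. y \<in> V \<Longrightarrow> g differentiable at y" using *(6) differentiable_def by blast
  qed
  with * show ?thesis using that by blast
qed

section \<open>Tangent vectors and velocities\<close>

text \<open>The part of the theory of tangent vectors that only uses differentiable changes of
  coordinates is developed for an arbitrary family of charts, since it is applied both to the
  atlas of the manifold and to the charts induced on first order jets.\<close>

locale differentiable_atlas =
  fixes A :: "('p, 'e::real_normed_vector) chart set"
  assumes inj_chart: "c \<in> A \<Longrightarrow> inj_on (snd c) (fst c)"
    and open_overlap: "c \<in> A \<Longrightarrow> d \<in> A \<Longrightarrow> open (snd c ` (fst c \<inter> fst d))"
    and transition_differentiable: "c \<in> A \<Longrightarrow> d \<in> A \<Longrightarrow> p \<in> fst c \<Longrightarrow> p \<in> fst d \<Longrightarrow>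
      (\<lambda>x. snd d (chart_inv c x)) differentiable (at (snd c p))"

definition transition_Der :: "('p, 'e::real_normed_vector) chart \<Rightarrow> ('p, 'e) chart \<Rightarrow> 'p \<Rightarrow> 'e \<Rightarrow> 'e"
    where
  "transition_Der c d p = Der (\<lambda>x. snd d (chart_inv c x)) (snd c p)"

text \<open>The tangent vector at \<open>p\<close> whose component in \<open>c\<close> is \<open>w\<close>.\<close>

definition tvec_of ::
    "('p, 'e::real_normed_vector) chart set \<Rightarrow> ('p, 'e) chart \<Rightarrow> 'p \<Rightarrow> 'e \<Rightarrow> ('p, 'e) tvec" where
  "tvec_of A c p w = (\<lambda>d. if d \<in> A \<and> p \<in> fst d then transition_Der c d p w else 0)"

context differentiable_atlas
begin

lemma chart_inv_chart: "c \<in> A \<Longrightarrow> q \<in> fst c \<Longrightarrow> chart_inv c (snd c q) = q"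
  by (simp add: chart_inv_def inj_chart)

lemma chart_chart_inv: "x \<in> snd c ` fst c \<Longrightarrow> snd c (chart_inv c x) = x"
  by (simp add: chart_inv_def f_inv_into_f)

lemma chart_inv_mem: "x \<in> snd c ` fst c \<Longrightarrow> chart_inv c x \<in> fst c"
  by (simp add: chart_inv_def inv_into_into)

lemma chart_inv_mem_overlap: "c \<in> A \<Longrightarrow> x \<in> snd c ` (fst c \<inter> fst d) \<Longrightarrow> chart_inv c x \<in> fst c \<inter> fst d"
  by (metis (no_types, lifting) IntD1 chart_inv_chart imageE)

lemma open_chart_image: "c \<in> A \<Longrightarrow> open (snd c ` fst c)"
  using open_overlap[of c c] by simp

lemma transition_has_derivative:
  assumes "c \<in> A" "d \<in> A" "p \<in> fst c" "p \<in> fst d"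
  shows "((\<lambda>x. snd d (chart_inv c x)) has_derivative transition_Der c d p) (at (snd c p))"
  unfolding transition_Der_def
  using transition_differentiable[OF assms] frechet_derivative_works by blast

lemma linear_transition_Der:
  assumes "c \<in> A" "d \<in> A" "p \<in> fst c" "p \<in> fst d"
  shows "linear (transition_Der c d p)"
  using transition_has_derivative[OF assms] by (rule has_derivative_linear)

lemma transition_Der_self:
  assumes "c \<in> A" "p \<in> fst c"
  shows "transition_Der c c p w = w"
proof -
  have "((\<lambda>x. snd c (chart_inv c x)) has_derivative (\<lambda>w. w)) (at (snd c p))"
    by (rule has_derivative_transform_within_open[of "\<lambda>x. x", OF _ open_chart_image[OF assms(1)]])
      (use assms in \<open>auto simp: chart_inv_chart\<close>)
  then have "transition_Der c c p = (\<lambda>w. w)"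
    unfolding transition_Der_def by (rule Der_eq)
  then show ?thesis by simp
qed

text \<open>By continuity \<open>f\<close> stays in the domain of the second chart near \<open>s\<close>, so that the chain rule
  applies.\<close>

lemma has_derivative_change_chart:
  assumes cd: "c \<in> A" "d \<in> A" and p: "f s \<in> fst c" "f s \<in> fst d"
    and ev: "\<forall>\<^sub>F t in nhds s. f t \<in> fst c"
    and der: "((\<lambda>t. snd c (f t)) has_derivative f') (at s)"
  shows "\<forall>\<^sub>F t in nhds s. f t \<in> fst d"
    and "((\<lambda>t. snd d (f t)) has_derivative (\<lambda>v. transition_Der c d (f s) (f' v))) (at s)"
proof -
  have "((\<lambda>t. snd c (f t)) \<longlongrightarrow> snd c (f s)) (nhds s)"
    using has_derivative_continuous[OF der] by (simp add: isCont_def tendsto_nhds_iff)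
  then have "\<forall>\<^sub>F t in nhds s. snd c (f t) \<in> snd c ` (fst c \<inter> fst d)"
    using open_overlap[OF cd] p by (auto intro: topological_tendstoD)
  then show *: "\<forall>\<^sub>F t in nhds s. f t \<in> fst d"
    using ev
  proof eventually_elim
    case (elim t)
    then show ?case using inj_chart[OF cd(1)] by (auto dest: inj_onD)
  qed
  have "((\<lambda>t. snd d (chart_inv c (snd c (f t)))) has_derivative
      (\<lambda>v. transition_Der c d (f s) (f' v))) (at s)"
    using diff_chain_at[OF der transition_has_derivative[OF cd p]] by (simp add: o_def)
  moreover have "\<forall>\<^sub>F t in at s. snd d (chart_inv c (snd c (f t))) = snd d (f t)"
    using ev unfolding eventually_at_filter by eventually_elim (simp add: chart_inv_chart[OF cd(1)])
  moreover have "snd d (chart_inv c (snd c (f s))) = snd d (f s)"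
    using chart_inv_chart cd p by simp
  ultimately show "((\<lambda>t. snd d (f t)) has_derivative (\<lambda>v. transition_Der c d (f s) (f' v))) (at s)"
    by (rule has_derivative_transform_eventually) simp
qed

lemma transition_Der_trans:
  assumes "c \<in> A" "d \<in> A" "e \<in> A" "p \<in> fst c" "p \<in> fst d" "p \<in> fst e"
  shows "transition_Der d e p (transition_Der c d p w) = transition_Der c e p w"
proof -
  have ci: "chart_inv c (snd c p) = p" using assms chart_inv_chart by simp
  have "\<forall>\<^sub>F x in nhds (snd c p). x \<in> snd c ` (fst c \<inter> fst d)"
    using open_overlap[OF assms(1,2)] assms(4,5) eventually_nhds_in_open by fastforce
  then have "\<forall>\<^sub>F x in nhds (snd c p). chart_inv c x \<in> fst d"
    by eventually_elim (use chart_inv_mem_overlap[OF assms(1)] in auto)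
  from has_derivative_change_chart(2)[where f = "chart_inv c", OF assms(2,3) _ _ this
      transition_has_derivative[OF assms(1,2,4,5)]]
  have "((\<lambda>x. snd e (chart_inv c x)) has_derivative
      (\<lambda>v. transition_Der d e p (transition_Der c d p v))) (at (snd c p))"
    by (simp add: ci assms)
  then show ?thesis
    using has_derivative_unique[OF transition_has_derivative[OF assms(1,3,4,6)]] by metis
qed

lemma tangent_spaceI:
  assumes "\<And>c d. c \<in> A \<Longrightarrow> d \<in> A \<Longrightarrow> p \<in> fst c \<Longrightarrow> p \<in> fst d \<Longrightarrow> v d = transition_Der c d p (v c)"
    and "\<And>c. \<not> (c \<in> A \<and> p \<in> fst c) \<Longrightarrow> v c = 0"
  shows "v \<in> tangent_space A p"
  unfolding tangent_space_def transition_Der_def[symmetric] using assms by blast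

lemma tangent_space_transition:
  "v \<in> tangent_space A p \<Longrightarrow> c \<in> A \<Longrightarrow> d \<in> A \<Longrightarrow> p \<in> fst c \<Longrightarrow> p \<in> fst d \<Longrightarrow>
    v d = transition_Der c d p (v c)"
  unfolding tangent_space_def transition_Der_def[symmetric] by blast

lemma tangent_space_outside:
  "v \<in> tangent_space A p \<Longrightarrow> \<not> (c \<in> A \<and> p \<in> fst c) \<Longrightarrow> v c = 0"
  unfolding tangent_space_def by blast

lemma tvec_of_in_tangent_space:
  assumes "c \<in> A" "p \<in> fst c"
  shows "tvec_of A c p w \<in> tangent_space A p"
  by (rule tangent_spaceI) (auto simp: tvec_of_def transition_Der_trans[OF assms(1) _ _ assms(2)])

lemma tvec_of_same: "c \<in> A \<Longrightarrow> p \<in> fst c \<Longrightarrow> tvec_of A c p w c = w"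
  by (simp add: tvec_of_def transition_Der_self)

lemma tvec_of_eq:
  assumes "v \<in> tangent_space A p" "c \<in> A" "p \<in> fst c"
  shows "tvec_of A c p (v c) = v"
proof
  show "tvec_of A c p (v c) d = v d" for d
    using tangent_space_transition[OF assms(1,2) _ assms(3), of d] tangent_space_outside[OF
        assms(1), of d]
    by (simp add: tvec_of_def)
qed

lemma tangent_vector_eqI:
  assumes "v \<in> tangent_space A p" "w \<in> tangent_space A p" "c \<in> A" "p \<in> fst c" "v c = w c"
  shows "v = w"
  using assms tvec_of_eq by metis

lemma tangent_space_linear_combination:
  assumes "v \<in> tangent_space A p" "w \<in> tangent_space A p"
  shows "(\<lambda>c. a *\<^sub>R v c + b *\<^sub>R w c) \<in> tangent_space A p"
proof (rule tangent_spaceI)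
  fix c d assume cd: "c \<in> A" "d \<in> A" "p \<in> fst c" "p \<in> fst d"
  show "a *\<^sub>R v d + b *\<^sub>R w d = transition_Der c d p (a *\<^sub>R v c + b *\<^sub>R w c)"
    by (simp add: tangent_space_transition[OF assms(1) cd] tangent_space_transition[OF assms(2) cd]
        linear_add[OF linear_transition_Der[OF cd]] linear_cmul[OF linear_transition_Der[OF cd]])
next
  fix c assume "\<not> (c \<in> A \<and> p \<in> fst c)"
  then show "a *\<^sub>R v c + b *\<^sub>R w c = 0"
    using tangent_space_outside[OF assms(1)] tangent_space_outside[OF assms(2)] by simp
qed

lemma tangent_space_add:
  "v \<in> tangent_space A p \<Longrightarrow> w \<in> tangent_space A p \<Longrightarrow> (\<lambda>c. v c + w c) \<in> tangent_space A p"
  using tangent_space_linear_combination[of v p w 1 1] by simp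

lemma tangent_space_scale: "v \<in> tangent_space A p \<Longrightarrow> (\<lambda>c. a *\<^sub>R v c) \<in> tangent_space A p"
  using tangent_space_linear_combination[of v p v a 0] by simp

lemma tangent_space_zero: "(\<lambda>c. 0) \<in> tangent_space A p"
  by (rule tangent_spaceI) (simp_all add: linear_0[OF linear_transition_Der])

lemma tangent_space_diff:
  "v \<in> tangent_space A p \<Longrightarrow> w \<in> tangent_space A p \<Longrightarrow> (\<lambda>c. v c - w c) \<in> tangent_space A p"
  using tangent_space_linear_combination[of v p w 1 "-1"] by simp

lemma tangent_space_sum:
  "(\<And>i. i \<in> I \<Longrightarrow> v i \<in> tangent_space A p) \<Longrightarrow> (\<lambda>c. \<Sum>i\<in>I. v i c) \<in> tangent_space A p"
  by (induction I rule: infinite_finite_induct) (simp_all add: tangent_space_zero tangent_space_add)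

lemma velocity_eq_tvec_of:
  assumes c: "c \<in> A" "\<gamma> 0 \<in> fst c" and ev: "\<forall>\<^sub>F t in nhds 0. \<gamma> t \<in> fst c"
    and der: "((\<lambda>t. snd c (\<gamma> t)) has_vector_derivative w) (at 0)"
  shows "velocity A \<gamma> = tvec_of A c (\<gamma> 0) w"
proof
  fix d
  show "velocity A \<gamma> d = tvec_of A c (\<gamma> 0) w d"
  proof (cases "d \<in> A \<and> \<gamma> 0 \<in> fst d")
    case True
    then have "((\<lambda>t. snd d (\<gamma> t)) has_vector_derivative (transition_Der c d (\<gamma> 0) w)) (at 0)"
      using has_derivative_change_chart(2)[OF c(1) _ c(2) _ ev der[unfolded
          has_vector_derivative_def]]
        linear_cmul[OF linear_transition_Der[OF c(1) _ c(2)]]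
      by (simp add: has_vector_derivative_def)
    then show ?thesis using True by (simp add: velocity_def tvec_of_def vector_derivative_at)
  qed (auto simp: velocity_def tvec_of_def)
qed

lemma chart_inv_interval: "t \<in> S \<Longrightarrow> chart_inv (S, \<lambda>t. t) t = t"
  by (simp add: chart_inv_def inv_into_f_f[of "\<lambda>t. t" S] inj_on_def)

text \<open>The curve is only known to be smooth in some chart; the chain rule carries its derivative at \<open>0\<close>
  over to all charts around the point.\<close>

lemma tangent_toE:
  assumes "v \<in> tangent_to A S q"
  obtains \<gamma> where "v \<in> tangent_space A q" "\<gamma> 0 = q" "\<forall>\<^sub>F t in nhds 0. \<gamma> t \<in> S"
    "\<And>d. d \<in> A \<Longrightarrow> q \<in> fst d \<Longrightarrow> \<forall>\<^sub>F t in nhds 0. \<gamma> t \<in> fst d"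
    "\<And>d. d \<in> A \<Longrightarrow> q \<in> fst d \<Longrightarrow> ((\<lambda>t. snd d (\<gamma> t)) has_vector_derivative v d) (at 0)"
proof -
  from assms obtain \<gamma> \<epsilon> where v: "v = velocity A \<gamma>" and g0: "\<gamma> 0 = q" and e: "\<epsilon> > 0"
    and S: "\<gamma> ` {-\<epsilon><..<\<epsilon>} \<subseteq> S"
    and sm: "smooth_map {({-\<epsilon><..<\<epsilon>}, \<lambda>t. t)} A {-\<epsilon><..<\<epsilon>} \<gamma>"
    unfolding tangent_to_def by auto
  let ?b = "({-\<epsilon><..<\<epsilon>}, \<lambda>t. t)"
  have "0 \<in> {-\<epsilon><..<\<epsilon>}" using e by simp
  from bspec[OF sm[unfolded smooth_map_def] this]
  obtain b c W where b: "b \<in> {?b}" and c: "c \<in> A"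
    and W0: "open W" "snd b 0 \<in> W" "W \<subseteq> snd b ` fst b"
    and in_c0: "\<forall>t\<in>W. \<gamma> (chart_inv b t) \<in> fst c"
    and sW0: "smooth_on W (\<lambda>t. snd c (\<gamma> (chart_inv b t)))"
    by blast
  have "b = ?b" using b by simp
  note W = W0[unfolded this snd_conv fst_conv image_ident]
    and in_c = in_c0[unfolded this, rule_format] and sW = sW0[unfolded this]
  have ci: "chart_inv ({-\<epsilon><..<\<epsilon>}, \<lambda>t. t) t = t" if "t \<in> W" for t
    using that W by (intro chart_inv_interval) auto
  have evW: "\<forall>\<^sub>F t in nhds 0. t \<in> W" using W by (simp add: eventually_nhds_in_open)
  have evc: "\<forall>\<^sub>F t in nhds 0. \<gamma> t \<in> fst c"
    using evW by eventually_elim (use in_c ci in fastforce)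
  have evS: "\<forall>\<^sub>F t in nhds 0. \<gamma> t \<in> S"
    using evW by eventually_elim (use S W in blast)
  have "smooth_on W (\<lambda>t. snd c (\<gamma> t))"
    using W(1) _ sW by (rule smooth_on_cong) (simp add: ci)
  then have "(\<lambda>t. snd c (\<gamma> t)) differentiable (at 0)"
    using W(2) by (rule smooth_on_differentiable)
  then obtain w where w: "((\<lambda>t. snd c (\<gamma> t)) has_vector_derivative w) (at 0)"
    using vector_derivative_works by blast
  have qc: "q \<in> fst c" using eventually_nhds_x_imp_x[OF evc] g0 by simp
  have vt: "v = tvec_of A c q w"
    using velocity_eq_tvec_of[OF c _ evc w] v g0 qc by simp
  show thesis
  proof
    show "v \<in> tangent_space A q" unfolding vt using c qc by (rule tvec_of_in_tangent_space)
    show "\<gamma> 0 = q" "\<forall>\<^sub>F t in nhds 0. \<gamma> t \<in> S" by fact+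
    fix d assume d: "d \<in> A" "q \<in> fst d"
    note * = has_derivative_change_chart[OF c d(1) _ _ evc w[unfolded has_vector_derivative_def]]
    show "\<forall>\<^sub>F t in nhds 0. \<gamma> t \<in> fst d" using *(1) g0 d qc by simp
    show "((\<lambda>t. snd d (\<gamma> t)) has_vector_derivative v d) (at 0)"
      using *(2) g0 d qc linear_cmul[OF linear_transition_Der[OF c d(1) qc d(2)]]
      by (simp add: has_vector_derivative_def vt tvec_of_def)
  qed
qed

lemma tangent_toI:
  assumes "\<epsilon> > 0" "c \<in> A" "\<gamma> 0 = q" "v \<in> tangent_space A q"
    and "\<And>t. \<bar>t\<bar> < \<epsilon> \<Longrightarrow> \<gamma> t \<in> S \<inter> fst c"
    and sm: "smooth_on {-\<epsilon><..<\<epsilon>} (\<lambda>t. snd c (\<gamma> t))"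
    and der: "((\<lambda>t. snd c (\<gamma> t)) has_vector_derivative v c) (at 0)"
  shows "v \<in> tangent_to A S q"
proof -
  let ?I = "{-\<epsilon><..<\<epsilon>}"
  have in_c: "\<gamma> t \<in> S \<inter> fst c" if "t \<in> ?I" for t using assms(5)[of t] that by auto
  have "\<forall>\<^sub>F t in nhds 0. t \<in> ?I"
    by (rule eventually_nhds_in_open) (use assms(1) in auto)
  then have "\<forall>\<^sub>F t in nhds 0. \<gamma> t \<in> fst c" by eventually_elim (use in_c in auto)
  then have "velocity A \<gamma> = tvec_of A c q (v c)"
    using velocity_eq_tvec_of[OF assms(2) _ _ der] in_c[of 0] assms(1,3) by auto
  also have "\<dots> = v"
    using tvec_of_eq[OF assms(4,2)] in_c[of 0] assms(1,3) by auto
  finally have "v = velocity A \<gamma>" ..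
  moreover have "smooth_map {(?I, \<lambda>t. t)} A ?I \<gamma>"
    unfolding smooth_map_def
  proof (intro ballI)
    fix t assume t: "t \<in> ?I"
    have "smooth_on ?I (\<lambda>x. snd c (\<gamma> (chart_inv (?I, \<lambda>t. t) x)))"
      by (rule smooth_on_cong[OF _ _ sm]) (simp_all add: chart_inv_interval)
    then show "\<exists>c\<in>{(?I, \<lambda>t. t)}. \<exists>d\<in>A. \<exists>W. t \<in> fst c \<and> open W \<and> snd c t \<in> W \<and>
        W \<subseteq> snd c ` fst c \<and> (\<forall>x\<in>W. \<gamma> (chart_inv c x) \<in> fst d) \<and>
        smooth_on W (\<lambda>x. snd d (\<gamma> (chart_inv c x)))"
      using t assms(2) in_c
      by (intro bexI[of _ "(?I, \<lambda>t. t)"] bexI[of _ c] exI[of _ ?I]) (auto simp: chart_inv_interval)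
  qed
  ultimately show ?thesis
    unfolding tangent_to_def using assms(1,3) in_c by (intro CollectI exI[of _ \<gamma>]) auto
qed

lemma apply_tvec_chart:
  assumes "v \<in> tangent_space A p" "c \<in> A" "p \<in> fst c"
    and "(\<lambda>x. f (chart_inv c x)) differentiable (at (snd c p))"
  shows "apply_tvec A p v f = Der (\<lambda>x. f (chart_inv c x)) (snd c p) (v c)"
proof -
  define e where "e = (SOME c. c \<in> A \<and> p \<in> fst c)"
  have e: "e \<in> A" "p \<in> fst e" unfolding e_def by (rule someI2[of _ c]; use assms in auto)+
  have "snd c (chart_inv e (snd e p)) = snd c p" using chart_inv_chart e by simp
  then have "((\<lambda>x. f (chart_inv c (snd c (chart_inv e x)))) has_derivative
      (\<lambda>w. Der (\<lambda>x. f (chart_inv c x)) (snd c p) (transition_Der e c p w))) (at (snd e p))"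
    using diff_chain_at[OF transition_has_derivative[OF e(1) assms(2) e(2) assms(3)],
        of "\<lambda>x. f (chart_inv c x)"] assms(4) frechet_derivative_works by (auto simp: o_def)
  then have "((\<lambda>x. f (chart_inv e x)) has_derivative
      (\<lambda>w. Der (\<lambda>x. f (chart_inv c x)) (snd c p) (transition_Der e c p w))) (at (snd e p))"
    by (rule has_derivative_transform_within_open[OF _ open_overlap[OF e(1) assms(2)]])
      (use e assms(2,3) in \<open>auto simp: chart_inv_chart\<close>)
  then have "Der (\<lambda>x. f (chart_inv e x)) (snd e p) =
      (\<lambda>w. Der (\<lambda>x. f (chart_inv c x)) (snd c p) (transition_Der e c p w))"
    by (rule Der_eq)
  moreover have "transition_Der e c p (v e) = v c"
    using tangent_space_transition[OF assms(1) e(1) assms(2) e(2) assms(3)] by simp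
  ultimately show ?thesis
    by (simp add: apply_tvec_def differential_def e_def[symmetric] Let_def)
qed

end

section \<open>Smooth manifolds\<close>

locale manifold =
  fixes T :: "'p topology" and A :: "('p, 'e::euclidean_space) chart set"
  assumes smooth_manifold: "smooth_manifold T A"
begin

lemma topological_chart: "c \<in> A \<Longrightarrow> topological_chart T c"
  using smooth_manifold by (simp add: smooth_manifold_def)

lemma openin_dom: "c \<in> A \<Longrightarrow> openin T (fst c)"
  using topological_chart by (auto simp: topological_chart_def)

lemma chart_homeomorphic_map:
  "c \<in> A \<Longrightarrow> homeomorphic_map (subtopology T (fst c)) (top_of_set (snd c ` fst c)) (snd c)"
  using topological_chart by (auto simp: topological_chart_def)

lemma open_dom_image: "c \<in> A \<Longrightarrow> open (snd c ` fst c)"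
  using topological_chart by (auto simp: topological_chart_def)

lemma topspace_dom: "c \<in> A \<Longrightarrow> topspace (subtopology T (fst c)) = fst c"
  using openin_subset[OF openin_dom[of c]] by auto

lemma openin_iff_open_image:
  assumes "c \<in> A" "U \<subseteq> fst c"
  shows "openin T U \<longleftrightarrow> open (snd c ` U)"
proof -
  have "openin T U \<longleftrightarrow> openin (subtopology T (fst c)) U"
    using openin_open_subtopology[OF openin_dom[OF assms(1)]] assms(2) by simp
  also have "\<dots> \<longleftrightarrow> openin (top_of_set (snd c ` fst c)) (snd c ` U)"
    using homeomorphic_map_openness_eq[OF chart_homeomorphic_map[OF assms(1)], of U]
      topspace_dom[OF assms(1)] assms(2) by (simp only: simp_thms)
  also have "\<dots> \<longleftrightarrow> open (snd c ` U)"
    using openin_open_eq[OF open_dom_image[OF assms(1)]] assms(2) by (metis image_mono)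
  finally show ?thesis .
qed

lemma inj_dom: "c \<in> A \<Longrightarrow> inj_on (snd c) (fst c)"
  using homeomorphic_imp_injective_map[OF chart_homeomorphic_map] topspace_dom by metis

lemma open_image: "c \<in> A \<Longrightarrow> openin T U \<Longrightarrow> open (snd c ` (fst c \<inter> U))"
  using openin_iff_open_image[of c "fst c \<inter> U"] openin_dom[of c] by auto

lemma smooth_transition:
  "c \<in> A \<Longrightarrow> d \<in> A \<Longrightarrow> smooth_on (snd c ` (fst c \<inter> fst d)) (\<lambda>x. snd d (chart_inv c x))"
  using smooth_manifold by (auto simp: smooth_manifold_def compatible_def)

end

sublocale manifold \<subseteq> differentiable_atlas A
proof
  show "inj_on (snd c) (fst c)" if "c \<in> A" for c using that by (rule inj_dom)
  show "open (snd c ` (fst c \<inter> fst d))" if "c \<in> A" "d \<in> A" for c d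
    using open_image[OF that(1) openin_dom[OF that(2)]] .
  show "(\<lambda>x. snd d (chart_inv c x)) differentiable (at (snd c p))"
    if "c \<in> A" "d \<in> A" "p \<in> fst c" "p \<in> fst d" for c d p
    by (rule smooth_on_differentiable[OF smooth_transition[OF that(1,2)]]) (use that in blast)
qed

context manifold
begin

lemma openin_chart_inv_image:
  assumes "c \<in> A" "open W" "W \<subseteq> snd c ` fst c"
  shows "openin T (chart_inv c ` W)"
proof -
  have "snd c ` chart_inv c ` W = W"
  proof -
    have "snd c (chart_inv c x) = x" if "x \<in> W" for x
      using chart_chart_inv[of x c] assms(3) that by blast
    then show ?thesis by (simp add: image_image)
  qed
  moreover have "chart_inv c ` W \<subseteq> fst c"
    using assms(3) chart_inv_mem[of _ c] by (meson image_subsetI subsetD)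
  ultimately show ?thesis using openin_iff_open_image[OF assms(1)] assms(2) by simp
qed

text \<open>In another chart the components are combinations of those in \<open>c\<close> with the partial derivatives
  of the change of coordinates as coefficients, all evaluated along a smooth map.\<close>

lemma smooth_vector_fieldI:
  assumes c: "c \<in> A" and U: "openin T U" "U \<subseteq> fst c"
    and X: "\<And>p. p \<in> U \<Longrightarrow> X p \<in> tangent_space A p"
    and sm: "smooth_on (snd c ` U) (\<lambda>x. X (chart_inv c x) c)"
  shows "smooth_vector_field T A U X"
  unfolding smooth_vector_field_def
proof (intro conjI ballI)
  fix d assume d: "d \<in> A"
  let ?S = "snd d ` (U \<inter> fst d)" and ?R = "snd c ` (U \<inter> fst d)"
  have S: "open ?S" using open_image[OF d U(1)] by (simp add: Int_commute)
  have R: "open ?R"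
    using openin_iff_open_image[OF c, of "U \<inter> fst d"] U openin_dom[OF d] by auto
  have img: "(\<lambda>y. snd c (chart_inv d y)) ` ?S \<subseteq> ?R"
    using chart_inv_mem_overlap[OF d, of _ c] chart_inv_chart[OF d] by fastforce
  have st: "smooth_on ?S (\<lambda>y. snd c (chart_inv d y))"
    by (rule smooth_on_subset[OF smooth_transition[OF d c]]) (use U(2) in blast)
  have s1: "smooth_on ?R (\<lambda>x. Der (\<lambda>x. snd d (chart_inv c x)) x b)" for b
    by (rule smooth_on_Der[OF smooth_on_subset[OF smooth_transition[OF c d]]]) (use U in blast)
  have s2: "smooth_on ?R (\<lambda>x. X (chart_inv c x) c)"
    by (rule smooth_on_subset[OF sm]) blast
  let ?F = "\<lambda>x. \<Sum>b\<in>Basis. (X (chart_inv c x) c \<bullet> b) *\<^sub>R Der (\<lambda>x. snd d (chart_inv c x)) x b"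
  have "smooth_on ?R ?F"
    by (intro smooth_on_sum smooth_on_scaleR R s1 smooth_on_bounded_linear[OF R
        bounded_linear_inner_left s2])
  then have "smooth_on ?S (\<lambda>y. ?F (snd c (chart_inv d y)))"
    by (rule smooth_on_compose[OF S R img st])
  then show "smooth_on ?S (\<lambda>y. X (chart_inv d y) d)"
  proof (rule smooth_on_cong[OF S, rotated])
    fix y assume "y \<in> ?S"
    then obtain q where q: "q \<in> U" "q \<in> fst d" "y = snd d q" by auto
    then have qc: "q \<in> fst c" using U by auto
    have lin: "linear (transition_Der c d q)" using linear_transition_Der[OF c d qc q(2)] .
    have "X q d = transition_Der c d q (X q c)"
      using tangent_space_transition[OF X[OF q(1)] c d qc q(2)] .
    also have "\<dots> = transition_Der c d q (\<Sum>b\<in>Basis. (X q c \<bullet> b) *\<^sub>R b)"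
      by (simp add: euclidean_representation)
    also have "\<dots> = (\<Sum>b\<in>Basis. (X q c \<bullet> b) *\<^sub>R transition_Der c d q b)"
      by (simp add: linear_sum[OF lin] linear_cmul[OF lin])
    finally show "?F (snd c (chart_inv d y)) = X (chart_inv d y) d"
      using q qc c d by (simp add: chart_inv_chart transition_Der_def)
  qed
qed (use assms in auto)

lemma smooth_vector_field_subset:
  assumes "smooth_vector_field T A U X" "openin T U'" "U' \<subseteq> U"
  shows "smooth_vector_field T A U' X"
  using assms unfolding smooth_vector_field_def
  by (auto intro: smooth_on_subset)

lemma smooth_map_realI:
  assumes "c \<in> A" "openin T U" "U \<subseteq> fst c" "smooth_on (snd c ` U) (\<lambda>x. f (chart_inv c x))"
  shows "smooth_map A {real_chart} U f"
  unfolding smooth_map_def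
proof (intro ballI)
  fix p assume p: "p \<in> U"
  have "open (snd c ` U)" using openin_iff_open_image assms by blast
  then show "\<exists>c\<in>A. \<exists>d\<in>{real_chart}. \<exists>W. p \<in> fst c \<and> open W \<and> snd c p \<in> W \<and> W \<subseteq> snd c ` fst c \<and>
        (\<forall>x\<in>W. f (chart_inv c x) \<in> fst d) \<and> smooth_on W (\<lambda>x. snd d (f (chart_inv c x)))"
    using p assms by (intro bexI[of _ c] bexI[of _ real_chart] exI[of _ "snd c ` U"]) auto
qed

end

section \<open>Submanifolds as local graphs\<close>

definition join :: "real^'n::finite \<Rightarrow> real^'m::finite \<Rightarrow> real^('n + 'm)" where
  "join y z = (\<chi> a. case a of Inl l \<Rightarrow> y $ l | Inr i \<Rightarrow> z $ i)"

definition lift :: "real^'n::finite^'m::finite \<Rightarrow> real^'n \<Rightarrow> real^('n + 'm)" where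
  "lift u \<xi> = join \<xi> (u *v \<xi>)"

definition slope :: "(real^'n::finite \<Rightarrow> real^'m::finite) \<Rightarrow> real^'n \<Rightarrow> real^'n^'m" where
  "slope f y = (\<chi> i l. Der f y (axis l 1) $ i)"

lemma greek_join [simp]: "greek (join y z) = y"
  by (simp add: greek_def join_def vec_eq_iff)

lemma latin_join [simp]: "latin (join y z) = z"
  by (simp add: latin_def join_def vec_eq_iff)

lemma join_greek_latin [simp]: "join (greek x) (latin x) = x"
  by (simp add: greek_def latin_def join_def vec_eq_iff split: sum.split)

lemma greek_latin_eqI: "greek x = greek y \<Longrightarrow> latin x = latin y \<Longrightarrow> x = y"
  by (metis join_greek_latin)

lemma greek_nth [simp]: "greek x $ l = x $ Inl l" and latin_nth [simp]: "latin x $ i = x $ Inr i"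
  by (simp_all add: greek_def latin_def)

lemma join_nth [simp]: "join y z $ Inl l = y $ l" "join y z $ Inr i = z $ i"
  by (simp_all add: join_def)

lemma greek_lift [simp]: "greek (lift u \<xi>) = \<xi>" and latin_lift [simp]: "latin (lift u \<xi>) = u *v \<xi>"
  by (simp_all add: lift_def)

lemma lift_greek: "latin x = u *v greek x \<Longrightarrow> lift u (greek x) = x"
  by (metis greek_latin_eqI greek_lift latin_lift)

lemma bounded_linear_greek: "bounded_linear greek" and bounded_linear_latin: "bounded_linear latin"
  unfolding linear_conv_bounded_linear[symmetric] by (auto intro!: linearI simp: vec_eq_iff)

lemma bounded_linear_join: "bounded_linear (\<lambda>w. join (fst w) (snd w))"
  unfolding linear_conv_bounded_linear[symmetric]
  by (rule linearI) (auto simp: vec_eq_iff join_def split: sum.split)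

lemma linear_lift: "linear (lift u)"
  by (rule linearI) (auto simp: vec_eq_iff lift_def join_def algebra_simps matrix_vector_mult_def
      sum.distrib sum_distrib_left split: sum.split)

lemma has_derivative_join:
  assumes "(f has_derivative f') (at x)" "(g has_derivative g') (at x)"
  shows "((\<lambda>x. join (f x) (g x)) has_derivative (\<lambda>v. join (f' v) (g' v))) (at x)"
  using bounded_linear.has_derivative[OF bounded_linear_join has_derivative_Pair[OF assms]] by simp

lemma smooth_on_join:
  "open S \<Longrightarrow> smooth_on S f \<Longrightarrow> smooth_on S g \<Longrightarrow> smooth_on S (\<lambda>x. join (f x) (g x))"
  using smooth_on_bounded_linear[OF _ bounded_linear_join smooth_on_Pair[of S f g]] by simp

lemmas smooth_on_greek = smooth_on_bounded_linear[OF _ bounded_linear_greek]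
  and smooth_on_latin = smooth_on_bounded_linear[OF _ bounded_linear_latin]

lemma open_greek_image:
  fixes W :: "(real^('n::finite + 'm::finite)) set"
  assumes "open W"
  shows "open (greek ` W)"
proof (rule open_surjective_linear_image[OF assms])
  show "linear (greek :: real^('n + 'm) \<Rightarrow> _)"
    using bounded_linear_greek by (rule bounded_linear.linear)
  show "surj (greek :: real^('n + 'm) \<Rightarrow> _)" by (metis greek_join surj_def)
qed

lemma slope_mult: "f differentiable (at y) \<Longrightarrow> slope f y *v \<xi> = Der f y \<xi>"
  using linear_axis_sum[OF linear_Der[of f y], of \<xi>]
  by (simp add: slope_def vec_eq_iff matrix_vector_mult_def mult.commute)

lemma partial_component:
  assumes "f differentiable (at y)"
  shows "partial [l] (\<lambda>x. f x $ i) y = slope f y $ i $ l"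
proof -
  have "((\<lambda>x. f x $ i) has_derivative (\<lambda>v. Der f y v $ i)) (at y)"
    using assms frechet_derivative_works bounded_linear.has_derivative[OF bounded_linear_vec_nth]
        by blast
  then show ?thesis by (simp add: slope_def Der_eq)
qed

lemma local_graphE:
  assumes "local_graph A c f L p"
  obtains W where "c \<in> A" "p \<in> fst c" "p \<in> L" "open W" "snd c p \<in> W" "W \<subseteq> snd c ` fst c"
    "open (greek ` W)" "smooth_on (greek ` W) f"
    "\<And>x. x \<in> W \<Longrightarrow> chart_inv c x \<in> L \<longleftrightarrow> latin x = f (greek x)"
  using assms open_greek_image unfolding local_graph_def by metis

lemma local_graph_smoothE:
  assumes "local_graph A c f L p"
  obtains S where "open S" "smooth_on S f" "greek (snd c p) \<in> S"
  using assms open_greek_image unfolding local_graph_def by blast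

lemma local_graph_differentiable:
  assumes "local_graph A c f L p"
  shows "f differentiable (at (greek (snd c p)))"
  using assms by (elim local_graphE) (rule smooth_on_differentiable, auto)

text \<open>These curves realise the tangent vectors of graphs and of their prolongations, and tangency
  conditions along a graph are differentiated along them.\<close>

lemma graph_curve:
  fixes f :: "real^'n::finite \<Rightarrow> real^'m::finite"
  assumes "open W" "x \<in> W" "smooth_on (greek ` W) f" and x: "latin x = f (greek x)"
  obtains \<epsilon> where "\<epsilon> > 0"
    "\<And>t. \<bar>t\<bar> < \<epsilon> \<Longrightarrow> join (greek x + t *\<^sub>R \<xi>) (f (greek x + t *\<^sub>R \<xi>)) \<in> W"
    "smooth_on {-\<epsilon><..<\<epsilon>} (\<lambda>t. greek x + t *\<^sub>R \<xi>)"
    "smooth_on {-\<epsilon><..<\<epsilon>} (\<lambda>t. join (greek x + t *\<^sub>R \<xi>) (f (greek x + t *\<^sub>R \<xi>)))"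
    "((\<lambda>t. join (greek x + t *\<^sub>R \<xi>) (f (greek x + t *\<^sub>R \<xi>))) has_vector_derivative
      lift (slope f (greek x)) \<xi>) (at 0)"
proof -
  let ?l = "\<lambda>t::real. greek x + t *\<^sub>R \<xi>" and ?X =
      "\<lambda>t. join (greek x + t *\<^sub>R \<xi>) (f (greek x + t *\<^sub>R \<xi>))"
  have oW: "open (greek ` W)" using assms(1) by (rule open_greek_image)
  have df: "f differentiable (at (greek x))"
    using smooth_on_differentiable[OF assms(3)] assms(2) by blast
  have dl: "(?l has_derivative (\<lambda>t. t *\<^sub>R \<xi>)) (at 0)"
    by (auto intro!: derivative_eq_intros)
  have "((\<lambda>t. f (?l t)) has_derivative (\<lambda>t. Der f (greek x) (t *\<^sub>R \<xi>))) (at 0)"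
    using diff_chain_at[OF dl, of f "Der f (greek x)"] df frechet_derivative_works
        by (auto simp: o_def)
  from has_derivative_join[OF dl this]
  have dX: "(?X has_derivative (\<lambda>t. lift (slope f (greek x)) (t *\<^sub>R \<xi>))) (at 0)"
    by (simp add: lift_def slope_mult[OF df])
  then have dX': "(?X has_vector_derivative lift (slope f (greek x)) \<xi>) (at 0)"
    by (simp add: has_vector_derivative_def linear_cmul[OF linear_lift])
  have X0: "?X 0 = x" using x by (metis add.right_neutral join_greek_latin scale_zero_left)
  have "(?X \<longlongrightarrow> ?X 0) (nhds 0)"
    using has_derivative_continuous[OF dX] by (simp add: isCont_def tendsto_nhds_iff)
  then have "\<forall>\<^sub>F t in nhds 0. ?X t \<in> W"
    using X0 assms(1,2) by (auto intro: topological_tendstoD)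
  then obtain \<epsilon> where e: "\<epsilon> > 0" "\<And>t. \<bar>t\<bar> < \<epsilon> \<Longrightarrow> ?X t \<in> W"
    unfolding eventually_nhds_metric by (auto simp: dist_real_def)
  have sl: "smooth_on {-\<epsilon><..<\<epsilon>} ?l"
    by (intro smooth_on_add smooth_on_scaleR smooth_on_const smooth_on_ident) auto
  have "?l ` {-\<epsilon><..<\<epsilon>} \<subseteq> greek ` W"
  proof
    fix y assume "y \<in> ?l ` {-\<epsilon><..<\<epsilon>}"
    then obtain t where "t \<in> {-\<epsilon><..<\<epsilon>}" "y = ?l t" by blast
    then have "\<bar>t\<bar> < \<epsilon>" "y = ?l t" by auto
    then show "y \<in> greek ` W" using e(2)[of t] by (metis greek_join imageI)
  qed
  then have "smooth_on {-\<epsilon><..<\<epsilon>} (\<lambda>t. f (?l t))"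
    by (intro smooth_on_compose[OF _ oW _ sl assms(3)]) auto
  then have "smooth_on {-\<epsilon><..<\<epsilon>} ?X"
    by (intro smooth_on_join sl) auto
  then show thesis using that e sl dX' by blast
qed

locale jet_manifold = manifold T A
  for T :: "'p topology" and A :: "('p, real^('n::finite + 'm::finite)) chart set"
begin

text \<open>One inclusion differentiates the equation of the graph along a curve in it; the other one is
  witnessed by the image in the graph of a straight line.\<close>

lemma tangent_to_graph:
  assumes lg: "local_graph A c f L p"
  shows "tangent_to A L p =
    {v \<in> tangent_space A p. latin (v c) = slope f (greek (snd c p)) *v greek (v c)}"
proof -
  from lg obtain W where W: "c \<in> A" "p \<in> fst c" "p \<in> L" "open W" "snd c p \<in> W" "W \<subseteq> snd c ` fst c"
    "open (greek ` W)" "smooth_on (greek ` W) f"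
    "\<And>x. x \<in> W \<Longrightarrow> chart_inv c x \<in> L \<longleftrightarrow> latin x = f (greek x)"
    by (rule local_graphE) blast
  let ?y = "greek (snd c p)"
  have ci: "chart_inv c (snd c p) = p" using W(1,2) by (rule chart_inv_chart)
  have fp: "latin (snd c p) = f ?y" using W(3) W(9)[OF W(5)] ci by simp
  have df: "f differentiable (at ?y)" by (rule local_graph_differentiable[OF lg])
  show ?thesis
  proof (intro equalityI subsetI)
    fix v assume "v \<in> tangent_to A L p"
    then obtain \<gamma> where v: "v \<in> tangent_space A p" and g: "\<gamma> 0 = p" "\<forall>\<^sub>F t in nhds 0. \<gamma> t \<in> L"
      and gc: "\<And>d. d \<in> A \<Longrightarrow> p \<in> fst d \<Longrightarrow> \<forall>\<^sub>F t in nhds 0. \<gamma> t \<in> fst d"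
        "\<And>d. d \<in> A \<Longrightarrow> p \<in> fst d \<Longrightarrow> ((\<lambda>t. snd d (\<gamma> t)) has_vector_derivative v d) (at 0)"
      by (rule tangent_toE) blast
    have dx: "((\<lambda>t. snd c (\<gamma> t)) has_derivative (\<lambda>t. t *\<^sub>R v c)) (at 0)"
      using gc(2)[OF W(1,2)] by (simp add: has_vector_derivative_def)
    have "((\<lambda>t. snd c (\<gamma> t)) \<longlongrightarrow> snd c p) (nhds 0)"
      using has_derivative_continuous[OF dx] g(1) by (simp add: isCont_def tendsto_nhds_iff)
    then have "\<forall>\<^sub>F t in nhds 0. snd c (\<gamma> t) \<in> W"
      using W(4,5) by (auto intro: topological_tendstoD)
    with g(2) gc(1)[OF W(1,2)]
    have ev: "\<forall>\<^sub>F t in nhds 0. latin (snd c (\<gamma> t)) = f (greek (snd c (\<gamma> t)))"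
    proof eventually_elim
      case (elim t)
      then show ?case using W(9)[of "snd c (\<gamma> t)"] chart_inv_chart[OF W(1)] by simp
    qed
    have d1: "((\<lambda>t. latin (snd c (\<gamma> t))) has_derivative (\<lambda>t. latin (t *\<^sub>R v c))) (at 0)"
      by (rule bounded_linear.has_derivative[OF bounded_linear_latin dx])
    have d2: "((\<lambda>t. greek (snd c (\<gamma> t))) has_derivative (\<lambda>t. greek (t *\<^sub>R v c))) (at 0)"
      by (rule bounded_linear.has_derivative[OF bounded_linear_greek dx])
    have "(f has_derivative Der f ?y) (at (greek (snd c (\<gamma> 0))))"
      using has_derivative_Der[OF df] g(1) by simp
    from diff_chain_at[OF d2 this]
    have "((\<lambda>t. f (greek (snd c (\<gamma> t)))) has_derivative (\<lambda>t. Der f ?y (greek (t *\<^sub>R v c)))) (at 0)"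
      by (simp add: o_def)
    moreover have "\<forall>\<^sub>F t in at 0. f (greek (snd c (\<gamma> t))) = latin (snd c (\<gamma> t))"
      using ev unfolding eventually_at_filter by eventually_elim simp
    ultimately have "((\<lambda>t. latin (snd c (\<gamma> t))) has_derivative
        (\<lambda>t. Der f ?y (greek (t *\<^sub>R v c)))) (at 0)"
      by (rule has_derivative_transform_eventually) (use eventually_nhds_x_imp_x[OF ev] in auto)
    with d1 have "(\<lambda>t. latin (t *\<^sub>R v c)) = (\<lambda>t. Der f ?y (greek (t *\<^sub>R v c)))"
      by (rule has_derivative_unique)
    from fun_cong[OF this, of 1] show "v \<in> {v \<in> tangent_space A p. latin (v c) =
        slope f ?y *v greek (v c)}"
      using v by (simp add: slope_mult[OF df])
  next
    fix v assume "v \<in> {v \<in> tangent_space A p. latin (v c) = slope f ?y *v greek (v c)}"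
    then have v: "v \<in> tangent_space A p" "lift (slope f ?y) (greek (v c)) = v c"
      by (auto intro: lift_greek)
    let ?X = "\<lambda>t. join (?y + t *\<^sub>R greek (v c)) (f (?y + t *\<^sub>R greek (v c)))"
    obtain \<epsilon> where e: "\<epsilon> > 0" "\<And>t. \<bar>t\<bar> < \<epsilon> \<Longrightarrow> ?X t \<in> W" "smooth_on {-\<epsilon><..<\<epsilon>} ?X"
      "(?X has_vector_derivative v c) (at 0)"
      by (rule graph_curve[OF W(4,5,8) fp, of "greek (v c)", unfolded v(2)]) blast
    have X: "snd c (chart_inv c (?X t)) = ?X t" if "\<bar>t\<bar> < \<epsilon>" for t
      by (rule chart_chart_inv) (use e(2)[OF that] W(6) in blast)
    show "v \<in> tangent_to A L p"
    proof (rule tangent_toI[OF e(1) W(1), of "\<lambda>t. chart_inv c (?X t)"])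
      have "?X 0 = snd c p" using fp by (metis add.right_neutral join_greek_latin scale_zero_left)
      then show "chart_inv c (?X 0) = p" using ci by simp
      show "chart_inv c (?X t) \<in> L \<inter> fst c" if "\<bar>t\<bar> < \<epsilon>" for t
        using W(9)[OF e(2)[OF that]] chart_inv_mem[of "?X t" c] e(2)[OF that] W(6) by auto
      show "smooth_on {-\<epsilon><..<\<epsilon>} (\<lambda>t. snd c (chart_inv c (?X t)))"
        by (rule smooth_on_cong[OF _ _ e(3)]) (auto simp: X)
      show "((\<lambda>t. snd c (chart_inv c (?X t))) has_vector_derivative v c) (at 0)"
        by (rule has_vector_derivative_transform_within_open[OF e(4), of "{-\<epsilon><..<\<epsilon>}"])
          (use e(1) X in auto)
    qed (use v in auto)
  qed
qed

lemma tangent_to_subset: "v \<in> tangent_to A L p \<Longrightarrow> v \<in> tangent_space A p"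
  by (rule tangent_toE)

lemma tvec_of_lift_tangent:
  assumes "local_graph A c f L p"
  shows "tvec_of A c p (lift (slope f (greek (snd c p))) \<xi>) \<in> tangent_to A L p"
proof -
  have "c \<in> A" "p \<in> fst c" using assms by (auto simp: local_graph_def)
  then show ?thesis
    unfolding tangent_to_graph[OF assms] by (simp add: tvec_of_in_tangent_space tvec_of_same)
qed

lemma slope_eq_if_tangent_eq:
  assumes "local_graph A c f L p" "local_graph A c f' L' p" "tangent_to A L p = tangent_to A L' p"
  shows "slope f (greek (snd c p)) = slope f' (greek (snd c p))"
proof -
  have c: "c \<in> A" "p \<in> fst c" using assms by (auto simp: local_graph_def)
  have "slope f (greek (snd c p)) *v \<xi> = slope f' (greek (snd c p)) *v \<xi>" for \<xi>
    using tvec_of_lift_tangent[OF assms(1), of \<xi>] assms(3) unfolding tangent_to_graph[OF assms(2)]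
    by (simp add: tvec_of_same c)
  then show ?thesis by (metis matrix_eq)
qed

text \<open>The inverse function theorem applies to the projection to the base of \<open>c\<close> of a parametrization
  of \<open>L\<close>, whose derivative is injective by transversality.\<close>

lemma local_graph_if_transverse:
  assumes lg: "local_graph A d h L p" and c: "c \<in> A" "p \<in> fst c"
    and trans: "\<And>v. v \<in> tangent_to A L p \<Longrightarrow> greek (v c) = 0 \<Longrightarrow> v c = 0"
  shows "\<exists>f. local_graph A c f L p"
proof -
  from lg obtain W where W: "d \<in> A" "p \<in> fst d" "p \<in> L" "open W" "snd d p \<in> W" "W \<subseteq> snd d ` fst d"
    "open (greek ` W)" "smooth_on (greek ` W) h"
    "\<And>x. x \<in> W \<Longrightarrow> chart_inv d x \<in> L \<longleftrightarrow> latin x = h (greek x)"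
    by (rule local_graphE) blast
  \<comment> \<open>\<open>\<phi>\<close> parametrizes \<open>L\<close> by its projection in \<open>d\<close>, read in \<open>c\<close>. If \<open>g\<close> is a local inverse of
    \<open>greek \<circ> \<phi>\<close>, then \<open>L\<close> is the graph of \<open>latin \<circ> \<phi> \<circ> g\<close> in \<open>c\<close>.\<close>
  define R where "R = snd d ` (fst d \<inter> fst c)"
  define S where "S = {y \<in> greek ` W. join y (h y) \<in> R \<inter> W}"
  define \<tau> where "\<tau> = (\<lambda>x. snd c (chart_inv d x))"
  define \<psi> where "\<psi> = (\<lambda>x. snd d (chart_inv c x))"
  define \<phi> where "\<phi> = (\<lambda>y. \<tau> (join y (h y)))"
  let ?y = "greek (snd d p)"
  have oR: "open R" unfolding R_def using open_overlap[OF W(1) c(1)] .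
  have cd: "chart_inv d (snd d p) = p" and cc: "chart_inv c (snd c p) = p"
    using chart_inv_chart c W(1,2) by auto
  have hp: "join ?y (h ?y) = snd d p" using W(3) W(9)[OF W(5)] cd join_greek_latin by metis
  have sj: "smooth_on (greek ` W) (\<lambda>y. join y (h y))"
    by (intro smooth_on_join smooth_on_ident W)
  have "continuous_on (greek ` W) (\<lambda>y. join y (h y))"
    by (rule smooth_on_continuous_on[OF sj])
  then have "open ((\<lambda>y. join y (h y)) -` (R \<inter> W) \<inter> greek ` W)"
    using continuous_on_open_vimage[OF W(7)] oR W(4) by blast
  also have "(\<lambda>y. join y (h y)) -` (R \<inter> W) \<inter> greek ` W = S" by (auto simp: S_def)
  finally have oS: "open S" .
  have yS: "?y \<in> S" using hp W c by (auto simp: S_def R_def)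
  have s\<tau>: "smooth_on R \<tau>" unfolding R_def \<tau>_def by (rule smooth_transition[OF W(1) c(1)])
  have sjS: "smooth_on S (\<lambda>y. join y (h y))" by (rule smooth_on_subset[OF sj]) (auto simp: S_def)
  have s\<phi>: "smooth_on S \<phi>"
    unfolding \<phi>_def by (rule smooth_on_compose[OF oS oR _ sjS s\<tau>]) (auto simp: S_def)
  have sF: "smooth_on S (\<lambda>y. greek (\<phi> y))" by (rule smooth_on_greek[OF oS s\<phi>])
  have dh: "h differentiable (at ?y)" by (rule local_graph_differentiable[OF lg])
  have "((\<lambda>y. join y (h y)) has_derivative (\<lambda>\<xi>. lift (slope h ?y) \<xi>)) (at ?y)"
    using has_derivative_join[OF has_derivative_ident has_derivative_Der[OF dh]]
    by (simp add: lift_def slope_mult[OF dh])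
  from diff_chain_at[OF this, of \<tau> "transition_Der d c p"]
  have "(\<phi> has_derivative (\<lambda>\<xi>. transition_Der d c p (lift (slope h ?y) \<xi>))) (at ?y)"
    using transition_has_derivative[OF W(1) c(1) W(2) c(2)] hp by (simp add: o_def \<phi>_def \<tau>_def)
  then have dF: "Der (\<lambda>y. greek (\<phi> y)) ?y =
      (\<lambda>\<xi>. greek (transition_Der d c p (lift (slope h ?y) \<xi>)))"
    by (rule Der_eq[OF bounded_linear.has_derivative[OF bounded_linear_greek]])
  have inj: "\<xi> = 0" if "Der (\<lambda>y. greek (\<phi> y)) ?y \<xi> = 0" for \<xi>
  proof -
    let ?v = "tvec_of A d p (lift (slope h ?y) \<xi>)"
    have v: "?v \<in> tangent_to A L p" by (rule tvec_of_lift_tangent[OF lg])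
    have vc: "?v c = transition_Der d c p (lift (slope h ?y) \<xi>)" using c by (simp add: tvec_of_def)
    have "?v c = 0" by (rule trans[OF v]) (use that in \<open>simp add: dF vc\<close>)
    then have "?v = (\<lambda>c. 0)"
      using tangent_vector_eqI[OF tangent_to_subset[OF v] tangent_space_zero c] by simp
    then have "lift (slope h ?y) \<xi> = 0" using tvec_of_same[OF W(1,2)] by metis
    then have "greek (lift (slope h ?y) \<xi>) = greek (0 :: real^('n+'m))" by simp
    then show ?thesis by (simp add: vec_eq_iff)
  qed
  obtain U V g where U: "open U" "U \<subseteq> S" "?y \<in> U" and V: "open V"
    and hom: "homeomorphism U V (\<lambda>y. greek (\<phi> y)) g" and sg: "smooth_on V g"
    using smooth_inverse_function[OF oS sF yS inj] by blast
  have gU: "g z \<in> U" "greek (\<phi> (g z)) = z" if "z \<in> V" for z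
    using hom that by (auto simp: homeomorphism_def)
  have FV: "greek (\<phi> y) \<in> V" "g (greek (\<phi> y)) = y" if "y \<in> U" for y
    using hom that by (auto simp: homeomorphism_def)
  define f where "f = (\<lambda>z. latin (\<phi> (g z)))"
  have "smooth_on V (\<lambda>z. \<phi> (g z))"
    by (rule smooth_on_compose[OF V oS _ sg s\<phi>]) (use gU(1) U(2) in blast)
  then have sf: "smooth_on V f" unfolding f_def by (rule smooth_on_latin[OF V])
  \<comment> \<open>Restricting the projection in \<open>d\<close> to \<open>U\<close>, where \<open>greek \<circ> \<phi>\<close> is injective, excludes other
    sheets of \<open>L\<close> over the same point of \<open>V\<close>.\<close>
  define R' where "R' = snd c ` (fst c \<inter> fst d)"
  define W' where "W' = {x \<in> R'. \<psi> x \<in> W \<inter> greek -` U} \<inter> greek -` V"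
  have oR': "open R'" unfolding R'_def by (rule open_overlap[OF c(1) W(1)])
  have og: "open (greek -` Q)" if "open Q" for Q :: "(real^'n) set"
    using open_vimage[OF that] linear_continuous_on[OF bounded_linear_greek] by blast
  have "continuous_on R' \<psi>"
    unfolding R'_def \<psi>_def by (rule smooth_on_continuous_on[OF smooth_transition[OF c(1) W(1)]])
  then have "open (\<psi> -` (W \<inter> greek -` U) \<inter> R')"
    using continuous_on_open_vimage[OF oR'] W(4) og[OF U(1)] by blast
  also have "\<psi> -` (W \<inter> greek -` U) \<inter> R' = {x \<in> R'. \<psi> x \<in> W \<inter> greek -` U}" by auto
  finally have oW': "open W'" unfolding W'_def using og[OF V] by blast
  have \<phi>y: "\<phi> ?y = snd c p" by (simp add: \<phi>_def hp \<tau>_def cd)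
  have pW': "snd c p \<in> W'"
    using W(2,5) c(2) U(3) FV(1)[OF U(3)] by (auto simp: W'_def R'_def \<psi>_def cc \<phi>y)
  have iff: "chart_inv c x \<in> L \<longleftrightarrow> latin x = f (greek x)" if x: "x \<in> W'" for x
  proof -
    define q where "q = chart_inv c x"
    have q: "q \<in> fst c" "q \<in> fst d" "snd c q = x" "snd d q \<in> W" "greek (snd d q) \<in> U" "greek x \<in> V"
      using x chart_inv_mem_overlap[OF c(1), of x d] chart_chart_inv[of x c]
      by (auto simp: W'_def R'_def q_def \<psi>_def)
    have qL: "q \<in> L \<longleftrightarrow> latin (snd d q) = h (greek (snd d q))"
      using W(9)[OF q(4)] chart_inv_chart[OF W(1) q(2)] by simp
    show ?thesis
    proof
      assume "chart_inv c x \<in> L"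
      then have "join (greek (snd d q)) (h (greek (snd d q))) = snd d q"
        using qL join_greek_latin by (metis q_def)
      then have "\<phi> (greek (snd d q)) = x"
        using chart_inv_chart[OF W(1) q(2)] q(3) by (simp add: \<phi>_def \<tau>_def)
      then show "latin x = f (greek x)" using FV(2)[OF q(5)] by (simp add: f_def)
    next
      assume lx: "latin x = f (greek x)"
      let ?z = "g (greek x)"
      have z: "?z \<in> S" using gU(1)[OF q(6)] U(2) by blast
      have "\<phi> ?z = x"
        by (rule greek_latin_eqI) (use gU(2)[OF q(6)] lx in \<open>auto simp: f_def\<close>)
      moreover obtain r where r: "r \<in> fst d" "r \<in> fst c" "snd d r = join ?z (h ?z)" "snd d r \<in> W"
        using z by (auto simp: S_def R_def)
      ultimately have "snd c r = x"
        using chart_inv_chart[OF W(1) r(1)] by (simp add: \<phi>_def \<tau>_def)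
      then have "r = q" using q r inj_chart[OF c(1)] by (metis inj_onD)
      then have "q \<in> L" using qL r(3) by simp
      then show "chart_inv c x \<in> L" by (simp add: q_def)
    qed
  qed
  have "smooth_on (greek ` W') f" by (rule smooth_on_subset[OF sf]) (auto simp: W'_def)
  moreover have "W' \<subseteq> snd c ` fst c" by (auto simp: W'_def R'_def)
  ultimately have "local_graph A c f L p"
    unfolding local_graph_def using c W(3) oW' pW' iff by blast
  then show ?thesis by blast
qed

lemma transverse_if_local_graph:
  assumes "local_graph A c f L p" "v \<in> tangent_to A L p" "greek (v c) = 0"
  shows "v c = 0"
proof -
  have "latin (v c) = slope f (greek (snd c p)) *v greek (v c)"
    using assms(2) unfolding tangent_to_graph[OF assms(1)] by blast
  then show ?thesis using assms(3) by (intro greek_latin_eqI) (auto simp: vec_eq_iff)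
qed

lemma submanifold_local_graph: "submanifold A L \<Longrightarrow> p \<in> L \<Longrightarrow> \<exists>c f. local_graph A c f L p"
  by (simp add: submanifold_def)

lemma local_graph_tangent_eq:
  assumes "local_graph A c f L p" "submanifold A L'" "p \<in> L'" "tangent_to A L' p = tangent_to A L p"
  shows "\<exists>f'. local_graph A c f' L' p"
proof -
  obtain d h where h: "local_graph A d h L' p" using submanifold_local_graph assms by blast
  have "c \<in> A" "p \<in> fst c" using assms(1) by (auto simp: local_graph_def)
  then show ?thesis
    by (rule local_graph_if_transverse[OF h])
      (rule transverse_if_local_graph[OF assms(1)], simp_all add: assms(4))
qed

lemma local_graph_value:
  assumes "local_graph A c f L p"
  shows "f (greek (snd c p)) = latin (snd c p)"
proof -
  obtain W where "c \<in> A" "p \<in> fst c" "p \<in> L" "snd c p \<in> W"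
    "\<And>x. x \<in> W \<Longrightarrow> chart_inv c x \<in> L \<longleftrightarrow> latin x = f (greek x)"
    using assms by (rule local_graphE) blast
  then show ?thesis using chart_inv_chart by metis
qed

section \<open>First order contact\<close>

lemma slope_eq_if_contact:
  assumes "1 \<le> r" "local_graph A c f L p" "local_graph A c f' L' p"
    and "\<And>\<sigma> i. length \<sigma> \<le> r \<Longrightarrow>
      partial \<sigma> (\<lambda>x. f x $ i) (greek (snd c p)) = partial \<sigma> (\<lambda>x. f' x $ i) (greek (snd c p))"
  shows "slope f (greek (snd c p)) = slope f' (greek (snd c p))"
proof -
  have "slope f (greek (snd c p)) $ i $ l = slope f' (greek (snd c p)) $ i $ l" for i l
    using assms(4)[of "[l]" i] assms(1) partial_component local_graph_differentiable[OF assms(2)]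
      local_graph_differentiable[OF assms(3)] by (metis length_Cons list.size(3) One_nat_def)
  then show ?thesis by (simp add: vec_eq_iff)
qed

text \<open>Together with the converse below this makes first order contact an equivalence relation that
  may be tested in any chart, although \<open>contact\<close> only provides a single one.\<close>

lemma tangent_eq_if_contact:
  assumes "1 \<le> r" "contact A r p L L'"
  shows "p \<in> L" "p \<in> L'" "tangent_to A L p = tangent_to A L' p"
proof -
  from assms(2) obtain c f f' where lg: "local_graph A c f L p" "local_graph A c f' L' p"
    and eq: "\<And>\<sigma> i. length \<sigma> \<le> r \<Longrightarrow>
      partial \<sigma> (\<lambda>x. f x $ i) (greek (snd c p)) = partial \<sigma> (\<lambda>x. f' x $ i) (greek (snd c p))"
    unfolding contact_def by blast
  show "p \<in> L" "p \<in> L'" using lg by (auto simp: local_graph_def)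
  show "tangent_to A L p = tangent_to A L' p"
    unfolding tangent_to_graph[OF lg(1)] tangent_to_graph[OF lg(2)]
    using slope_eq_if_contact[OF assms(1) lg eq] by simp
qed

lemma contact_1_if_tangent_eq:
  assumes "submanifold A L" "submanifold A L'" "p \<in> L" "p \<in> L'"
      "tangent_to A L p = tangent_to A L' p"
  shows "contact A 1 p L L'"
proof -
  obtain c f where f: "local_graph A c f L p"
    using submanifold_local_graph[OF assms(1,3)] by blast
  obtain f' where f': "local_graph A c f' L' p" 
    using local_graph_tangent_eq[OF f assms(2,4) assms(5)[symmetric]] by blast
  note d = local_graph_differentiable[OF f] local_graph_differentiable[OF f']
  have "partial \<sigma> (\<lambda>x. f x $ i) (greek (snd c p)) = partial \<sigma> (\<lambda>x. f' x $ i) (greek (snd c p))"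
    if le: "length \<sigma> \<le> 1" for \<sigma> i
  proof (cases "\<sigma> = []")
    case True
    then show ?thesis using local_graph_value[OF f] local_graph_value[OF f'] by simp
  next
    case False
    then obtain l where "\<sigma> = [l]" using le by (cases \<sigma>) auto
    then show ?thesis
      using partial_component[OF d(1), of l i] partial_component[OF d(2), of l i]
        slope_eq_if_tangent_eq[OF f f' assms(5)] by simp
  qed
  then show ?thesis
    unfolding contact_def by (intro exI[of _ c] exI[of _ f] exI[of _ f'] conjI allI impI f f')
qed

lemma contact_refl: "submanifold A L \<Longrightarrow> p \<in> L \<Longrightarrow> contact A r p L L"
  unfolding contact_def using submanifold_local_graph by blast

lemma self_in_jet: "submanifold A L \<Longrightarrow> p \<in> L \<Longrightarrow> (L, p) \<in> jet A r L p"
  by (simp add: jet_def contact_refl)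

lemma base_point_jet: "submanifold A L \<Longrightarrow> p \<in> L \<Longrightarrow> base_point (jet A r L p) = p"
  unfolding base_point_def using self_in_jet[of L p r] by (intro the_equality) (auto simp: jet_def)

lemma in_jet_1_iff:
  assumes "submanifold A L" "p \<in> L"
  shows "(L', p') \<in> jet A 1 L p \<longleftrightarrow>
    p' = p \<and> submanifold A L' \<and> p \<in> L' \<and> tangent_to A L' p = tangent_to A L p"
  unfolding jet_def
  using contact_1_if_tangent_eq[OF assms(1) _ assms(2)] tangent_eq_if_contact[of 1 p L L'] by auto

lemma jet_1_eq_iff:
  assumes "submanifold A L" "p \<in> L" "submanifold A L'" "p' \<in> L'"
  shows "jet A 1 L p = jet A 1 L' p' \<longleftrightarrow> p = p' \<and> tangent_to A L p = tangent_to A L' p'"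
proof
  assume "jet A 1 L p = jet A 1 L' p'"
  then have "(L, p) \<in> jet A 1 L' p'" using self_in_jet[OF assms(1,2), of 1] by simp
  then show "p = p' \<and> tangent_to A L p = tangent_to A L' p'"
    using in_jet_1_iff[OF assms(3,4), of L p] by blast
next
  assume *: "p = p' \<and> tangent_to A L p = tangent_to A L' p'"
  have "(M, q) \<in> jet A 1 L p \<longleftrightarrow> (M, q) \<in> jet A 1 L' p'" for M q
    unfolding in_jet_1_iff[OF assms(1,2)] in_jet_1_iff[OF assms(3,4)]
    by (simp only: conjunct1[OF *] conjunct2[OF *, unfolded conjunct1[OF *]])
  then show "jet A 1 L p = jet A 1 L' p'" by auto
qed

text \<open>Graphs over a whole chart domain, used to produce submanifolds with prescribed jets.\<close>

definition graph_set :: "('p, 'n, 'm) echart \<Rightarrow> (real^'n \<Rightarrow> real^'m) \<Rightarrow> 'p set" where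
  "graph_set c f = {q \<in> fst c. latin (snd c q) = f (greek (snd c q))}"

lemma local_graph_graph_set:
  assumes "c \<in> A" "smooth_on UNIV f" "p \<in> graph_set c f"
  shows "local_graph A c f (graph_set c f) p"
  unfolding local_graph_def
proof (intro conjI exI[of _ "snd c ` fst c"] ballI)
  show "open (snd c ` fst c)" by (rule open_chart_image[OF assms(1)])
  show "smooth_on (greek ` snd c ` fst c) f" by (rule smooth_on_subset[OF assms(2)]) auto
  show "chart_inv c x \<in> graph_set c f \<longleftrightarrow> latin x = f (greek x)" if "x \<in> snd c ` fst c" for x
    using chart_inv_mem[OF that] chart_chart_inv[OF that] by (simp add: graph_set_def)
qed (use assms in \<open>auto simp: graph_set_def\<close>)

lemma submanifold_graph_set: "c \<in> A \<Longrightarrow> smooth_on UNIV f \<Longrightarrow> submanifold A (graph_set c f)"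
  unfolding submanifold_def using local_graph_graph_set by blast

end

section \<open>The charts on first order jets\<close>

text \<open>The image of the \<open>b\<close>-th vector of the standard basis of the plane with coordinates \<open>z\<close> in
  \<open>c\<close>, read in \<open>d\<close>.\<close>

definition frame ::
  "('p, 'n::finite, 'm::finite) echart \<Rightarrow> ('p, 'n, 'm) echart \<Rightarrow> 'n \<Rightarrow> ('n, 'm) coord1 \<Rightarrow> real^('n + 'm)"
  where
  "frame c d b z = (\<Sum>e\<in>UNIV. lift (snd z) (axis b 1) $ e *\<^sub>R
     Der (\<lambda>x. snd d (chart_inv c x)) (fst z) (axis e 1))"

definition frame_matrix ::
  "('p, 'n::finite, 'm::finite) echart \<Rightarrow> ('p, 'n, 'm) echart \<Rightarrow> ('n, 'm) coord1 \<Rightarrow> real^'n^'n" where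
  "frame_matrix c d z = (\<chi> b a. frame c d b z $ Inl a)"

text \<open>The new slopes solve a linear system with matrix \<open>frame_matrix\<close>; they are given by
  Cramer's rule.\<close>

definition slope_transition ::
  "('p, 'n::finite, 'm::finite) echart \<Rightarrow> ('p, 'n, 'm) echart \<Rightarrow> ('n, 'm) coord1 \<Rightarrow> real^'n^'m" where
  "slope_transition c d z = (\<chi> k l.
     det (\<chi> i j. if j = l then frame c d i z $ Inr k else frame_matrix c d z $ i $ j) /
     det (frame_matrix c d z))"

definition affine_map :: "('n::finite, 'm::finite) coord1 \<Rightarrow> real^'n \<Rightarrow> real^'m" where
  "affine_map z y = latin (fst z) + snd z *v (y - greek (fst z))"

lemma affine_map_has_derivative: "(affine_map z has_derivative (*v) (snd z)) (at y)"
proof -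
  have "((\<lambda>y. latin (fst z) + snd z *v (y - greek (fst z))) has_derivative
      (\<lambda>h. 0 + snd z *v (h - 0))) (at y)"
    by (intro has_derivative_add has_derivative_const has_derivative_diff has_derivative_ident
        bounded_linear.has_derivative[OF matrix_vector_mul_bounded_linear])
  then show ?thesis by (simp add: affine_map_def[abs_def])
qed

lemma slope_affine_map: "slope (affine_map z) y = snd z"
  by (simp add: slope_def Der_eq[OF affine_map_has_derivative] vec_eq_iff matrix_vector_mult_basis
      column_def)

lemma smooth_affine_map: "smooth_on UNIV (affine_map z)"
  unfolding affine_map_def[abs_def]
  by (intro smooth_on_add smooth_on_const smooth_on_bounded_linear[OF _
      matrix_vector_mul_bounded_linear]
      smooth_on_diff smooth_on_ident open_UNIV)

lemma affine_map_base: "affine_map z (greek (fst z)) = latin (fst z)"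
  by (simp add: affine_map_def)

lemma smooth_on_lift_axis:
  assumes "open S"
  shows "smooth_on S (\<lambda>z::('n::finite, 'm::finite) coord1. lift (snd z) (axis b 1) $ e)"
proof (cases e)
  case (Inl l)
  then show ?thesis by (simp add: lift_def smooth_on_const)
next
  case (Inr i)
  have "smooth_on S (\<lambda>z::('n, 'm) coord1. snd z $ i $ b)"
    by (intro smooth_on_nth smooth_on_bounded_linear[OF _ bounded_linear_snd] smooth_on_ident assms)
  then show ?thesis using Inr by (simp add: lift_def matrix_vector_mult_basis column_def)
qed

lemma smooth_on_frame:
  fixes c d :: "('p, 'n::finite, 'm::finite) echart"
  assumes "open R" "smooth_on R (\<lambda>x. snd d (chart_inv c x))"
  shows "smooth_on (R \<times> UNIV) (frame c d b)"
proof -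
  have o: "open (R \<times> (UNIV :: (real^'n^'m) set))" using assms(1) by (simp add: open_Times)
  have "smooth_on (R \<times> UNIV) (\<lambda>z::('n, 'm) coord1.
      Der (\<lambda>x. snd d (chart_inv c x)) (fst z) (axis e 1))" for e
    by (rule smooth_on_compose[OF o assms(1) _ smooth_on_bounded_linear[OF o bounded_linear_fst
            smooth_on_ident[OF o]] smooth_on_Der[OF assms(2)]]) auto
  then show ?thesis
    unfolding frame_def by (intro smooth_on_sum[OF o] smooth_on_scaleR[OF o] smooth_on_lift_axis[OF
        o])
qed

context jet_manifold
begin

abbreviation J1 :: "('p, 'n, 'm) echart \<Rightarrow> ('p jet, ('n, 'm) coord1) chart" where
  "J1 c \<equiv> jet1_chart A c"

lemma fst_J1: "fst (J1 c) = jet_dom A 1 c"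
  by (simp add: jet1_chart_def)

lemma jets_cases:
  assumes "\<theta> \<in> jets A r"
  obtains L p where "submanifold A L" "p \<in> L" "\<theta> = jet A r L p"
  using assms unfolding jets_def by blast

lemma jet_in_jets: "submanifold A L \<Longrightarrow> p \<in> L \<Longrightarrow> jet A r L p \<in> jets A r"
  unfolding jets_def by blast

lemma jet_dom_1_iff:
  assumes "submanifold A L" "p \<in> L"
  shows "jet A 1 L p \<in> jet_dom A 1 c \<longleftrightarrow> (\<exists>f. local_graph A c f L p)"
proof
  assume "jet A 1 L p \<in> jet_dom A 1 c"
  then obtain L' p' f where *: "(L', p') \<in> jet A 1 L p" "local_graph A c f L' p'"
    unfolding jet_dom_def by blast
  then show "\<exists>f. local_graph A c f L p"
    using local_graph_tangent_eq[of c f L' p L] in_jet_1_iff[OF assms, of L' p'] assms by metis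
next
  assume "\<exists>f. local_graph A c f L p"
  then show "jet A 1 L p \<in> jet_dom A 1 c"
    unfolding jet_dom_def using jet_in_jets[OF assms] self_in_jet[OF assms] by blast
qed

lemma jet_dom_1_cases:
  assumes "\<theta> \<in> jet_dom A 1 c"
  obtains L p f where "submanifold A L" "p \<in> L" "\<theta> = jet A 1 L p" "local_graph A c f L p"
proof -
  have "\<theta> \<in> jets A 1" using assms by (simp add: jet_dom_def)
  then obtain L p where L: "submanifold A L" "p \<in> L" "\<theta> = jet A 1 L p" by (rule jets_cases)
  then show thesis using that assms jet_dom_1_iff[OF L(1,2), of c] by blast
qed

lemma jet_coord_1:
  assumes L: "submanifold A L" "p \<in> L" and f: "local_graph A c f L p"
  shows "jet_coord A c i [l] (jet A 1 L p) = slope f (greek (snd c p)) $ i $ l"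
  unfolding jet_coord_def
proof (rule the_equality)
  have "partial [l] (\<lambda>x. f x $ i) (greek (snd c p)) = slope f (greek (snd c p)) $ i $ l"
    by (rule partial_component[OF local_graph_differentiable[OF f]])
  then show "\<exists>L' p' f'. (L', p') \<in> jet A 1 L p \<and> local_graph A c f' L' p' \<and>
      slope f (greek (snd c p)) $ i $ l = partial [l] (\<lambda>x. f' x $ i) (greek (snd c p'))"
    using self_in_jet[OF L, of 1] f by metis
next
  fix y assume "\<exists>L' p' f'. (L', p') \<in> jet A 1 L p \<and> local_graph A c f' L' p' \<and>
      y = partial [l] (\<lambda>x. f' x $ i) (greek (snd c p'))"
  then obtain L' p' f' where *: "(L', p') \<in> jet A 1 L p" "local_graph A c f' L' p'"
    "y = partial [l] (\<lambda>x. f' x $ i) (greek (snd c p'))" by blast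
  then have p: "p' = p" "tangent_to A L' p = tangent_to A L p"
    using in_jet_1_iff[OF L, of L' p'] by blast+
  show "y = slope f (greek (snd c p)) $ i $ l"
    using *(3) partial_component[OF local_graph_differentiable[OF *(2)], of l i]
      slope_eq_if_tangent_eq[OF *(2)[unfolded p(1)] f p(2)] p(1) by simp
qed

lemma J1_coords:
  assumes "submanifold A L" "p \<in> L" "local_graph A c f L p"
  shows "snd (J1 c) (jet A 1 L p) = (snd c p, slope f (greek (snd c p)))"
  unfolding jet1_chart_def using base_point_jet[OF assms(1,2)]
  by (simp only: jet_coord_1[OF assms] snd_conv vec_lambda_eta)

lemma local_graph_dom: "local_graph A c f L p \<Longrightarrow> c \<in> A" "local_graph A c f L p \<Longrightarrow> p \<in> fst c"
  by (auto simp: local_graph_def)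

lemma base_point_dom: "\<theta> \<in> jet_dom A 1 c \<Longrightarrow> base_point \<theta> \<in> fst c"
  by (erule jet_dom_1_cases) (use local_graph_dom in \<open>auto simp: base_point_jet\<close>)

lemma fst_J1_coords: "fst (snd (J1 c) \<theta>) = snd c (base_point \<theta>)"
  by (simp add: jet1_chart_def)

lemma tangent_to_J1:
  assumes "submanifold A L" "p \<in> L" "jet A 1 L p \<in> jet_dom A 1 c"
  shows "tangent_to A L p =
    {v \<in> tangent_space A p. latin (v c) = snd (snd (J1 c) (jet A 1 L p)) *v greek (v c)}"
proof -
  obtain f where f: "local_graph A c f L p" using jet_dom_1_iff[OF assms(1,2)] assms(3) by blast
  show ?thesis unfolding tangent_to_graph[OF f] J1_coords[OF assms(1,2) f] by simp
qed

lemma inj_J1: "inj_on (snd (J1 c)) (jet_dom A 1 c)"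
proof (rule inj_onI)
  fix \<theta> \<theta>' assume \<theta>: "\<theta> \<in> jet_dom A 1 c" and \<theta>': "\<theta>' \<in> jet_dom A 1 c"
    and eq: "snd (J1 c) \<theta> = snd (J1 c) \<theta>'"
  obtain L p f where L: "submanifold A L" "p \<in> L" "\<theta> = jet A 1 L p" "local_graph A c f L p"
    using \<theta> by (rule jet_dom_1_cases)
  obtain L' p' f' where L': "submanifold A L'" "p' \<in> L'" "\<theta>' = jet A 1 L' p'"
      "local_graph A c f' L' p'"
    using \<theta>' by (rule jet_dom_1_cases)
  have "snd c p = snd c p'" using eq J1_coords[OF L(1,2,4)] J1_coords[OF L'(1,2,4)] L(3) L'(3)
      by simp
  then have p: "p = p'"
    using inj_chart[OF local_graph_dom(1)[OF L(4)]] local_graph_dom(2)[OF L(4)]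
        local_graph_dom(2)[OF L'(4)]
    by (metis inj_onD)
  moreover have "tangent_to A L p = tangent_to A L' p'"
    using tangent_to_J1[OF L(1,2)] tangent_to_J1[OF L'(1,2)] \<theta> \<theta>' L(3) L'(3) eq p by simp
  ultimately show "\<theta> = \<theta>'" using jet_1_eq_iff[OF L(1,2) L'(1,2)] L(3) L'(3) by simp
qed

text \<open>The jet with given coordinates, represented by an affine graph.\<close>

definition jet_at :: "('p, 'n, 'm) echart \<Rightarrow> ('n, 'm) coord1 \<Rightarrow> 'p jet" where
  "jet_at c z = jet A 1 (graph_set c (affine_map z)) (chart_inv c (fst z))"

lemma jet_at:
  assumes "c \<in> A" "fst z \<in> snd c ` fst c"
  shows "jet_at c z \<in> jet_dom A 1 c" "snd (J1 c) (jet_at c z) = z"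
    "base_point (jet_at c z) = chart_inv c (fst z)"
proof -
  let ?p = "chart_inv c (fst z)" and ?L = "graph_set c (affine_map z)"
  have cp: "snd c ?p = fst z" using chart_chart_inv[OF assms(2)] .
  have p: "?p \<in> ?L"
    using chart_inv_mem[OF assms(2)] cp by (simp add: graph_set_def affine_map_base)
  have L: "submanifold A ?L" by (rule submanifold_graph_set[OF assms(1) smooth_affine_map])
  have f: "local_graph A c (affine_map z) ?L ?p"
    by (rule local_graph_graph_set[OF assms(1) smooth_affine_map p])
  show "jet_at c z \<in> jet_dom A 1 c" unfolding jet_at_def using jet_dom_1_iff[OF L p] f by blast
  show "snd (J1 c) (jet_at c z) = z"
    unfolding jet_at_def J1_coords[OF L p f] by (simp add: cp slope_affine_map)
  show "base_point (jet_at c z) = ?p" unfolding jet_at_def by (rule base_point_jet[OF L p])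
qed

lemma chart_inv_J1: "\<theta> \<in> jet_dom A 1 c \<Longrightarrow> chart_inv (J1 c) (snd (J1 c) \<theta>) = \<theta>"
  using inj_J1 by (simp add: chart_inv_def fst_J1)

lemma chart_inv_J1_jet_at:
  assumes "c \<in> A" "fst z \<in> snd c ` fst c"
  shows "chart_inv (J1 c) z = jet_at c z"
  using chart_inv_J1[OF jet_at(1)[OF assms]] jet_at(2)[OF assms] by simp

lemma J1_image: "c \<in> A \<Longrightarrow> snd (J1 c) ` jet_dom A 1 c = (snd c ` fst c) \<times> UNIV"
proof (intro equalityI subsetI)
  fix z assume "c \<in> A" "z \<in> snd (J1 c) ` jet_dom A 1 c"
  then obtain \<theta> where "\<theta> \<in> jet_dom A 1 c" "z = snd (J1 c) \<theta>" by blast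
  then show "z \<in> (snd c ` fst c) \<times> UNIV"
    using base_point_dom[of \<theta> c] fst_J1_coords[of c \<theta>] by (auto simp: mem_Times_iff)
next
  fix z :: "('n, 'm) coord1" assume "c \<in> A" "z \<in> (snd c ` fst c) \<times> UNIV"
  then have "fst z \<in> snd c ` fst c" by auto
  from jet_at[OF \<open>c \<in> A\<close> this] show "z \<in> snd (J1 c) ` jet_dom A 1 c" by (metis imageI)
qed

lemma frame_eq:
  assumes "c \<in> A" "d \<in> A" "p \<in> fst c" "p \<in> fst d"
  shows "frame c d b (snd c p, u) = transition_Der c d p (lift u (axis b 1))"
  unfolding linear_axis_sum[OF linear_transition_Der[OF assms], of "lift u (axis b 1)"]
  by (simp add: frame_def transition_Der_def)

lemma frame_matrix_mult:
  assumes "c \<in> A" "d \<in> A" "p \<in> fst c" "p \<in> fst d"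
  shows "transpose (frame_matrix c d (snd c p, u)) *v \<xi> = greek (transition_Der c d p (lift u \<xi>))"
proof -
  have "linear (\<lambda>\<xi>. transition_Der c d p (lift u \<xi>))"
    using linear_compose[OF linear_lift linear_transition_Der[OF assms]] by (simp add: o_def)
  from linear_axis_sum[OF this, of \<xi>] show ?thesis
    by (simp add: vec_eq_iff matrix_vector_mult_def transpose_def frame_matrix_def frame_eq[OF
        assms] mult.commute)
qed

lemma det_frame_matrix:
  assumes "c \<in> A" "d \<in> A" "p \<in> fst c" "p \<in> fst d"
  shows "det (frame_matrix c d (snd c p, u)) \<noteq> 0 \<longleftrightarrow>
    (\<forall>\<xi>. greek (transition_Der c d p (lift u \<xi>)) = 0 \<longrightarrow> \<xi> = 0)"
proof -
  let ?P = "transpose (frame_matrix c d (snd c p, u))"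
  have "det (frame_matrix c d (snd c p, u)) \<noteq> 0 \<longleftrightarrow> invertible ?P"
    by (simp add: invertible_det_nz det_transpose)
  also have "\<dots> \<longleftrightarrow> (\<forall>\<xi>. ?P *v \<xi> = 0 \<longrightarrow> \<xi> = 0)"
    unfolding invertible_left_inverse matrix_left_invertible_ker ..
  finally show ?thesis unfolding frame_matrix_mult[OF assms] .
qed

text \<open>The determinant tests whether the plane of the jet is transverse to the fibres of \<open>d\<close>.\<close>

lemma jet_dom_1_overlap:
  assumes c: "c \<in> A" "d \<in> A" and \<theta>: "\<theta> \<in> jet_dom A 1 c"
  shows "\<theta> \<in> jet_dom A 1 d \<longleftrightarrow>
    base_point \<theta> \<in> fst d \<and> det (frame_matrix c d (snd (J1 c) \<theta>)) \<noteq> 0"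
proof -
  obtain L p f where L: "submanifold A L" "p \<in> L" "\<theta> = jet A 1 L p" "local_graph A c f L p"
    using \<theta> by (rule jet_dom_1_cases)
  let ?u = "slope f (greek (snd c p))"
  have pc: "p \<in> fst c" using local_graph_dom(2)[OF L(4)] .
  have bp: "base_point \<theta> = p" using base_point_jet L by simp
  have coords: "snd (J1 c) \<theta> = (snd c p, ?u)" using J1_coords L by simp
  show ?thesis
  proof (cases "p \<in> fst d")
    case False
    then show ?thesis using base_point_dom[of \<theta> d] bp by auto
  next
    case pd: True
    have vT: "tvec_of A c p (lift ?u \<xi>) \<in> tangent_to A L p" for \<xi>
      by (rule tvec_of_lift_tangent[OF L(4)])
    have vd: "tvec_of A c p (lift ?u \<xi>) d = transition_Der c d p (lift ?u \<xi>)" for \<xi>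
      using c pd by (simp add: tvec_of_def)
    have "(\<exists>f. local_graph A d f L p) \<longleftrightarrow>
        (\<forall>\<xi>. greek (transition_Der c d p (lift ?u \<xi>)) = 0 \<longrightarrow> \<xi> = 0)"
    proof
      assume "\<exists>f. local_graph A d f L p"
      then obtain h where h: "local_graph A d h L p" by blast
      show "\<forall>\<xi>. greek (transition_Der c d p (lift ?u \<xi>)) = 0 \<longrightarrow> \<xi> = 0"
      proof (intro allI impI)
        fix \<xi> assume "greek (transition_Der c d p (lift ?u \<xi>)) = 0"
        then have "tvec_of A c p (lift ?u \<xi>) d = 0"
          using transverse_if_local_graph[OF h vT] vd by simp
        then have "tvec_of A c p (lift ?u \<xi>) = (\<lambda>c. 0)"
          by (rule tangent_vector_eqI[OF tangent_to_subset[OF vT] tangent_space_zero c(2) pd])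
        then have "lift ?u \<xi> = 0" using tvec_of_same[OF c(1) pc] by metis
        then have "greek (lift ?u \<xi>) = greek (0 :: real^('n + 'm))" by simp
        then show "\<xi> = 0" by (simp add: vec_eq_iff)
      qed
    next
      assume inj: "\<forall>\<xi>. greek (transition_Der c d p (lift ?u \<xi>)) = 0 \<longrightarrow> \<xi> = 0"
      show "\<exists>f. local_graph A d f L p"
      proof (rule local_graph_if_transverse[OF L(4) c(2) pd])
        fix v assume v: "v \<in> tangent_to A L p" "greek (v d) = 0"
        have "lift ?u (greek (v c)) = v c"
          using v(1) unfolding tangent_to_graph[OF L(4)] by (auto intro: lift_greek)
        moreover have "v d = transition_Der c d p (v c)"
          by (rule tangent_space_transition[OF tangent_to_subset[OF v(1)] c pc pd])
        ultimately have "v d = transition_Der c d p (lift ?u (greek (v c)))"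
            "v c = lift ?u (greek (v c))"
          by simp_all
        then show "v d = 0"
          using inj v(2) linear_0[OF linear_lift] linear_0[OF linear_transition_Der[OF c pc pd]]
              by metis
      qed
    qed
    then show ?thesis
      using jet_dom_1_iff[OF L(1,2), of d] det_frame_matrix[OF c pc pd, of ?u] bp coords pd L(3)
          by simp
  qed
qed

text \<open>The images in \<open>d\<close> of the basis vectors of the plane satisfy the equation of the plane in \<open>d\<close>;
  this is a linear system for the rows of the new slope.\<close>

lemma J1_transition:
  assumes c: "c \<in> A" "d \<in> A" and \<theta>: "\<theta> \<in> jet_dom A 1 c" "\<theta> \<in> jet_dom A 1 d"
  shows "snd (J1 d) \<theta> = (snd d (base_point \<theta>), slope_transition c d (snd (J1 c) \<theta>))"
proof -
  obtain L p f where L: "submanifold A L" "p \<in> L" "\<theta> = jet A 1 L p" "local_graph A c f L p"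
    using \<theta>(1) by (rule jet_dom_1_cases)
  let ?u = "slope f (greek (snd c p))" and ?u' = "snd (snd (J1 d) \<theta>)" and ?z = "snd (J1 c) \<theta>"
  have z: "?z = (snd c p, ?u)" using J1_coords L by simp
  have p: "base_point \<theta> = p" "p \<in> fst c" "p \<in> fst d"
    using base_point_jet[OF L(1,2)] base_point_dom[OF \<theta>(1)] base_point_dom[OF \<theta>(2)] L(3) by auto
  have det: "det (frame_matrix c d ?z) \<noteq> 0"
    using jet_dom_1_overlap[OF c \<theta>(1)] \<theta>(2) by simp
  have "latin (frame c d b ?z) = ?u' *v greek (frame c d b ?z)" for b
  proof -
    have "tvec_of A c p (lift ?u (axis b 1)) \<in> tangent_to A L p"
      by (rule tvec_of_lift_tangent[OF L(4)])
    then have "latin (tvec_of A c p (lift ?u (axis b 1)) d) =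
        ?u' *v greek (tvec_of A c p (lift ?u (axis b 1)) d)"
      unfolding tangent_to_J1[OF L(1,2) \<theta>(2)[unfolded L(3)], folded L(3)] by blast
    then show ?thesis
      unfolding z frame_eq[OF c p(2,3)] by (simp add: tvec_of_def c(2) p(3))
  qed
  then have "frame_matrix c d ?z *v (?u' $ k) = (\<chi> b. frame c d b ?z $ Inr k)" for k
    by (simp add: vec_eq_iff matrix_vector_mult_def frame_matrix_def mult.commute)
  from cramer[OF det, THEN iffD1, OF this] have "?u' = slope_transition c d ?z"
    by (simp add: vec_eq_iff slope_transition_def cong: if_cong)
  then show ?thesis using fst_J1_coords p(1) by (metis prod.collapse)
qed

lemma
  assumes c: "c \<in> A" "d \<in> A"
  shows J1_overlap: "snd (J1 c) ` (jet_dom A 1 c \<inter> jet_dom A 1 d) =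
      {z \<in> (snd c ` (fst c \<inter> fst d)) \<times> UNIV. det (frame_matrix c d z) \<noteq> 0}" (is "?O = ?R")
    and open_J1_overlap: "open (snd (J1 c) ` (jet_dom A 1 c \<inter> jet_dom A 1 d))"
    and smooth_slope_transition:
      "smooth_on (snd (J1 c) ` (jet_dom A 1 c \<inter> jet_dom A 1 d)) (slope_transition c d)"
proof -
  let ?B = "snd c ` (fst c \<inter> fst d)"
  show eq: "?O = ?R"
  proof (intro equalityI subsetI)
    fix z assume "z \<in> ?O"
    then obtain \<theta> where \<theta>: "\<theta> \<in> jet_dom A 1 c" "\<theta> \<in> jet_dom A 1 d" "z = snd (J1 c) \<theta>" by blast
    then show "z \<in> ?R"
      using jet_dom_1_overlap[OF c \<theta>(1)] base_point_dom[OF \<theta>(1)] fst_J1_coords[of c \<theta>]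
      by (auto simp: mem_Times_iff)
  next
    fix z assume z: "z \<in> ?R"
    then obtain q where q: "q \<in> fst c" "q \<in> fst d" "fst z = snd c q" by auto
    then have x: "fst z \<in> snd c ` fst c" "chart_inv c (fst z) = q"
      using chart_inv_chart[OF c(1)] by auto
    note j = jet_at[OF c(1) x(1)]
    have "jet_at c z \<in> jet_dom A 1 d"
      using jet_dom_1_overlap[OF c j(1)] j(2,3) x(2) q z by auto
    then show "z \<in> ?O" using j(1,2) by (metis IntI imageI)
  qed
  have oB: "open ?B" by (rule open_overlap[OF c])
  have oBU: "open (?B \<times> (UNIV :: (real^'n^'m) set))" using oB by (simp add: open_Times)
  have sf: "smooth_on (?B \<times> UNIV) (\<lambda>z. frame c d b z $ e)" for b e
    by (intro smooth_on_nth oBU smooth_on_frame oB smooth_transition c)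
  have sdet: "smooth_on (?B \<times> UNIV) (\<lambda>z. det (frame_matrix c d z))"
    unfolding frame_matrix_def by (intro smooth_on_det oBU sf)
  have "open ((\<lambda>z. det (frame_matrix c d z)) -` (- {0}) \<inter> (?B \<times> UNIV))"
    by (rule continuous_on_open_vimage[OF oBU, THEN iffD1, OF smooth_on_continuous_on[OF sdet],
        rule_format])
      (simp add: open_Compl)
  also have "(\<lambda>z. det (frame_matrix c d z)) -` (- {0}) \<inter> (?B \<times> UNIV) = ?R" by blast
  finally show o: "open ?O" unfolding eq .
  have sub: "?O \<subseteq> ?B \<times> UNIV" unfolding eq by blast
  show "smooth_on ?O (slope_transition c d)"
    unfolding slope_transition_def
  proof (intro smooth_on_vec smooth_on_divide o smooth_on_det)
    show "smooth_on ?O (\<lambda>z. if j = l then frame c d i z $ Inr k else frame_matrix c d z $ i $ j)"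
        for i j k l
      using smooth_on_subset[OF sf sub] by (cases "j = l") (simp_all add: frame_matrix_def)
    show "smooth_on ?O (\<lambda>z. det (frame_matrix c d z))" by (rule smooth_on_subset[OF sdet sub])
    show "det (frame_matrix c d z) \<noteq> 0" if "z \<in> ?O" for z using that unfolding eq by blast
  qed
qed

lemma jet1_atlasE:
  assumes "C \<in> jet1_atlas A"
  obtains c where "c \<in> A" "C = J1 c"
  using assms unfolding jet1_atlas_def by blast

lemma jet1_atlasI: "c \<in> A \<Longrightarrow> J1 c \<in> jet1_atlas A"
  unfolding jet1_atlas_def by blast

sublocale jet1: differentiable_atlas "jet1_atlas A"
proof
  fix C assume "C \<in> jet1_atlas A"
  then obtain c where c: "c \<in> A" "C = J1 c" by (rule jet1_atlasE)
  show "inj_on (snd C) (fst C)" using inj_J1 c by (simp add: fst_J1)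
  fix D assume "D \<in> jet1_atlas A"
  then obtain d where d: "d \<in> A" "D = J1 d" by (rule jet1_atlasE)
  show "open (snd C ` (fst C \<inter> fst D))"
    using open_J1_overlap[OF c(1) d(1)] c(2) d(2) by (simp add: fst_J1)
  fix \<theta> assume \<theta>: "\<theta> \<in> fst C" "\<theta> \<in> fst D"
  let ?O = "snd (J1 c) ` (jet_dom A 1 c \<inter> jet_dom A 1 d)" and ?B = "snd c ` (fst c \<inter> fst d)"
  have o: "open ?O" by (rule open_J1_overlap[OF c(1) d(1)])
  have "smooth_on ?O (\<lambda>z. snd d (chart_inv c (fst z)))"
  proof (rule smooth_on_compose[OF o open_overlap[OF c(1) d(1)] _ _ smooth_transition[OF c(1)
      d(1)]])
    show "fst ` ?O \<subseteq> ?B" unfolding J1_overlap[OF c(1) d(1)] by auto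
    show "smooth_on ?O fst"
      by (rule smooth_on_bounded_linear[OF o bounded_linear_fst smooth_on_ident[OF o]])
  qed
  then have "smooth_on ?O (\<lambda>z. (snd d (chart_inv c (fst z)), slope_transition c d z))"
    by (intro smooth_on_Pair o smooth_slope_transition c(1) d(1))
  then have "smooth_on ?O (\<lambda>z. snd D (chart_inv C z))"
  proof (rule smooth_on_cong[OF o, rotated])
    fix z assume "z \<in> ?O"
    then obtain \<eta> where \<eta>: "\<eta> \<in> jet_dom A 1 c" "\<eta> \<in> jet_dom A 1 d" "z = snd (J1 c) \<eta>" by blast
    have "chart_inv c (fst z) = base_point \<eta>"
      using \<eta>(3) fst_J1_coords[of c \<eta>] chart_inv_chart[OF c(1) base_point_dom[OF \<eta>(1)]] by simp
    then show "(snd d (chart_inv c (fst z)), slope_transition c d z) = snd D (chart_inv C z)"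
      using J1_transition[OF c(1) d(1) \<eta>(1,2)] chart_inv_J1[OF \<eta>(1)] c(2) d(2) \<eta>(3) by simp
  qed
  then show "(\<lambda>x. snd D (chart_inv C x)) differentiable (at (snd C \<theta>))"
    by (rule smooth_on_differentiable) (use \<theta> c(2) d(2) in \<open>auto simp: fst_J1\<close>)
qed

lemma jets_1_dom:
  assumes "\<theta> \<in> jets A 1"
  obtains c where "c \<in> A" "\<theta> \<in> jet_dom A 1 c"
proof -
  obtain L p where L: "submanifold A L" "p \<in> L" "\<theta> = jet A 1 L p" using assms by (rule jets_cases)
  obtain c f where f: "local_graph A c f L p" using submanifold_local_graph[OF L(1,2)] by blast
  show thesis
    using that[OF local_graph_dom(1)[OF f]] jet_dom_1_iff[OF L(1,2), of c] f L(3) by blast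
qed

lemma R_plane1_jet:
  assumes "submanifold A L" "p \<in> L"
  shows "R_plane1 A (jet A 1 L p) = tangent_to A L p"
proof -
  have "tangent_to A (fst x) (snd x) = tangent_to A L p" if "x \<in> jet A 1 L p" for x
    using that in_jet_1_iff[OF assms, of "fst x" "snd x"] by (metis prod.collapse)
  then have "(\<Union>x\<in>jet A 1 L p. tangent_to A (fst x) (snd x)) = (\<Union>x\<in>jet A 1 L p. tangent_to A L p)"
    by (rule SUP_cong[OF refl])
  then show ?thesis
    unfolding R_plane1_def case_prod_unfold using self_in_jet[OF assms, of 1] by blast
qed

text \<open>In induced charts \<open>base_point\<close> is the first projection. The second part needs an argument since
  \<open>differential\<close> reads the source in a chart of its own choice.\<close>

lemma differential_base_point:
  assumes \<theta>: "\<theta> \<in> jets A 1" and W: "W \<in> tangent_space (jet1_atlas A) \<theta>"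
  shows "differential (jet1_atlas A) A base_point \<theta> W \<in> tangent_space A (base_point \<theta>)"
    and "\<And>d. d \<in> A \<Longrightarrow> \<theta> \<in> jet_dom A 1 d \<Longrightarrow>
      differential (jet1_atlas A) A base_point \<theta> W d = fst (W (J1 d))"
proof -
  define C where "C = (SOME C. C \<in> jet1_atlas A \<and> \<theta> \<in> fst C)"
  obtain c0 where "c0 \<in> A" "\<theta> \<in> jet_dom A 1 c0" using \<theta> by (rule jets_1_dom)
  then have "J1 c0 \<in> jet1_atlas A \<and> \<theta> \<in> fst (J1 c0)" using jet1_atlasI by (simp add: fst_J1)
  then have "C \<in> jet1_atlas A \<and> \<theta> \<in> fst C" unfolding C_def by (rule someI)
  then have C: "C \<in> jet1_atlas A" "\<theta> \<in> fst C" by auto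
  obtain e where e: "e \<in> A" "C = J1 e" using C(1) by (rule jet1_atlasE)
  have \<theta>e: "\<theta> \<in> jet_dom A 1 e" using C(2) e(2) by (simp add: fst_J1)
  let ?p = "base_point \<theta>" and ?z = "snd (J1 e) \<theta>"
  have pe: "?p \<in> fst e" by (rule base_point_dom[OF \<theta>e])
  have der1: "((\<lambda>z. snd d (chart_inv e (fst z))) has_derivative
      (\<lambda>w. transition_Der e d ?p (fst w))) (at ?z)"
    if "d \<in> A" "?p \<in> fst d" for d
  proof -
    have "((\<lambda>x. snd d (chart_inv e x)) has_derivative transition_Der e d ?p) (at (fst ?z))"
      using transition_has_derivative[OF e(1) that(1) pe that(2)] by (simp add: fst_J1_coords)
    from diff_chain_at[OF bounded_linear.has_derivative[OF bounded_linear_fst has_derivative_ident]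
        this]
    show ?thesis by (simp add: o_def)
  qed
  have diff_eq: "differential (jet1_atlas A) A base_point \<theta> W = tvec_of A e ?p (fst (W (J1 e)))"
  proof
    fix d
    show "differential (jet1_atlas A) A base_point \<theta> W d = tvec_of A e ?p (fst (W (J1 e))) d"
    proof (cases "d \<in> A \<and> ?p \<in> fst d")
      case True
      have "((\<lambda>z. snd d (base_point (chart_inv (J1 e) z))) has_derivative
          (\<lambda>w. transition_Der e d ?p (fst w))) (at ?z)"
      proof (rule has_derivative_transform_within_open[OF der1])
        show "open ((snd e ` fst e) \<times> (UNIV :: (real^'n^'m) set))"
          using open_chart_image[OF e(1)] by (simp add: open_Times)
        show "?z \<in> (snd e ` fst e) \<times> UNIV" using J1_image[OF e(1)] \<theta>e by blast
        fix z :: "('n, 'm) coord1" assume "z \<in> (snd e ` fst e) \<times> UNIV"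
        then have "fst z \<in> snd e ` fst e" by auto
        from chart_inv_J1_jet_at[OF e(1) this] jet_at(3)[OF e(1) this]
        show "snd d (chart_inv e (fst z)) = snd d (base_point (chart_inv (J1 e) z))" by simp
      qed (use True in auto)
      then show ?thesis
        using True by (simp add: differential_def C_def[symmetric] e(2) tvec_of_def Der_eq)
    qed (auto simp: differential_def tvec_of_def)
  qed
  show "differential (jet1_atlas A) A base_point \<theta> W \<in> tangent_space A ?p"
    unfolding diff_eq using tvec_of_in_tangent_space[OF e(1) pe] by simp
  fix d assume d: "d \<in> A" "\<theta> \<in> jet_dom A 1 d"
  have pd: "?p \<in> fst d" by (rule base_point_dom[OF d(2)])
  note trans = jet1.transition_has_derivative[OF jet1_atlasI[OF e(1)] jet1_atlasI[OF d(1)],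
      unfolded fst_J1, OF \<theta>e d(2)]
  from bounded_linear.has_derivative[OF bounded_linear_fst trans]
  have "((\<lambda>z. snd d (chart_inv e (fst z))) has_derivative
      (\<lambda>w. fst (transition_Der (J1 e) (J1 d) \<theta> w))) (at ?z)"
  proof (rule has_derivative_transform_within_open[OF _ open_J1_overlap[OF e(1) d(1)]])
    show "?z \<in> snd (J1 e) ` (jet_dom A 1 e \<inter> jet_dom A 1 d)" using \<theta>e d(2) by blast
    fix z assume "z \<in> snd (J1 e) ` (jet_dom A 1 e \<inter> jet_dom A 1 d)"
    then obtain \<eta> where \<eta>: "\<eta> \<in> jet_dom A 1 e" "\<eta> \<in> jet_dom A 1 d" "z = snd (J1 e) \<eta>" by blast
    show "fst (snd (J1 d) (chart_inv (J1 e) z)) = snd d (chart_inv e (fst z))"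
      using \<eta>(3) chart_inv_J1[OF \<eta>(1)] chart_inv_chart[OF e(1) base_point_dom[OF \<eta>(1)]]
      by (simp add: fst_J1_coords)
  qed
  with der1[OF d(1) pd] have tr: "(\<lambda>w. transition_Der e d ?p (fst w)) =
      (\<lambda>w. fst (transition_Der (J1 e) (J1 d) \<theta> w))"
    by (rule has_derivative_unique)
  have Wd: "W (J1 d) = transition_Der (J1 e) (J1 d) \<theta> (W (J1 e))"
    by (rule jet1.tangent_space_transition[OF W jet1_atlasI[OF e(1)] jet1_atlasI[OF d(1)]])
      (use \<theta>e d(2) in \<open>auto simp: fst_J1\<close>)
  show "differential (jet1_atlas A) A base_point \<theta> W d = fst (W (J1 d))"
    using fun_cong[OF tr, of "W (J1 e)"] unfolding diff_eq Wd by (simp add: tvec_of_def d(1) pd)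
qed

end

section \<open>Connections in coordinates\<close>

definition christoffel_form ::
  "('p, real^'k::finite) chart set \<Rightarrow> ('p, real^'k) covariant_derivative \<Rightarrow> ('p, real^'k) chart \<Rightarrow>
   'p \<Rightarrow> real^'k \<Rightarrow> real^'k \<Rightarrow> real^'k" where
  "christoffel_form A D c p v w =
      (\<chi> s. \<Sum>a\<in>UNIV. v $ a * (\<Sum>b\<in>UNIV. w $ b * christoffel A D c a s b p))"

lemma bilinear_christoffel_form: "bilinear (christoffel_form A D c p)"
proof -
  have "linear (\<lambda>v. christoffel_form A D c p v w)" for w
    by (rule linearI) (simp_all add: christoffel_form_def vec_eq_iff distrib_right sum.distrib
        sum_distrib_left mult.assoc)
  moreover have "linear (\<lambda>w. christoffel_form A D c p v w)" for v
    by (rule linearI) (simp_all add: christoffel_form_def vec_eq_iff distrib_right distrib_left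
        sum.distrib
        sum_distrib_left mult.assoc mult.left_commute)
  ultimately show ?thesis by (simp add: bilinear_def)
qed

text \<open>Coordinates of the class of \<open>w\<close> in the quotient by the plane of slope \<open>u\<close>, represented by the
  vertical vectors.\<close>

definition normal_part :: "real^'n::finite^'m::finite \<Rightarrow> real^('n + 'm) \<Rightarrow> real^'m" where
  "normal_part u w = latin w - u *v greek w"

lemma linear_normal_part: "linear (normal_part u)"
  unfolding normal_part_def
  by (intro linear_compose_sub bounded_linear.linear[OF bounded_linear_latin]
      linear_compose[of greek "(*v) u", unfolded o_def] bounded_linear.linear[OF
          bounded_linear_greek]
      matrix_vector_mul_linear)

text \<open>The contribution of the connection to the second fundamental form of a submanifold of slope
  \<open>u\<close>, as a bilinear form on the base of the plane; its components are the terms with Christoffel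
  symbols in the equation of totally geodesic submanifolds.\<close>

definition normal_form ::
  "('p, 'n::finite, 'm::finite) echart set \<Rightarrow> ('p, real^('n + 'm)) covariant_derivative \<Rightarrow>
   ('p, 'n, 'm) echart \<Rightarrow> 'p \<Rightarrow> real^'n^'m \<Rightarrow> real^'n \<Rightarrow> real^'n \<Rightarrow> real^'m" where
  "normal_form A D c p u \<xi> \<eta> = normal_part u (christoffel_form A D c p (lift u \<xi>) (lift u \<eta>))"

lemma bilinear_normal_form: "bilinear (normal_form A D c p u)"
proof -
  note b = bilinear_christoffel_form[of A D c p, unfolded bilinear_def]
  have "linear (\<lambda>\<xi>. normal_form A D c p u \<xi> \<eta>)" for \<eta>
    unfolding normal_form_def
    using linear_compose[OF linear_compose[OF linear_lift b[THEN conjunct2, rule_format]]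
        linear_normal_part]
    by (simp add: o_def)
  moreover have "linear (\<lambda>\<eta>. normal_form A D c p u \<xi> \<eta>)" for \<xi>
    unfolding normal_form_def
    using linear_compose[OF linear_compose[OF linear_lift b[THEN conjunct1, rule_format]]
        linear_normal_part]
    by (simp add: o_def)
  ultimately show ?thesis by (simp add: bilinear_def)
qed

lemma sum_UNIV_Plus:
  fixes g :: "'n::finite + 'm::finite \<Rightarrow> 'a::comm_monoid_add"
  shows "(\<Sum>a\<in>UNIV. g a) = (\<Sum>l\<in>UNIV. g (Inl l)) + (\<Sum>i\<in>UNIV. g (Inr i))"
  using sum.Plus[of UNIV UNIV g] by (simp add: o_def)

lemma sum_lift_axis:
  fixes g :: "'n::finite + 'm::finite \<Rightarrow> real"
  shows "(\<Sum>b\<in>UNIV. lift u (axis \<xi> 1) $ b * g b) = g (Inl \<xi>) + (\<Sum>i\<in>UNIV. g (Inr i) * u $ i $ \<xi>)"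
proof -
  have "(\<Sum>l\<in>UNIV. axis \<xi> 1 $ l * g (Inl l)) = g (Inl \<xi>)"
    by (simp add: axis_def if_distrib[of "\<lambda>x. x * _"] cong: if_cong)
  then show ?thesis
    by (simp add: sum_UNIV_Plus lift_def matrix_vector_mult_basis column_def mult.commute)
qed

locale connection = jet_manifold T A
  for T :: "'p topology" and A :: "('p, real^('n::finite + 'm::finite)) chart set" +
  fixes D :: "('p, real^('n + 'm)) covariant_derivative"
  assumes linear_connection: "linear_connection T A D"
    and torsion_free: "torsion_free T A D"
begin

abbreviation vf :: "'p set \<Rightarrow> ('p \<Rightarrow> ('p, real^('n + 'm)) tvec) \<Rightarrow> bool" where
  "vf \<equiv> smooth_vector_field T A"

abbreviation coord :: "('p, 'n, 'm) echart \<Rightarrow> 'n + 'm \<Rightarrow> 'p \<Rightarrow> ('p, real^('n + 'm)) tvec" where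
  "coord \<equiv> coord_field A"

lemma D_smooth: "vf U X \<Longrightarrow> vf U Y \<Longrightarrow> vf U (\<lambda>p. D p (X p) Y)"
  using linear_connection unfolding linear_connection_def by blast

lemmas D_at = linear_connection[unfolded linear_connection_def, THEN conjunct2, THEN spec, THEN
    spec,
    THEN spec, THEN mp, OF conjI]

lemma D_tangent: "p \<in> U \<Longrightarrow> vf U Y \<Longrightarrow> v \<in> tangent_space A p \<Longrightarrow> D p v Y \<in> tangent_space A p"
  by (rule D_at[THEN conjunct1, THEN bspec])

lemma D_linear:
  "p \<in> U \<Longrightarrow> vf U Y \<Longrightarrow> v \<in> tangent_space A p \<Longrightarrow> w \<in> tangent_space A p \<Longrightarrow>
    D p (\<lambda>c. a *\<^sub>R v c + b *\<^sub>R w c) Y = (\<lambda>c. a *\<^sub>R D p v Y c + b *\<^sub>R D p w Y c)"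
  by (rule D_at[THEN conjunct2, THEN conjunct1, THEN bspec, THEN bspec, THEN spec, THEN spec])

lemma D_add:
  "p \<in> U \<Longrightarrow> vf U Y \<Longrightarrow> vf U Z \<Longrightarrow> v \<in> tangent_space A p \<Longrightarrow>
    D p v (\<lambda>q c. Y q c + Z q c) = (\<lambda>c. D p v Y c + D p v Z c)"
  by (rule D_at[THEN conjunct2, THEN conjunct2, THEN conjunct1, THEN spec, THEN bspec, THEN mp])

lemma D_Leibniz:
  "p \<in> U \<Longrightarrow> vf U Y \<Longrightarrow> v \<in> tangent_space A p \<Longrightarrow> smooth_map A {real_chart} U f \<Longrightarrow>
    D p v (\<lambda>q c. f q *\<^sub>R Y q c) = (\<lambda>c. apply_tvec A p v f *\<^sub>R Y p c + f p *\<^sub>R D p v Y c)"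
  by (rule D_at[THEN conjunct2, THEN conjunct2, THEN conjunct2, THEN conjunct1, THEN spec,
        THEN bspec, THEN mp])

lemma D_local:
  assumes "p \<in> U" "vf U Y" "vf U Z" "v \<in> tangent_space A p" "\<And>q. q \<in> U \<Longrightarrow> Y q = Z q"
  shows "D p v Y = D p v Z"
  by (rule D_at[OF assms(1,2), THEN conjunct2, THEN conjunct2, THEN conjunct2, THEN conjunct2,
        THEN spec, THEN bspec, THEN mp]) (use assms in auto)

lemma vf_openin: "vf U Y \<Longrightarrow> openin T U"
  and vf_tangent: "vf U Y \<Longrightarrow> p \<in> U \<Longrightarrow> Y p \<in> tangent_space A p"
  by (simp_all add: smooth_vector_field_def)

lemma vf_chart: "vf U Y \<Longrightarrow> c \<in> A \<Longrightarrow> smooth_on (snd c ` (U \<inter> fst c)) (\<lambda>x. Y (chart_inv c x) c)"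
  by (simp add: smooth_vector_field_def)

lemma vf_sum:
  assumes "openin T U" "\<And>i. i \<in> I \<Longrightarrow> vf U (Y i)"
  shows "vf U (\<lambda>q c. \<Sum>i\<in>I. Y i q c)"
  unfolding smooth_vector_field_def
proof (intro conjI ballI)
  show "openin T U" by fact
  show "(\<lambda>c. \<Sum>i\<in>I. Y i p c) \<in> tangent_space A p" if "p \<in> U" for p
    using vf_tangent[OF assms(2) that] by (rule tangent_space_sum)
  show "smooth_on (snd c ` (U \<inter> fst c)) (\<lambda>x. \<Sum>i\<in>I. Y i (chart_inv c x) c)" if "c \<in> A" for c
    by (intro smooth_on_sum vf_chart assms(2) that)
      (use open_image[OF that assms(1)] in \<open>simp add: Int_commute\<close>)
qed

lemma D_sum:
  assumes p: "p \<in> U" and U: "openin T U" and v: "v \<in> tangent_space A p"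
    and Y: "\<And>i. i \<in> I \<Longrightarrow> vf U (Y i)" and "finite I"
  shows "D p v (\<lambda>q c. \<Sum>i\<in>I. Y i q c) = (\<lambda>c. \<Sum>i\<in>I. D p v (Y i) c)"
  using \<open>finite I\<close> Y
proof (induction I rule: finite_induct)
  case empty
  have z: "vf U (\<lambda>q c. 0)" using vf_sum[OF U, of "{}"] by simp
  have "D p v (\<lambda>q c. 0 + 0) = (\<lambda>c. D p v (\<lambda>q c. 0) c + D p v (\<lambda>q c. 0) c)"
    by (rule D_add[OF p z z v])
  then show ?case by (simp add: fun_eq_iff)
next
  case (insert i I)
  have "D p v (\<lambda>q c. Y i q c + (\<Sum>i\<in>I. Y i q c)) =
      (\<lambda>c. D p v (Y i) c + D p v (\<lambda>q c. \<Sum>i\<in>I. Y i q c) c)"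
    by (rule D_add[OF p _ vf_sum[OF U] v]) (use insert in auto)
  then show ?case using insert by simp
qed

lemma D_linear_sum:
  assumes p: "p \<in> U" and Y: "vf U Y" and v: "\<And>i. i \<in> I \<Longrightarrow> v i \<in> tangent_space A p" and "finite I"
  shows "D p (\<lambda>c. \<Sum>i\<in>I. a i *\<^sub>R v i c) Y = (\<lambda>c. \<Sum>i\<in>I. a i *\<^sub>R D p (v i) Y c)"
  using \<open>finite I\<close> v
proof (induction I rule: finite_induct)
  case empty
  show ?case using D_linear[OF p Y tangent_space_zero tangent_space_zero, of 0 0] by simp
next
  case (insert i I)
  have "(\<lambda>c. \<Sum>i\<in>I. a i *\<^sub>R v i c) \<in> tangent_space A p"
    by (intro tangent_space_sum tangent_space_scale insert.prems) simp
  from D_linear[OF p Y insert.prems[of i] this, of "a i" 1] insert show ?case by simp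
qed

lemma coord_field_eq: "coord c a p = tvec_of A c p (axis a 1)"
  by (rule ext) (simp add: coord_field_def tvec_of_def transition_Der_def)

lemma coord_field_tangent: "c \<in> A \<Longrightarrow> p \<in> fst c \<Longrightarrow> coord c a p \<in> tangent_space A p"
  by (simp add: coord_field_eq tvec_of_in_tangent_space)

lemma coord_field_same: "c \<in> A \<Longrightarrow> p \<in> fst c \<Longrightarrow> coord c a p c = axis a 1"
  by (simp add: coord_field_eq tvec_of_same)

lemma coord_field_const:
  assumes "c \<in> A" "x \<in> snd c ` fst c"
  shows "coord c a (chart_inv c x) c = axis a 1"
  by (rule coord_field_same[OF assms(1) chart_inv_mem[OF assms(2)]])

lemma vf_coord_field: "c \<in> A \<Longrightarrow> vf (fst c) (coord c a)"
  by (rule smooth_vector_fieldI[OF _ openin_dom order_refl coord_field_tangent])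
    (auto intro!: smooth_on_cong[OF open_chart_image _ smooth_on_const] simp: coord_field_const)

lemma vector_in_coord_fields:
  assumes "v \<in> tangent_space A p" "c \<in> A" "p \<in> fst c"
  shows "v = (\<lambda>d. \<Sum>a\<in>UNIV. v c $ a *\<^sub>R coord c a p d)"
proof (rule tangent_vector_eqI[OF assms(1) _ assms(2,3)])
  show "(\<lambda>d. \<Sum>a\<in>UNIV. v c $ a *\<^sub>R coord c a p d) \<in> tangent_space A p"
    by (intro tangent_space_sum tangent_space_scale coord_field_tangent assms)
  show "v c = (\<Sum>a\<in>UNIV. v c $ a *\<^sub>R coord c a p c)"
    unfolding coord_field_same[OF assms(2,3)] by (rule linear_axis_sum[OF linear_ident])
qed

lemma smooth_on_christoffel:
  assumes "c \<in> A"
  shows "smooth_on (snd c ` fst c) (\<lambda>x. christoffel A D c a s b (chart_inv c x))"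
  unfolding christoffel_def
  using smooth_on_nth[OF open_chart_image[OF assms]]
    vf_chart[OF D_smooth[OF vf_coord_field[OF assms, of a] vf_coord_field[OF assms, of b]] assms]
  by simp

text \<open>Coordinate fields have constant components in their own chart, so their bracket vanishes
  there.\<close>

lemma christoffel_sym:
  assumes "c \<in> A" "p \<in> fst c"
  shows "christoffel A D c a s b p = christoffel A D c b s a p"
proof -
  have "(\<lambda>d. D p (coord c a p) (coord c b) d - D p (coord c b p) (coord c a) d) =
      lie_bracket A (coord c a) (coord c b) p"
    using torsion_free assms vf_coord_field unfolding torsion_free_def by blast
  from fun_cong[OF this, of c]
  have *: "D p (coord c a p) (coord c b) c - D p (coord c b p) (coord c a) c =
      lie_bracket A (coord c a) (coord c b) p c" .
  have "Der (\<lambda>x. coord c a (chart_inv c x) c) (snd c p) = (\<lambda>v. 0)" for a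
  proof (rule Der_eq)
    show "((\<lambda>x. coord c a (chart_inv c x) c) has_derivative (\<lambda>v. 0)) (at (snd c p))"
      by (rule has_derivative_transform_within_open[OF has_derivative_const open_chart_image[OF
          assms(1)]])
        (use assms coord_field_const[OF assms(1)] in auto)
  qed
  then have "lie_bracket A (coord c a) (coord c b) p c = 0" by (simp add: lie_bracket_def)
  then show ?thesis using * by (simp add: christoffel_def)
qed

lemma christoffel_form_sym:
  assumes "c \<in> A" "p \<in> fst c"
  shows "christoffel_form A D c p v w = christoffel_form A D c p w v"
proof -
  have "(\<Sum>a\<in>UNIV. v $ a * (\<Sum>b\<in>UNIV. w $ b * christoffel A D c a s b p)) =
      (\<Sum>b\<in>UNIV. \<Sum>a\<in>UNIV. v $ a * (w $ b * christoffel A D c a s b p))" for s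
    unfolding sum_distrib_left by (rule sum.swap)
  also have "\<dots> s = (\<Sum>b\<in>UNIV. w $ b * (\<Sum>a\<in>UNIV. v $ a * christoffel A D c b s a p))" for s
    by (simp add: sum_distrib_left mult.left_commute christoffel_sym[OF assms, of _ s])
  finally show ?thesis by (simp add: christoffel_form_def)
qed

text \<open>Expanding the field in coordinate fields, additivity and the Leibniz rule give the
  coordinate expression of the covariant derivative.\<close>

lemma D_coordinates:
  assumes c: "c \<in> A" "p \<in> fst c" and U: "p \<in> U" "vf U Y" and v: "v \<in> tangent_space A p"
  shows "D p v Y c =
      Der (\<lambda>x. Y (chart_inv c x) c) (snd c p) (v c) + christoffel_form A D c p (v c) (Y p c)"
proof -
  define V where "V = U \<inter> fst c"
  have V: "openin T V" "V \<subseteq> fst c" "V \<subseteq> U" "p \<in> V"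
    using vf_openin[OF U(2)] openin_dom[OF c(1)] U(1) c(2) by (auto simp: V_def)
  have Y: "vf V Y" by (rule smooth_vector_field_subset[OF U(2) V(1,3)])
  have E: "vf V (coord c b)" for b by (rule smooth_vector_field_subset[OF vf_coord_field[OF c(1)]
      V(1,2)])
  have oV: "open (snd c ` V)" using openin_iff_open_image[OF c(1) V(2)] V(1) by simp
  have sY: "smooth_on (snd c ` V) (\<lambda>x. Y (chart_inv c x) c)"
    using vf_chart[OF Y c(1)] V(2) by (simp add: Int_absorb2)
  let ?f = "\<lambda>b q. Y q c $ b"
  have sf: "smooth_on (snd c ` V) (\<lambda>x. ?f b (chart_inv c x))" for b
    by (rule smooth_on_nth[OF oV sY])
  have mf: "smooth_map A {real_chart} V (?f b)" for b
    by (rule smooth_map_realI[OF c(1) V(1,2) sf])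
  have fE: "vf V (\<lambda>q d. ?f b q *\<^sub>R coord c b q d)" for b
  proof (rule smooth_vector_fieldI[OF c(1) V(1,2)])
    show "(\<lambda>d. ?f b q *\<^sub>R coord c b q d) \<in> tangent_space A q" if "q \<in> V" for q
      using tangent_space_scale[OF vf_tangent[OF E that]] .
    have "smooth_on (snd c ` V) (\<lambda>x. coord c b (chart_inv c x) c)"
      using vf_chart[OF E c(1)] V(2) by (simp add: Int_absorb2)
    then show "smooth_on (snd c ` V) (\<lambda>x. ?f b (chart_inv c x) *\<^sub>R coord c b (chart_inv c x) c)"
      by (rule smooth_on_scaleR[OF oV sf])
  qed
  have pc: "snd c p \<in> snd c ` V" using V(4) by blast
  have dY: "((\<lambda>x. Y (chart_inv c x) c) has_derivative
      Der (\<lambda>x. Y (chart_inv c x) c) (snd c p)) (at (snd c p))"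
    by (rule smooth_on_has_derivative[OF sY pc])
  have app: "apply_tvec A p v (?f b) = Der (\<lambda>x. Y (chart_inv c x) c) (snd c p) (v c) $ b" for b
    unfolding apply_tvec_chart[OF v c smooth_on_differentiable[OF sf pc]]
    by (simp add: Der_eq[OF bounded_linear.has_derivative[OF bounded_linear_vec_nth dY]])
  have "D p v Y = D p v (\<lambda>q d. \<Sum>b\<in>UNIV. ?f b q *\<^sub>R coord c b q d)"
  proof (rule D_local[OF V(4) Y vf_sum[OF V(1) fE] v])
    show "Y q = (\<lambda>d. \<Sum>b\<in>UNIV. ?f b q *\<^sub>R coord c b q d)" if "q \<in> V" for q
      using vector_in_coord_fields[OF vf_tangent[OF Y that] c(1)] that V(2) by blast
  qed
  also have "\<dots> = (\<lambda>d. \<Sum>b\<in>UNIV. D p v (\<lambda>q d. ?f b q *\<^sub>R coord c b q d) d)"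
    by (rule D_sum[OF V(4,1) v fE]) simp
  also have "\<dots> =
      (\<lambda>d. \<Sum>b\<in>UNIV. apply_tvec A p v (?f b) *\<^sub>R coord c b p d + ?f b p *\<^sub>R D p v (coord c b) d)"
    by (simp only: D_Leibniz[OF V(4) E v mf])
  finally have 1: "D p v Y c =
      (\<Sum>b\<in>UNIV. Der (\<lambda>x. Y (chart_inv c x) c) (snd c p) (v c) $ b *\<^sub>R axis b 1)
      + (\<Sum>b\<in>UNIV. Y p c $ b *\<^sub>R D p v (coord c b) c)"
    by (simp add: app coord_field_same c sum.distrib)
  have 2: "(\<Sum>b\<in>UNIV. w $ b *\<^sub>R axis b 1) = w" for w :: "real^('n + 'm)"
    using linear_axis_sum[OF linear_ident, of w] by (rule sym)
  have "D p v (coord c b) c = (\<Sum>a\<in>UNIV. v c $ a *\<^sub>R D p (coord c a p) (coord c b) c)" for b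
  proof -
    have "D p v (coord c b) = D p (\<lambda>d. \<Sum>a\<in>UNIV. v c $ a *\<^sub>R coord c a p d) (coord c b)"
      using vector_in_coord_fields[OF v c] by simp
    also have "\<dots> = (\<lambda>d. \<Sum>a\<in>UNIV. v c $ a *\<^sub>R D p (coord c a p) (coord c b) d)"
      by (rule D_linear_sum[OF V(4) E coord_field_tangent[OF c]]) simp
    finally show ?thesis by simp
  qed
  then have "(\<Sum>b\<in>UNIV. Y p c $ b *\<^sub>R D p v (coord c b) c) $ s =
      christoffel_form A D c p (v c) (Y p c) $ s" for s
    by (simp add: christoffel_form_def christoffel_def sum_distrib_left mult.left_commute)
      (rule sum.swap)
  then show ?thesis unfolding 1 2 by (simp add: vec_eq_iff)
qed

end

section \<open>The second derivative of a graph\<close>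

definition hess :: "(real^'n::finite \<Rightarrow> real^'m::finite) \<Rightarrow> real^'n \<Rightarrow> real^'n \<Rightarrow> real^'n \<Rightarrow> real^'m"
    where
  "hess f y \<xi> \<eta> = Der (\<lambda>y. Der f y \<eta>) y \<xi>"

lemma hess_has_derivative:
  "smooth_on S f \<Longrightarrow> y \<in> S \<Longrightarrow> ((\<lambda>y. Der f y \<eta>) has_derivative (\<lambda>\<xi>. hess f y \<xi> \<eta>)) (at y)"
  unfolding hess_def by (rule smooth_on_has_derivative[OF smooth_on_Der])

lemma hess_sum:
  assumes "open S" "smooth_on S f" "y \<in> S"
  shows "hess f y \<xi> \<eta> = (\<Sum>l\<in>UNIV. \<eta> $ l *\<^sub>R hess f y \<xi> (axis l 1))"
proof -
  have "((\<lambda>y. \<Sum>l\<in>UNIV. \<eta> $ l *\<^sub>R Der f y (axis l 1)) has_derivative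
      (\<lambda>\<xi>. \<Sum>l\<in>UNIV. \<eta> $ l *\<^sub>R hess f y \<xi> (axis l 1))) (at y)"
    by (intro has_derivative_sum has_derivative_scaleR_right hess_has_derivative[OF assms(2,3)])
  then have "((\<lambda>y. Der f y \<eta>) has_derivative (\<lambda>\<xi>. \<Sum>l\<in>UNIV. \<eta> $ l *\<^sub>R hess f y \<xi> (axis l 1))) (at y)"
    by (rule has_derivative_transform_within_open[OF _ assms(1,3)])
      (simp add: linear_axis_sum[OF linear_Der[OF smooth_on_differentiable[OF assms(2)]],
          symmetric])
  with hess_has_derivative[OF assms(2,3)] have "(\<lambda>\<xi>. hess f y \<xi> \<eta>) =
      (\<lambda>\<xi>. \<Sum>l\<in>UNIV. \<eta> $ l *\<^sub>R hess f y \<xi> (axis l 1))"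
    by (rule has_derivative_unique)
  then show ?thesis by (rule fun_cong)
qed

lemma bilinear_hess:
  assumes "open S" "smooth_on S f" "y \<in> S"
  shows "bilinear (hess f y)"
proof -
  have "linear (\<lambda>\<xi>. hess f y \<xi> \<eta>)" for \<eta>
    by (rule has_derivative_linear[OF hess_has_derivative[OF assms(2,3)]])
  moreover have "linear (hess f y \<xi>)" for \<xi>
  proof -
    have "linear (\<lambda>\<eta>. \<Sum>l\<in>UNIV. \<eta> $ l *\<^sub>R hess f y \<xi> (axis l 1))"
      by (rule linearI) (simp_all add: scaleR_add_left sum.distrib scaleR_sum_right)
    then show ?thesis
      using hess_sum[OF assms, of \<xi>, symmetric] by simp
  qed
  ultimately show ?thesis by (simp add: bilinear_def)
qed

definition slope_Der :: "(real^'n::finite \<Rightarrow> real^'m::finite) \<Rightarrow> real^'n \<Rightarrow> real^'n \<Rightarrow> real^'n^'m" where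
  "slope_Der f y \<xi> = (\<chi> k l. hess f y \<xi> (axis l 1) $ k)"

lemma slope_has_derivative:
  assumes "smooth_on S f" "y \<in> S"
  shows "(slope f has_derivative slope_Der f y) (at y)"
  unfolding slope_def slope_Der_def
  by (intro has_derivative_vec bounded_linear.has_derivative[OF bounded_linear_vec_nth]
      hess_has_derivative[OF assms])

lemma smooth_on_slope: "open S \<Longrightarrow> smooth_on S f \<Longrightarrow> smooth_on S (slope f)"
  unfolding slope_def by (intro smooth_on_vec smooth_on_nth smooth_on_Der)

lemma partial_2_component:
  assumes "open S" "smooth_on S f" "y \<in> S"
  shows "partial [l, \<xi>] (\<lambda>x. f x $ i) y = hess f y (axis l 1) (axis \<xi> 1) $ i"
proof -
  have "((\<lambda>y. Der f y (axis \<xi> 1) $ i) has_derivative (\<lambda>v. hess f y v (axis \<xi> 1) $ i)) (at y)"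
    by (rule bounded_linear.has_derivative[OF bounded_linear_vec_nth hess_has_derivative[OF
        assms(2,3)]])
  then have "((\<lambda>y. Der (\<lambda>x. f x $ i) y (axis \<xi> 1)) has_derivative
      (\<lambda>v. hess f y v (axis \<xi> 1) $ i)) (at y)"
    by (rule has_derivative_transform_within_open[OF _ assms(1,3)])
      (simp add: Der_eq[OF bounded_linear.has_derivative[OF bounded_linear_vec_nth
            smooth_on_has_derivative[OF assms(2)]]])
  then show ?thesis by (simp add: Der_eq)
qed

lemma bilinear_eq_on_axes:
  fixes B C :: "real^'n::finite \<Rightarrow> real^'n \<Rightarrow> 'b::real_vector"
  assumes "bilinear B" "bilinear C" "\<And>l \<xi>. B (axis l 1) (axis \<xi> 1) = C (axis l 1) (axis \<xi> 1)"
  shows "B = C"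
proof (intro ext)
  fix v w
  have l: "linear (\<lambda>v. F v w)" "linear (F v)" if "bilinear F" for F :: "real^'n \<Rightarrow> real^'n \<Rightarrow> 'b"
      and v w
    using that by (auto simp: bilinear_def)
  have *: "F v w = (\<Sum>a\<in>UNIV. v $ a *\<^sub>R (\<Sum>b\<in>UNIV. w $ b *\<^sub>R F (axis a 1) (axis b 1)))"
      if "bilinear F"
    for F :: "real^'n \<Rightarrow> real^'n \<Rightarrow> 'b"
    unfolding linear_axis_sum[OF l(1)[OF that], of v w]
    by (subst linear_axis_sum[OF l(2)[OF that], of _ w]) (rule refl)
  show "B v w = C v w" unfolding *[OF assms(1)] *[OF assms(2)] assms(3) ..
qed

text \<open>A graph through the point and with the slope given by \<open>z\<close>; for symmetric \<open>B\<close> its second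
  derivative is \<open>- B\<close> everywhere.\<close>

definition quadratic_map ::
  "('n::finite, 'm::finite) coord1 \<Rightarrow> (real^'n \<Rightarrow> real^'n \<Rightarrow> real^'m) \<Rightarrow> real^'n \<Rightarrow> real^'m" where
  "quadratic_map z B y = affine_map z y - (1/2) *\<^sub>R B (y - greek (fst z)) (y - greek (fst z))"

lemma
  assumes B: "bilinear B" and sym: "\<And>v w. B v w = B w v"
  shows smooth_quadratic_map: "smooth_on UNIV (quadratic_map z B)"
    and slope_quadratic_map: "slope (quadratic_map z B) (greek (fst z)) = snd z"
    and hess_quadratic_map: "hess (quadratic_map z B) y \<xi> \<eta> = - B \<xi> \<eta>"
proof -
  let ?y = "greek (fst z)"
  interpret B: bounded_bilinear B using B by (simp add: bilinear_conv_bounded_bilinear)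
  have sd: "smooth_on UNIV (\<lambda>y. y - ?y)"
    by (intro smooth_on_diff smooth_on_ident smooth_on_const open_UNIV)
  have "smooth_on UNIV (\<lambda>y. B (y - ?y) (y - ?y))"
    using sd unfolding smooth_on_def
    by (auto intro!: Ck_on_bounded_bilinear[OF open_UNIV B.bounded_bilinear_axioms])
  then show "smooth_on UNIV (quadratic_map z B)"
    unfolding quadratic_map_def[abs_def]
    by (intro smooth_on_diff smooth_affine_map smooth_on_scaleR smooth_on_const open_UNIV)
  have dd: "((\<lambda>y. y - ?y) has_derivative (\<lambda>h. h)) (at x)" for x
    by (auto intro!: derivative_eq_intros)
  have "(quadratic_map z B has_derivative
      (\<lambda>h. snd z *v h - (1/2) *\<^sub>R (B (x - ?y) h + B h (x - ?y)))) (at x)" for x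
    unfolding quadratic_map_def[abs_def]
    by (intro has_derivative_diff affine_map_has_derivative has_derivative_scaleR_right B.FDERIV dd)
  then have D: "Der (quadratic_map z B) x =
      (\<lambda>h. snd z *v h - (1/2) *\<^sub>R (B (x - ?y) h + B h (x - ?y)))" for x
    by (rule Der_eq)
  have D': "Der (quadratic_map z B) x h = snd z *v h - B (x - ?y) h" for x h
    by (simp add: D sym[of h] scaleR_2[symmetric])
  show "slope (quadratic_map z B) ?y = snd z"
    by (simp add: slope_def D' B.zero_left vec_eq_iff matrix_vector_mult_basis column_def)
  have "((\<lambda>y. snd z *v \<eta> - B (y - ?y) \<eta>) has_derivative (\<lambda>h. 0 - B h \<eta>)) (at y)"
    by (intro has_derivative_diff has_derivative_const bounded_linear.has_derivative[OF
        B.bounded_linear_left] dd)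
  then show "hess (quadratic_map z B) y \<xi> \<eta> = - B \<xi> \<eta>"
    unfolding hess_def D' by (simp add: Der_eq)
qed

section \<open>Totally geodesic jets in coordinates\<close>

context jet_manifold
begin

lemma local_graph_nbhdE:
  assumes "local_graph A c f L p"
  obtains W where "open W" "snd c p \<in> W" "W \<subseteq> snd c ` fst c"
    "open (greek ` W)" "smooth_on (greek ` W) f" "greek (snd c p) \<in> greek ` W"
    "\<And>x. x \<in> W \<Longrightarrow> latin x = f (greek x) \<Longrightarrow> chart_inv c x \<in> L \<and> local_graph A c f L (chart_inv c x)"
    "\<And>q. q \<in> fst c \<Longrightarrow> snd c q \<in> W \<Longrightarrow> q \<in> L \<Longrightarrow> local_graph A c f L q"
proof -
  obtain W where W: "c \<in> A" "p \<in> fst c" "p \<in> L" "open W" "snd c p \<in> W" "W \<subseteq> snd c ` fst c"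
    "open (greek ` W)" "smooth_on (greek ` W) f"
    "\<And>x. x \<in> W \<Longrightarrow> chart_inv c x \<in> L \<longleftrightarrow> latin x = f (greek x)"
    using assms by (rule local_graphE) blast
  have near: "local_graph A c f L q" if "q \<in> fst c" "snd c q \<in> W" "q \<in> L" for q
    unfolding local_graph_def using that W by blast
  have "chart_inv c x \<in> L \<and> local_graph A c f L (chart_inv c x)" if "x \<in> W" "latin x = f (greek x)"
      for x
  proof -
    have x: "x \<in> snd c ` fst c" using that(1) W(6) by blast
    have "chart_inv c x \<in> L" using W(9) that by blast
    then show ?thesis using near chart_inv_mem[OF x] chart_chart_inv[OF x] that(1) by simp
  qed
  then show thesis using that[OF W(4,5,6,7,8)] near W(5) by blast
qed

lemma tangent_to_iff_normal_part:
  assumes "local_graph A c f L p"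
  shows "v \<in> tangent_to A L p \<longleftrightarrow>
    v \<in> tangent_space A p \<and> normal_part (slope f (greek (snd c p))) (v c) = 0"
  unfolding tangent_to_graph[OF assms] by (simp add: normal_part_def)

lemma tangent_eq_lift:
  assumes "local_graph A c f L p" "v \<in> tangent_to A L p"
  shows "lift (slope f (greek (snd c p))) (greek (v c)) = v c"
  using assms(2) unfolding tangent_to_graph[OF assms(1)] by (auto intro: lift_greek)

end

context connection
begin

text \<open>Differentiating the tangency condition along a curve of \<open>L\<close> expresses the derivative of the
  components of \<open>Z\<close>, modulo \<open>T\<^sub>pL\<close>, by the second derivative of the graph. Hence only the value of
  \<open>Z\<close> at \<open>p\<close> enters.\<close>

lemma normal_part_D:
  assumes lg: "local_graph A c f L p" and U: "p \<in> U" "vf U Z"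
    and tan: "\<And>q. q \<in> U \<inter> L \<Longrightarrow> Z q \<in> tangent_to A L q" and X: "X \<in> tangent_to A L p"
  shows "normal_part (slope f (greek (snd c p))) (D p X Z c) =
    hess f (greek (snd c p)) (greek (X c)) (greek (Z p c)) +
    normal_form A D c p (slope f (greek (snd c p))) (greek (X c)) (greek (Z p c))"
proof -
  have c: "c \<in> A" "p \<in> fst c" using lg local_graph_dom by blast+
  have pL: "p \<in> L" using lg by (simp add: local_graph_def)
  obtain W where W: "open W" "snd c p \<in> W" "W \<subseteq> snd c ` fst c"
    "open (greek ` W)" "smooth_on (greek ` W) f" "greek (snd c p) \<in> greek ` W"
    "\<And>x. x \<in> W \<Longrightarrow> latin x = f (greek x) \<Longrightarrow> chart_inv c x \<in> L \<and> local_graph A c f L (chart_inv c x)"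
    using lg by (rule local_graph_nbhdE) blast
  define y where "y = greek (snd c p)"
  define u where "u = slope f y"
  define \<xi> where "\<xi> = greek (X c)"
  define z where "z = (\<lambda>x. Z (chart_inv c x) c)"
  let ?R = "snd c ` (U \<inter> fst c)"
  have oR: "open ?R" using open_image[OF c(1) vf_openin[OF U(2)]] by (simp add: Int_commute)
  have pR: "snd c p \<in> ?R" using U(1) c(2) by blast
  have sz: "smooth_on ?R z" unfolding z_def by (rule vf_chart[OF U(2) c(1)])
  have Xc: "lift u \<xi> = X c"
    unfolding u_def y_def \<xi>_def by (rule tangent_eq_lift[OF lg X])
  have Zp: "lift u (greek (Z p c)) = Z p c"
    unfolding u_def y_def by (rule tangent_eq_lift[OF lg tan]) (use U(1) pL in blast)
  have zp: "z (snd c p) = Z p c" by (simp add: z_def chart_inv_chart[OF c])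
  let ?V = "W \<inter> ?R"
  have V: "open ?V" "snd c p \<in> ?V" using W(1,2) oR pR by auto
  have sV: "smooth_on (greek ` ?V) f" by (rule smooth_on_subset[OF W(5)]) blast
  let ?l = "\<lambda>t. y + t *\<^sub>R \<xi>" and ?X = "\<lambda>t. join (y + t *\<^sub>R \<xi>) (f (y + t *\<^sub>R \<xi>))"
  obtain \<epsilon> where e: "\<epsilon> > 0" "\<And>t. \<bar>t\<bar> < \<epsilon> \<Longrightarrow> ?X t \<in> ?V"
    and dX: "(?X has_vector_derivative lift u \<xi>) (at 0)"
    by (rule graph_curve[OF V sV local_graph_value[OF lg, symmetric], of \<xi>, folded y_def, folded
        u_def]) blast
  have X0: "?X 0 = snd c p"
    using local_graph_value[OF lg] by (simp add: y_def)
  define w where "w = Der z (snd c p) (X c)"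
  define h where "h = (\<lambda>t. z (?X t))"
  have dz: "(z has_derivative Der z (snd c p)) (at (?X 0))"
    unfolding X0 by (rule smooth_on_has_derivative[OF sz pR])
  have "(h has_derivative (\<lambda>t. Der z (snd c p) (t *\<^sub>R X c))) (at 0)"
    using diff_chain_at[OF dX[unfolded has_vector_derivative_def] dz] by (simp add: o_def h_def Xc)
  then have dh: "(h has_vector_derivative w) (at 0)"
    unfolding has_vector_derivative_def w_def
    using linear_cmul[OF has_derivative_linear[OF dz]] by simp
  have h0: "h 0 = Z p c" unfolding h_def X0 zp ..
  \<comment> \<open>\<open>h\<close> is the field along a curve of \<open>L\<close>; its tangency is an identity in \<open>t\<close>, to be differentiated
    at \<open>0\<close>.\<close>
  have latin_h: "latin (h t) = (\<Sum>l\<in>UNIV. greek (h t) $ l *\<^sub>R Der f (?l t) (axis l 1))" if "\<bar>t\<bar> < \<epsilon>"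
      for t
  proof -
    define q where "q = chart_inv c (?X t)"
    have xV: "?X t \<in> W" "?X t \<in> ?R" using e(2)[OF that] by blast+
    have q: "snd c q = ?X t" "q \<in> U"
      using xV(2) chart_inv_chart[OF c(1)] by (auto simp: q_def)
    have lq: "q \<in> L" "local_graph A c f L q" using W(7)[OF xV(1)] by (simp_all add: q_def)
    have df: "f differentiable (at (?l t))" using local_graph_differentiable[OF lq(2)] q(1) by simp
    have "Z q \<in> tangent_to A L q" using tan q(2) lq(1) by blast
    then have "latin (Z q c) = slope f (greek (snd c q)) *v greek (Z q c)"
      unfolding tangent_to_graph[OF lq(2)] by simp
    then have "latin (h t) = Der f (?l t) (greek (h t))"
      by (simp add: q(1) slope_mult[OF df] h_def z_def q_def[symmetric])
    then show ?thesis using linear_axis_sum[OF linear_Der[OF df], of "greek (h t)"] by simp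
  qed
  have dl: "(?l has_vector_derivative \<xi>) (at 0)"
    by (auto intro!: derivative_eq_intros simp: has_vector_derivative_def)
  have dDer: "((\<lambda>t. Der f (?l t) (axis l 1)) has_vector_derivative hess f y \<xi> (axis l 1)) (at 0)"
      for l
  proof -
    have hd: "((\<lambda>y. Der f y (axis l 1)) has_derivative (\<lambda>\<xi>. hess f y \<xi> (axis l 1))) (at (?l 0))"
      using hess_has_derivative[OF W(5,6)] by (simp add: y_def)
    from diff_chain_at[OF dl[unfolded has_vector_derivative_def] this]
    show ?thesis
      using linear_cmul[OF has_derivative_linear[OF hd]]
          by (simp add: o_def has_vector_derivative_def)
  qed
  have dg: "((\<lambda>t. greek (h t) $ l) has_real_derivative greek w $ l) (at 0)" for l
    unfolding has_real_derivative_iff_has_vector_derivative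
    by (intro bounded_linear.has_vector_derivative[OF bounded_linear_vec_nth]
        bounded_linear.has_vector_derivative[OF bounded_linear_greek] dh)
  have "((\<lambda>t. \<Sum>l\<in>UNIV. greek (h t) $ l *\<^sub>R Der f (?l t) (axis l 1)) has_vector_derivative
      (\<Sum>l\<in>UNIV. greek (h 0) $ l *\<^sub>R hess f y \<xi> (axis l 1) + greek w $ l *\<^sub>R Der f (?l 0) (axis l
          1))) (at 0)"
    by (intro has_vector_derivative_sum has_vector_derivative_scaleR dg dDer)
  then have "((\<lambda>t. latin (h t)) has_vector_derivative
      (\<Sum>l\<in>UNIV. greek (h 0) $ l *\<^sub>R hess f y \<xi> (axis l 1) + greek w $ l *\<^sub>R Der f (?l 0) (axis l
          1))) (at 0)"
    by (rule has_vector_derivative_transform_within_open[of _ _ _ "{-\<epsilon><..<\<epsilon>}"])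
      (use e(1) latin_h in auto)
  from vector_derivative_unique_at[OF bounded_linear.has_vector_derivative[OF bounded_linear_latin
      dh] this]
  have "latin w = (\<Sum>l\<in>UNIV. greek (h 0) $ l *\<^sub>R hess f y \<xi> (axis l 1)) +
      (\<Sum>l\<in>UNIV. greek w $ l *\<^sub>R Der f (?l 0) (axis l 1))"
    by (simp only: sum.distrib)
  also have "(\<Sum>l\<in>UNIV. greek (h 0) $ l *\<^sub>R hess f y \<xi> (axis l 1)) = hess f y \<xi> (greek (h 0))"
    using hess_sum[OF W(4,5,6), of \<xi> "greek (h 0)"] by (simp add: y_def)
  also have "(\<Sum>l\<in>UNIV. greek w $ l *\<^sub>R Der f (?l 0) (axis l 1)) = u *v greek w"
    using linear_axis_sum[OF linear_Der[OF local_graph_differentiable[OF lg]], of "greek w"]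
      slope_mult[OF local_graph_differentiable[OF lg], of "greek w"] by (simp add: y_def u_def)
  finally have "normal_part u w = hess f y \<xi> (greek (Z p c))" by (simp add: normal_part_def h0)
  moreover have "D p X Z c = w + christoffel_form A D c p (lift u \<xi>) (lift u (greek (Z p c)))"
    unfolding D_coordinates[OF c U tangent_to_subset[OF X]] w_def z_def Xc Zp ..
  ultimately show ?thesis
    unfolding y_def[symmetric] u_def[symmetric] \<xi>_def[symmetric]
    by (simp add: normal_form_def linear_add[OF linear_normal_part])
qed

text \<open>The extension has constant projection to the base of the graph.\<close>

lemma tangent_extension:
  assumes lg: "local_graph A c f L p" and Y: "Y \<in> tangent_to A L p"
  obtains U Z where "p \<in> U" "vf U Z" "\<And>q. q \<in> U \<inter> L \<Longrightarrow> Z q \<in> tangent_to A L q" "Z p = Y"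
proof -
  have c: "c \<in> A" "p \<in> fst c" using lg local_graph_dom by blast+
  obtain W where W: "open W" "snd c p \<in> W" "W \<subseteq> snd c ` fst c"
    "open (greek ` W)" "smooth_on (greek ` W) f"
    "\<And>q. q \<in> fst c \<Longrightarrow> snd c q \<in> W \<Longrightarrow> q \<in> L \<Longrightarrow> local_graph A c f L q"
    using lg by (rule local_graph_nbhdE) blast
  define U where "U = chart_inv c ` W"
  define \<eta> where "\<eta> = greek (Y c)"
  define Z where "Z = (\<lambda>q. tvec_of A c q (lift (slope f (greek (snd c q))) \<eta>))"
  have U: "openin T U" unfolding U_def by (rule openin_chart_inv_image[OF c(1) W(1,3)])
  have inU: "q \<in> fst c \<and> snd c q \<in> W" if qU: "q \<in> U" for q
  proof -
    obtain x where x: "x \<in> W" "q = chart_inv c x" using qU U_def by blast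
    then have "x \<in> snd c ` fst c" using W(3) by blast
    then show ?thesis using x chart_inv_mem chart_chart_inv by metis
  qed
  have imU: "snd c ` U = W"
  proof -
    have "snd c (chart_inv c x) = x" if "x \<in> W" for x
      using chart_chart_inv[of x c] W(3) that by blast
    then show ?thesis by (simp add: U_def image_image)
  qed
  have "vf U Z"
  proof (rule smooth_vector_fieldI[OF c(1) U])
    show "U \<subseteq> fst c" using inU by blast
    show "Z q \<in> tangent_space A q" if "q \<in> U" for q
      unfolding Z_def using tvec_of_in_tangent_space[OF c(1)] inU[OF that] by blast
    have "smooth_on W (\<lambda>x. Der f (greek x) \<eta>)"
      by (rule smooth_on_compose[OF W(1,4) order_refl
            smooth_on_greek[OF W(1) smooth_on_ident[OF W(1)]] smooth_on_Der[OF W(5)]])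
    then have "smooth_on W (\<lambda>x. join \<eta> (Der f (greek x) \<eta>))"
      by (intro smooth_on_join W(1) smooth_on_const)
    then show "smooth_on (snd c ` U) (\<lambda>x. Z (chart_inv c x) c)"
      unfolding imU
    proof (rule smooth_on_cong[OF W(1), rotated])
      fix x assume x: "x \<in> W"
      then have x': "x \<in> snd c ` fst c" using W(3) by blast
      have "f differentiable (at (greek x))" using smooth_on_differentiable[OF W(5)] x by blast
      then show "join \<eta> (Der f (greek x) \<eta>) = Z (chart_inv c x) c"
        by (simp add: Z_def tvec_of_same[OF c(1) chart_inv_mem[OF x']] chart_chart_inv[OF x']
            lift_def slope_mult)
    qed
  qed
  moreover have "p \<in> U" unfolding U_def using W(2) chart_inv_chart[OF c] by (metis imageI)
  moreover have "Z q \<in> tangent_to A L q" if "q \<in> U \<inter> L" for q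
    unfolding Z_def using that inU W(6) by (intro tvec_of_lift_tangent) blast
  moreover have "Z p = Y"
    unfolding Z_def \<eta>_def tangent_eq_lift[OF lg Y]
        by (rule tvec_of_eq[OF tangent_to_subset[OF Y] c])
  ultimately show thesis using that by blast
qed

definition geodesic_at :: "'p set \<Rightarrow> 'p \<Rightarrow> bool" where
  "geodesic_at L p \<longleftrightarrow> (\<forall>X\<in>tangent_to A L p. \<forall>Y\<in>tangent_to A L p.
     second_fundamental_form T A D L p X Y = tangent_to A L p)"

text \<open>As \<open>c\<close> is any chart in which \<open>L\<close> is a graph, the local equation holds in one such chart iff it
  holds in all of them; this replaces the transformation laws of Christoffel symbols and of second
  derivatives.\<close>

lemma geodesic_at_iff:
  assumes lg: "local_graph A c f L p"
  shows "geodesic_at L p \<longleftrightarrow> (\<forall>\<xi> \<eta>. hess f (greek (snd c p)) \<xi> \<eta> =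
    - normal_form A D c p (slope f (greek (snd c p))) \<xi> \<eta>)"
proof
  let ?y = "greek (snd c p)"
  let ?u = "slope f ?y"
  have c: "c \<in> A" "p \<in> fst c" using lg local_graph_dom by blast+
  note nadd = linear_add[OF linear_normal_part[of ?u]] linear_diff[OF linear_normal_part[of ?u]]
    linear_0[OF linear_normal_part[of ?u]]
  note tan_iff = tangent_to_iff_normal_part[OF lg]
  {
    assume geo: "geodesic_at L p"
    show "\<forall>\<xi> \<eta>. hess f ?y \<xi> \<eta> = - normal_form A D c p ?u \<xi> \<eta>"
    proof (intro allI)
      fix \<xi> \<eta>
      let ?X = "tvec_of A c p (lift ?u \<xi>)" and ?Y = "tvec_of A c p (lift ?u \<eta>)"
      have XY: "?X \<in> tangent_to A L p" "?Y \<in> tangent_to A L p"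
        by (rule tvec_of_lift_tangent[OF lg])+
      \<comment> \<open>That the form contains \<open>0\<close> provides an extension of \<open>?Y\<close> with tangent covariant derivative.\<close>
      have "(\<lambda>c. 0) \<in> tangent_to A L p" unfolding tan_iff using tangent_space_zero nadd(3) by simp
      then have "(\<lambda>c. 0) \<in> second_fundamental_form T A D L p ?X ?Y"
        using geo XY unfolding geodesic_at_def by blast
      then obtain U Z where Z: "p \<in> U" "vf U Z" "\<forall>q\<in>U \<inter> L. Z q \<in> tangent_to A L q" "Z p = ?Y"
        and DZ: "(\<lambda>c. 0 - D p ?X Z c) \<in> tangent_to A L p"
        unfolding second_fundamental_form_def by blast
      have "normal_part ?u (D p ?X Z c) = 0"
        using DZ unfolding tan_iff nadd(2,3) by simp
      then show "hess f ?y \<xi> \<eta> = - normal_form A D c p ?u \<xi> \<eta>"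
        using normal_part_D[OF lg Z(1,2) _ XY(1)] Z(3,4)
        by (simp add: tvec_of_same[OF c] eq_neg_iff_add_eq_0)
    qed
  next
    assume eq: "\<forall>\<xi> \<eta>. hess f ?y \<xi> \<eta> = - normal_form A D c p ?u \<xi> \<eta>"
    have DZ: "D p X Z \<in> tangent_to A L p"
      if "p \<in> U" "vf U Z" "\<forall>q\<in>U \<inter> L. Z q \<in> tangent_to A L q" "X \<in> tangent_to A L p" for U Z X
      unfolding tan_iff
      using normal_part_D[OF lg that(1,2) _ that(4)] that(3) eq
        D_tangent[OF that(1,2) tangent_to_subset[OF that(4)]] by simp
    show "geodesic_at L p"
      unfolding geodesic_at_def
    proof (intro ballI equalityI subsetI)
      fix X Y w assume X: "X \<in> tangent_to A L p" and Y: "Y \<in> tangent_to A L p"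
        and "w \<in> second_fundamental_form T A D L p X Y"
      then obtain U Z where w: "w \<in> tangent_space A p"
        and Z: "p \<in> U" "vf U Z" "\<forall>q\<in>U \<inter> L. Z q \<in> tangent_to A L q" "Z p = Y"
        and wD: "(\<lambda>c. w c - D p X Z c) \<in> tangent_to A L p"
        unfolding second_fundamental_form_def by blast
      show "w \<in> tangent_to A L p"
        using wD DZ[OF Z(1-3) X] w unfolding tan_iff nadd(2) by simp
    next
      fix X Y w assume X: "X \<in> tangent_to A L p" and Y: "Y \<in> tangent_to A L p"
        and w: "w \<in> tangent_to A L p"
      obtain U Z where Z: "p \<in> U" "vf U Z" "\<And>q. q \<in> U \<inter> L \<Longrightarrow> Z q \<in> tangent_to A L q" "Z p = Y"
        using tangent_extension[OF lg Y] by blast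
      have D: "D p X Z \<in> tangent_to A L p" using DZ[OF Z(1,2) _ X] Z(3) by blast
      have "(\<lambda>c. w c - D p X Z c) \<in> tangent_to A L p"
        using w D tangent_space_diff unfolding tan_iff nadd(2) by simp
      then show "w \<in> second_fundamental_form T A D L p X Y"
        unfolding second_fundamental_form_def using Z tangent_to_subset[OF w] by blast
    qed
  }
qed

section \<open>Horizontal lifts and prolongations\<close>

text \<open>The vertical projection of a vector over \<open>lift u v\<close> adds to its vertical part the same expression
  that the second fundamental form adds to the second derivative.\<close>

lemma dot_coeff_sum:
  "(\<Sum>a\<in>UNIV. dot_coeff A D c a k l \<theta> * lift (snd (snd (J1 c) \<theta>)) v $ a) =
    normal_form A D c (base_point \<theta>) (snd (snd (J1 c) \<theta>)) v (axis l 1) $ k"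
proof -
  let ?u = "snd (snd (J1 c) \<theta>)" and ?p = "base_point \<theta>"
  have u: "jet_coord A c i [l] \<theta> = ?u $ i $ l" for i l by (simp add: jet1_chart_def)
  define g where "g = (\<lambda>a s. \<Sum>b\<in>UNIV. lift ?u (axis l 1) $ b * christoffel A D c a s b ?p)"
  have dc: "dot_coeff A D c a k l \<theta> = g a (Inr k) - (\<Sum>\<beta>\<in>UNIV. ?u $ k $ \<beta> * g a (Inl \<beta>))" for a
    unfolding g_def sum_lift_axis by (simp add: dot_coeff_def Let_def u)
  have "(\<Sum>a\<in>UNIV. dot_coeff A D c a k l \<theta> * lift ?u v $ a) =
      (\<Sum>a\<in>UNIV. lift ?u v $ a * g a (Inr k)) -
      (\<Sum>a\<in>UNIV. \<Sum>\<beta>\<in>UNIV. ?u $ k $ \<beta> * (lift ?u v $ a * g a (Inl \<beta>)))"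
    unfolding dc by (simp add: algebra_simps sum_subtractf sum_distrib_left)
  also have "(\<Sum>a\<in>UNIV. \<Sum>\<beta>\<in>UNIV. ?u $ k $ \<beta> * (lift ?u v $ a * g a (Inl \<beta>))) =
      (\<Sum>\<beta>\<in>UNIV. ?u $ k $ \<beta> * (\<Sum>a\<in>UNIV. lift ?u v $ a * g a (Inl \<beta>)))"
    unfolding sum_distrib_left by (rule sum.swap)
  finally show ?thesis
    by (simp add: normal_form_def normal_part_def christoffel_form_def matrix_vector_mult_def g_def)
qed

end

context jet_manifold
begin

text \<open>Along a curve in the prolongation the coordinates of the base point lie on the graph and the
  slopes are those of the graph there; both relations are differentiated at \<open>0\<close>.\<close>

lemma tangent_to_prolongation:
  assumes L: "submanifold A L" "p \<in> L" and lg: "local_graph A c f L p"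
    and W: "W \<in> tangent_to (jet1_atlas A) (prolongation A 1 L) (jet A 1 L p)"
  obtains \<xi> where "W (J1 c) =
    (lift (slope f (greek (snd c p))) \<xi>, slope_Der f (greek (snd c p)) \<xi>)"
proof -
  have c: "c \<in> A" "p \<in> fst c" using lg local_graph_dom by blast+
  have dom: "jet A 1 L p \<in> jet_dom A 1 c" using jet_dom_1_iff[OF L] lg by blast
  let ?y = "greek (snd c p)"
  obtain V where V: "open V" "snd c p \<in> V" "smooth_on (greek ` V) f" "?y \<in> greek ` V"
    "\<And>q. q \<in> fst c \<Longrightarrow> snd c q \<in> V \<Longrightarrow> q \<in> L \<Longrightarrow> local_graph A c f L q"
    using lg by (rule local_graph_nbhdE) blast
  obtain \<gamma> where g: "\<gamma> 0 = jet A 1 L p" "\<forall>\<^sub>F t in nhds 0. \<gamma> t \<in> prolongation A 1 L"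
    and gd: "\<And>d. d \<in> jet1_atlas A \<Longrightarrow> jet A 1 L p \<in> fst d \<Longrightarrow> \<forall>\<^sub>F t in nhds 0. \<gamma> t \<in> fst d"
     "\<And>d. d \<in> jet1_atlas A \<Longrightarrow> jet A 1 L p \<in> fst d \<Longrightarrow>
        ((\<lambda>t. snd d (\<gamma> t)) has_vector_derivative W d) (at 0)"
    using W by (rule jet1.tangent_toE) blast
  have gc: "\<forall>\<^sub>F t in nhds 0. \<gamma> t \<in> jet_dom A 1 c"
    "((\<lambda>t. snd (J1 c) (\<gamma> t)) has_vector_derivative W (J1 c)) (at 0)"
    using gd[OF jet1_atlasI[OF c(1)]] dom by (simp_all add: fst_J1)
  let ?x = "\<lambda>t. fst (snd (J1 c) (\<gamma> t))" and ?w = "fst (W (J1 c))"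
  have dx: "(?x has_vector_derivative ?w) (at 0)"
    by (rule bounded_linear.has_vector_derivative[OF bounded_linear_fst gc(2)])
  have du: "((\<lambda>t. snd (snd (J1 c) (\<gamma> t))) has_vector_derivative snd (W (J1 c))) (at 0)"
    by (rule bounded_linear.has_vector_derivative[OF bounded_linear_snd gc(2)])
  have x0: "?x 0 = snd c p" using J1_coords[OF L lg] g(1) by simp
  have "(?x \<longlongrightarrow> snd c p) (nhds 0)"
    using has_vector_derivative_continuous[OF dx] x0
    by (simp add: continuous_within isCont_def tendsto_nhds_iff)
  then have "\<forall>\<^sub>F t in nhds 0. ?x t \<in> V" using V(1,2) by (rule topological_tendstoD)
  with g(2) gc(1) have ev: "\<forall>\<^sub>F t in nhds 0. latin (?x t) = f (greek (?x t)) \<and>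
      snd (snd (J1 c) (\<gamma> t)) = slope f (greek (?x t))"
  proof eventually_elim
    case (elim t)
    then obtain q where q: "q \<in> L" "\<gamma> t = jet A 1 L q" by (auto simp: prolongation_def)
    have bq: "base_point (\<gamma> t) = q" using base_point_jet[OF L(1) q(1)] q(2) by simp
    then have "q \<in> fst c" "snd c q = ?x t"
      using base_point_dom[OF elim(2)] by (simp_all add: fst_J1_coords)
    then have lq: "local_graph A c f L q" using V(5) elim(3) q(1) by simp
    from J1_coords[OF L(1) q(1) lq] local_graph_value[OF lq] show ?case by (simp add: q(2))
  qed
  have dgx: "((\<lambda>t. greek (?x t)) has_derivative (\<lambda>t. t *\<^sub>R greek ?w)) (at 0)"
    using bounded_linear.has_vector_derivative[OF bounded_linear_greek dx]
    by (simp add: has_vector_derivative_def)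
  have df: "f differentiable (at ?y)" by (rule local_graph_differentiable[OF lg])
  have d0: "(f has_derivative Der f ?y) (at (greek (?x 0)))"
    unfolding x0 by (rule has_derivative_Der[OF df])
  have d1: "(slope f has_derivative slope_Der f ?y) (at (greek (?x 0)))"
    unfolding x0 by (rule slope_has_derivative[OF V(3,4)])
  have chain: "((\<lambda>t. F (greek (?x t))) has_vector_derivative F' (greek ?w)) (at 0)"
    if "(F has_derivative F') (at (greek (?x 0)))"
    for F :: "real^'n \<Rightarrow> 'z::real_normed_vector" and F'
    using diff_chain_at[OF dgx that] linear_cmul[OF has_derivative_linear[OF that]]
    by (simp add: has_vector_derivative_def o_def)
  obtain S where S: "open S" "0 \<in> S" and evS: "\<And>t. t \<in> S \<Longrightarrow> latin (?x t) = f (greek (?x t)) \<and>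
      snd (snd (J1 c) (\<gamma> t)) = slope f (greek (?x t))"
    using ev unfolding eventually_nhds by blast
  have "((\<lambda>t. latin (?x t)) has_vector_derivative Der f ?y (greek ?w)) (at 0)"
    by (rule has_vector_derivative_transform_within_open[OF chain[OF d0] S]) (simp add: evS)
  moreover have "((\<lambda>t. latin (?x t)) has_vector_derivative latin ?w) (at 0)"
    by (rule bounded_linear.has_vector_derivative[OF bounded_linear_latin dx])
  ultimately have "Der f ?y (greek ?w) = latin ?w" by (rule vector_derivative_unique_at)
  then have "lift (slope f ?y) (greek ?w) = ?w"
    by (intro lift_greek) (simp add: slope_mult[OF df])
  moreover have "((\<lambda>t. snd (snd (J1 c) (\<gamma> t))) has_vector_derivative
      slope_Der f ?y (greek ?w)) (at 0)"
    by (rule has_vector_derivative_transform_within_open[OF chain[OF d1] S]) (simp add: evS)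
  then have "slope_Der f ?y (greek ?w) = snd (W (J1 c))"
    using du by (rule vector_derivative_unique_at)
  ultimately show thesis using that[of "greek ?w"] by simp
qed

lemma prolongation_tangent_exists:
  assumes L: "submanifold A L" "p \<in> L" and lg: "local_graph A c f L p"
    and W: "W \<in> tangent_space (jet1_atlas A) (jet A 1 L p)"
    and Wc: "W (J1 c) = (lift (slope f (greek (snd c p))) \<xi>, slope_Der f (greek (snd c p)) \<xi>)"
  shows "W \<in> tangent_to (jet1_atlas A) (prolongation A 1 L) (jet A 1 L p)"
proof -
  have c: "c \<in> A" "p \<in> fst c" using lg local_graph_dom by blast+
  let ?y = "greek (snd c p)"
  obtain V where V: "open V" "snd c p \<in> V" "V \<subseteq> snd c ` fst c" "open (greek ` V)"
    "smooth_on (greek ` V) f" "?y \<in> greek ` V"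
    "\<And>x. x \<in> V \<Longrightarrow> latin x = f (greek x) \<Longrightarrow> chart_inv c x \<in> L \<and> local_graph A c f L (chart_inv c x)"
    using lg by (rule local_graph_nbhdE) blast
  let ?l = "\<lambda>t. ?y + t *\<^sub>R \<xi>" and ?X = "\<lambda>t. join (?y + t *\<^sub>R \<xi>) (f (?y + t *\<^sub>R \<xi>))"
  obtain \<epsilon> where e: "\<epsilon> > 0" "\<And>t. \<bar>t\<bar> < \<epsilon> \<Longrightarrow> ?X t \<in> V"
    "smooth_on {-\<epsilon><..<\<epsilon>} ?l" "smooth_on {-\<epsilon><..<\<epsilon>} ?X"
    and dX: "(?X has_vector_derivative lift (slope f ?y) \<xi>) (at 0)"
    by (rule graph_curve[OF V(1,2,5) local_graph_value[OF lg, symmetric], of \<xi>]) blast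
  let ?I = "{-\<epsilon><..<\<epsilon>}"
  define \<gamma> where "\<gamma> = (\<lambda>t. jet A 1 L (chart_inv c (?X t)))"
  have g: "\<gamma> t \<in> prolongation A 1 L \<inter> jet_dom A 1 c \<and> snd (J1 c) (\<gamma> t) = (?X t, slope f (?l t))"
    if "\<bar>t\<bar> < \<epsilon>" for t
  proof -
    let ?q = "chart_inv c (?X t)"
    have q: "?q \<in> L" "local_graph A c f L ?q" using V(7)[OF e(2)[OF that]] by simp_all
    have sq: "snd c ?q = ?X t" 
      by (rule chart_chart_inv) (use e(2)[OF that] V(3) in blast)
    show ?thesis
      using J1_coords[OF L(1) q] jet_dom_1_iff[OF L(1) q(1), of c] q
      by (auto simp: \<gamma>_def sq prolongation_def)
  qed
  have "?l ` ?I \<subseteq> greek ` V"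
  proof
    fix z assume "z \<in> ?l ` ?I"
    then obtain t where t: "t \<in> ?I" "z = ?l t" by blast
    then have "?X t \<in> V" using e(2)[of t] by auto
    then show "z \<in> greek ` V" using t(2) by (metis greek_join imageI)
  qed
  then have sl: "smooth_on ?I (\<lambda>t. slope f (?l t))"
    by (intro smooth_on_compose[OF _ V(4) _ e(3) smooth_on_slope[OF V(4,5)]]) auto
  have dl: "(?l has_derivative (\<lambda>t. t *\<^sub>R \<xi>)) (at 0)"
    by (auto intro!: derivative_eq_intros)
  have d1: "(slope f has_derivative slope_Der f ?y) (at (?l 0))"
    using slope_has_derivative[OF V(5,6)] by simp
  have "((\<lambda>t. slope f (?l t)) has_vector_derivative slope_Der f ?y \<xi>) (at 0)"
    using diff_chain_at[OF dl d1] linear_cmul[OF has_derivative_linear[OF d1]]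
    by (simp add: has_vector_derivative_def o_def)
  from has_vector_derivative_Pair[OF dX this]
  have dXl: "((\<lambda>t. (?X t, slope f (?l t))) has_vector_derivative W (J1 c)) (at 0)" unfolding Wc .
  show ?thesis
  proof (rule jet1.tangent_toI[OF e(1) jet1_atlasI[OF c(1)] _ W])
    show "\<gamma> 0 = jet A 1 L p"
      using local_graph_value[OF lg] by (simp add: \<gamma>_def chart_inv_chart[OF c])
    show "\<gamma> t \<in> prolongation A 1 L \<inter> fst (J1 c)" if "\<bar>t\<bar> < \<epsilon>" for t
      unfolding fst_J1 using g[OF that] by blast
    have "smooth_on ?I (\<lambda>t. (?X t, slope f (?l t)))"
      by (rule smooth_on_Pair[OF _ e(4) sl]) simp
    then show "smooth_on ?I (\<lambda>t. snd (J1 c) (\<gamma> t))"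
      by (rule smooth_on_cong[rotated 2]) (use g in auto)
    show "((\<lambda>t. snd (J1 c) (\<gamma> t)) has_vector_derivative W (J1 c)) (at 0)"
      by (rule has_vector_derivative_transform_within_open[OF dXl, of ?I]) (use e(1) g in auto)
  qed
qed

end

context connection
begin

lemma normal_form_sym:
  "c \<in> A \<Longrightarrow> p \<in> fst c \<Longrightarrow> normal_form A D c p u \<xi> \<eta> = normal_form A D c p u \<eta> \<xi>"
  unfolding normal_form_def by (simp add: christoffel_form_sym[of c p "lift u \<xi>"])

lemma vertical_projection_eq:
  assumes L: "submanifold A L" "p \<in> L" and lg: "local_graph A c f L p"
    and W: "W (J1 c) = (lift (slope f (greek (snd c p))) \<xi>, slope_Der f (greek (snd c p)) \<xi>)"
  shows "vertical_projection A D c (jet A 1 L p) W =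
    (\<chi> k l. (hess f (greek (snd c p)) \<xi> (axis l 1) +
      normal_form A D c p (slope f (greek (snd c p))) \<xi> (axis l 1)) $ k)"
proof -
  have z: "snd (snd (J1 c) (jet A 1 L p)) = slope f (greek (snd c p))"
    using J1_coords[OF L lg] by simp
  show ?thesis
    unfolding vertical_projection_def W snd_conv fst_conv
    using dot_coeff_sum[of c _ _ "jet A 1 L p" \<xi>, unfolded z base_point_jet[OF L]]
    by (simp add: slope_Der_def)
qed

text \<open>Vectors tangent to the prolongation are horizontal in every induced chart because the local
  equation holds in every chart. Conversely a horizontal vector over \<open>T\<^sub>pL\<close> has the vertical part that
  the equation prescribes for the prolonged curves of \<open>L\<close>.\<close>

lemma tangent_to_prolongation_geodesic:
  assumes L: "submanifold A L" "p \<in> L" and geo: "geodesic_at L p"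
  shows "tangent_to (jet1_atlas A) (prolongation A 1 L) (jet A 1 L p) =
    horizontal_lift A D (jet A 1 L p) (R_plane1 A (jet A 1 L p))" (is "?T = ?H")
proof -
  let ?\<theta> = "jet A 1 L p"
  obtain c f where lg: "local_graph A c f L p" using submanifold_local_graph[OF L] by blast
  have c: "c \<in> A" "p \<in> fst c" using lg local_graph_dom by blast+
  have dom: "?\<theta> \<in> jet_dom A 1 c" using jet_dom_1_iff[OF L] lg by blast
  have j: "?\<theta> \<in> jets A 1" by (rule jet_in_jets[OF L])
  note bp = base_point_jet[OF L, of 1] and R = R_plane1_jet[OF L]
  show ?thesis
  proof (intro equalityI subsetI)
    fix W assume W: "W \<in> ?T"
    then have Wt: "W \<in> tangent_space (jet1_atlas A) ?\<theta>" by (rule jet1.tangent_toE)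
    have hor: "vertical_projection A D d ?\<theta> W = 0" if d: "d \<in> A" "?\<theta> \<in> fst (J1 d)" for d
    proof -
      obtain h where h: "local_graph A d h L p" using jet_dom_1_iff[OF L, of d] d(2)
          by (auto simp: fst_J1)
      obtain \<xi>
          where Wd: "W (J1 d) =
          (lift (slope h (greek (snd d p))) \<xi>, slope_Der h (greek (snd d p)) \<xi>)"
        using tangent_to_prolongation[OF L h W] by blast
      show ?thesis
        unfolding vertical_projection_eq[where W = W, OF L h Wd]
            using geo[unfolded geodesic_at_iff[OF h]]
        by (simp add: vec_eq_iff)
    qed
    obtain \<xi>
        where Wc: "W (J1 c) = (lift (slope f (greek (snd c p))) \<xi>, slope_Der f (greek (snd c p)) \<xi>)"
      using tangent_to_prolongation[OF L lg W] by blast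
    have "differential (jet1_atlas A) A base_point ?\<theta> W \<in> tangent_to A L p"
      unfolding tangent_to_graph[OF lg]
      using differential_base_point(1)[OF j Wt] differential_base_point(2)[OF j Wt c(1) dom] Wc bp
          by simp
    then show "W \<in> ?H"
      unfolding horizontal_lift_def horizontal_space_def R using Wt hor by blast
  next
    fix W assume W: "W \<in> ?H"
    then have Wt: "W \<in> tangent_space (jet1_atlas A) ?\<theta>"
      and hor: "vertical_projection A D c ?\<theta> W = 0"
      and base: "differential (jet1_atlas A) A base_point ?\<theta> W \<in> tangent_to A L p"
      unfolding horizontal_lift_def horizontal_space_def R using c(1) dom by (auto simp: fst_J1)
    define \<xi> where "\<xi> = greek (fst (W (J1 c)))"
    have f1: "fst (W (J1 c)) = lift (slope f (greek (snd c p))) \<xi>"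
      using tangent_eq_lift[OF lg base] differential_base_point(2)[OF j Wt c(1) dom]
          by (simp add: \<xi>_def)
    have z: "snd (snd (J1 c) ?\<theta>) = slope f (greek (snd c p))"
      using J1_coords[OF L lg] by simp
    have "snd (W (J1 c)) $ k $ l = slope_Der f (greek (snd c p)) \<xi> $ k $ l" for k l
    proof -
      have "vertical_projection A D c ?\<theta> W $ k $ l = 0" using hor by simp
      then have "snd (W (J1 c)) $ k $ l +
          normal_form A D c p (slope f (greek (snd c p))) \<xi> (axis l 1) $ k = 0"
        using dot_coeff_sum[of c k l ?\<theta> \<xi>, unfolded z bp]
        by (simp add: vertical_projection_def f1)
      moreover have hn: "hess f (greek (snd c p)) \<xi> (axis l 1) =
          - normal_form A D c p (slope f (greek (snd c p))) \<xi> (axis l 1)"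
        using geo[unfolded geodesic_at_iff[OF lg]] by blast
      ultimately show ?thesis by (simp add: slope_Der_def hn eq_neg_iff_add_eq_0)
    qed
    then have "W (J1 c) = (lift (slope f (greek (snd c p))) \<xi>, slope_Der f (greek (snd c p)) \<xi>)"
      using f1 by (simp add: prod_eq_iff vec_eq_iff)
    then show "W \<in> ?T" by (rule prolongation_tangent_exists[OF L lg Wt])
  qed
qed

text \<open>Prolonged curves over every direction \<open>\<xi>\<close> give the equation for \<open>\<xi>\<close> and each basis vector, and
  bilinearity the rest.\<close>

lemma geodesic_at_if_horizontal:
  assumes L: "submanifold A L" "p \<in> L"
    and hor: "tangent_to (jet1_atlas A) (prolongation A 1 L) (jet A 1 L p) \<subseteq>
        horizontal_space A D (jet A 1 L p)"
  shows "geodesic_at L p"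
proof -
  let ?\<theta> = "jet A 1 L p"
  obtain c f where lg: "local_graph A c f L p" using submanifold_local_graph[OF L] by blast
  have c: "c \<in> A" "p \<in> fst c" using lg local_graph_dom by blast+
  have dom: "?\<theta> \<in> fst (J1 c)" unfolding fst_J1 using jet_dom_1_iff[OF L] lg by blast
  let ?y = "greek (snd c p)"
  let ?u = "slope f ?y"
  obtain V where V: "open V" "smooth_on V f" "?y \<in> V"
    using lg by (rule local_graph_smoothE)
  have eq: "hess f ?y \<xi> (axis l 1) = - normal_form A D c p ?u \<xi> (axis l 1)" for \<xi> l
  proof -
    let ?W = "tvec_of (jet1_atlas A) (J1 c) ?\<theta> (lift ?u \<xi>, slope_Der f ?y \<xi>)"
    have Wc: "?W (J1 c) = (lift ?u \<xi>, slope_Der f ?y \<xi>)"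
      by (rule jet1.tvec_of_same[OF jet1_atlasI[OF c(1)] dom])
    have "?W \<in> tangent_to (jet1_atlas A) (prolongation A 1 L) ?\<theta>"
      by (rule prolongation_tangent_exists[OF L lg jet1.tvec_of_in_tangent_space[OF jet1_atlasI[OF
          c(1)] dom] Wc])
    then have "vertical_projection A D c ?\<theta> ?W = 0"
      using hor c(1) dom unfolding horizontal_space_def by blast
    then show ?thesis
      unfolding vertical_projection_eq[where W = ?W, OF L lg Wc]
          by (simp add: vec_eq_iff eq_neg_iff_add_eq_0)
  qed
  have "bilinear (\<lambda>\<xi> \<eta>. - normal_form A D c p ?u \<xi> \<eta>)"
    using bilinear_normal_form[of A D c p ?u] by (auto simp: bilinear_def intro: linear_compose_neg)
  then have "hess f ?y = (\<lambda>\<xi> \<eta>. - normal_form A D c p ?u \<xi> \<eta>)"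
    using bilinear_hess[OF V] eq by (intro bilinear_eq_on_axes) auto
  then show ?thesis unfolding geodesic_at_iff[OF lg] by simp
qed

section \<open>The section determined by the connection\<close>

text \<open>Second order jets are themselves sets of pointed submanifolds, so that this set can serve as the
  value at \<open>\<theta>\<close> of the section.\<close>

definition solutions :: "'p jet \<Rightarrow> 'p jet" where
  "solutions \<theta> = {(L, p). submanifold A L \<and> p \<in> L \<and> jet A 1 L p = \<theta> \<and> geodesic_at L p}"

text \<open>The form \<open>normal_form\<close> is symmetric because \<open>D\<close> is torsion-free, so it is minus the second
  derivative of a quadratic graph with the given first order jet.\<close>

lemma solution_exists:
  assumes "\<theta> \<in> jets A 1"
  obtains L p where "(L, p) \<in> solutions \<theta>"
proof -
  obtain c where c: "c \<in> A" "\<theta> \<in> jet_dom A 1 c" using assms by (rule jets_1_dom)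
  let ?p = "base_point \<theta>" and ?z = "snd (J1 c) \<theta>"
  have p: "?p \<in> fst c" by (rule base_point_dom[OF c(2)])
  have z: "fst ?z = snd c ?p" by (rule fst_J1_coords)
  define f where "f = quadratic_map ?z (normal_form A D c ?p (snd ?z))"
  note quad = smooth_quadratic_map slope_quadratic_map hess_quadratic_map
  note q = quad[OF bilinear_normal_form[of A D c ?p "snd ?z"] normal_form_sym[OF c(1) p], of ?z,
      folded f_def]
  have "f (greek (fst ?z)) = latin (fst ?z)"
    using bilinear_lzero[OF bilinear_normal_form[of A D c ?p "snd ?z"]]
    by (simp add: f_def quadratic_map_def affine_map_base)
  then have pL: "?p \<in> graph_set c f" using p z by (simp add: graph_set_def)
  have L: "submanifold A (graph_set c f)" by (rule submanifold_graph_set[OF c(1) q(1)])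
  have lg: "local_graph A c f (graph_set c f) ?p" by (rule local_graph_graph_set[OF c(1) q(1) pL])
  have "geodesic_at (graph_set c f) ?p"
    unfolding geodesic_at_iff[OF lg] using q(2,3) z by simp
  moreover have "jet A 1 (graph_set c f) ?p = \<theta>"
  proof (rule inj_onD[OF inj_J1])
    show "snd (J1 c) (jet A 1 (graph_set c f) ?p) = snd (J1 c) \<theta>"
      using J1_coords[OF L pL lg] q(2) z by (metis prod.collapse)
    show "jet A 1 (graph_set c f) ?p \<in> jet_dom A 1 c" using jet_dom_1_iff[OF L pL] lg by blast
  qed (rule c(2))
  ultimately show thesis using that L pL unfolding solutions_def by blast
qed

text \<open>Two solutions with the same first order jet have contact of order 2, because the equation
  prescribes all second derivatives; hence the solutions form a single second order jet.\<close>

lemma jet_2_eq_solutions: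
  assumes "(L, p) \<in> solutions \<theta>"
  shows "jet A 2 L p = solutions \<theta>"
proof -
  have L: "submanifold A L" "p \<in> L" "jet A 1 L p = \<theta>" "geodesic_at L p"
    using assms unfolding solutions_def by auto
  have "(L', p') \<in> jet A 2 L p \<longleftrightarrow> (L', p') \<in> solutions \<theta>" for L' p'
  proof
    assume "(L', p') \<in> jet A 2 L p"
    then have L': "p' = p" "submanifold A L'" "contact A 2 p L L'" by (auto simp: jet_def)
    have le: "(1::nat) \<le> 2" by simp
    note t = tangent_eq_if_contact[OF le L'(3)]
    from L'(3) obtain c f f' where lg: "local_graph A c f L p" "local_graph A c f' L' p"
      and eq: "\<And>\<sigma> i. length \<sigma> \<le> 2 \<Longrightarrow>
        partial \<sigma> (\<lambda>x. f x $ i) (greek (snd c p)) = partial \<sigma> (\<lambda>x. f' x $ i) (greek (snd c p))"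
      unfolding contact_def by blast
    let ?y = "greek (snd c p)"
    obtain V where V: "open V" "smooth_on V f" "?y \<in> V"
      using lg(1) by (rule local_graph_smoothE)
    obtain V' where V': "open V'" "smooth_on V' f'" "?y \<in> V'"
      using lg(2) by (rule local_graph_smoothE)
    have "hess f ?y = hess f' ?y"
    proof (rule bilinear_eq_on_axes[OF bilinear_hess[OF V] bilinear_hess[OF V']])
      show "hess f ?y (axis l 1) (axis \<xi> 1) = hess f' ?y (axis l 1) (axis \<xi> 1)" for l \<xi>
        using eq[of "[l, \<xi>]"] unfolding vec_eq_iff partial_2_component[OF V, symmetric]
          partial_2_component[OF V', symmetric] by simp
    qed
    moreover have "slope f ?y = slope f' ?y" by (rule slope_eq_if_contact[OF le lg eq])
    ultimately have "geodesic_at L' p"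
      using L(4) unfolding geodesic_at_iff[OF lg(1)] geodesic_at_iff[OF lg(2)] by simp
    moreover have "jet A 1 L' p = \<theta>" using jet_1_eq_iff[OF L'(2) t(2) L(1,2)] t(3) L(3) by simp
    ultimately show "(L', p') \<in> solutions \<theta>" using L' t(2) by (simp add: solutions_def)
  next
    assume "(L', p') \<in> solutions \<theta>"
    then have L': "submanifold A L'" "p' \<in> L'" "jet A 1 L' p' = \<theta>" "geodesic_at L' p'"
      unfolding solutions_def by auto
    have t: "p' = p" "tangent_to A L' p = tangent_to A L p"
      using jet_1_eq_iff[OF L'(1,2) L(1,2)] L(3) L'(3) by auto
    obtain c f where f: "local_graph A c f L p" using submanifold_local_graph[OF L(1,2)] by blast
    obtain f' where f': "local_graph A c f' L' p"
      using local_graph_tangent_eq[OF f L'(1) L'(2)[unfolded t(1)] t(2)] by blast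
    let ?y = "greek (snd c p)"
    obtain V where V: "open V" "smooth_on V f" "?y \<in> V"
      using f by (rule local_graph_smoothE)
    obtain V' where V': "open V'" "smooth_on V' f'" "?y \<in> V'"
      using f' by (rule local_graph_smoothE)
    have s: "slope f ?y = slope f' ?y" by (rule slope_eq_if_tangent_eq[OF f f' t(2)[symmetric]])
    have h: "hess f ?y \<xi> \<eta> = hess f' ?y \<xi> \<eta>" for \<xi> \<eta>
      using L(4)[unfolded geodesic_at_iff[OF f]] L'(4)[unfolded t(1) geodesic_at_iff[OF f']] s
          by simp
    have "partial \<sigma> (\<lambda>x. f x $ i) ?y = partial \<sigma> (\<lambda>x. f' x $ i) ?y" if le: "length \<sigma> \<le> 2" for \<sigma> i
    proof -
      consider "\<sigma> = []" | l where "\<sigma> = [l]" | l \<xi> where "\<sigma> = [l, \<xi>]"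
        using le by (cases \<sigma> rule: remdups_adj.cases) auto
      then show ?thesis
      proof cases
        case 1
        then show ?thesis using local_graph_value[OF f] local_graph_value[OF f'] by simp
      next
        case 2
        then show ?thesis
          using partial_component[OF local_graph_differentiable[OF f], of l i]
            partial_component[OF local_graph_differentiable[OF f'], of l i] s by simp
      next
        case 3
        then show ?thesis
          unfolding 3 partial_2_component[OF V] partial_2_component[OF V'] h by simp
      qed
    qed
    then have "contact A 2 p L L'"
      unfolding contact_def by (intro exI[of _ c] exI[of _ f] exI[of _ f'] conjI allI impI f f')
    then show "(L', p') \<in> jet A 2 L p" using L'(1) t(1) by (simp add: jet_def)
  qed
  then show ?thesis by auto
qed

lemma solutions_in_jets:
  assumes "\<theta> \<in> jets A 1"
  shows "solutions \<theta> \<in> jets A 2"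
proof -
  obtain L p where s: "(L, p) \<in> solutions \<theta>" using assms by (rule solution_exists)
  then have "submanifold A L" "p \<in> L" by (auto simp: solutions_def)
  then show ?thesis using jet_2_eq_solutions[OF s] jet_in_jets by metis
qed

lemma jet_proj_solutions:
  assumes "\<theta> \<in> jets A 1"
  shows "jet_proj A 1 (solutions \<theta>) = \<theta>"
proof -
  obtain L p where s: "(L, p) \<in> solutions \<theta>" using assms by (rule solution_exists)
  have "jet A 1 (fst x) (snd x) = \<theta>" if "x \<in> solutions \<theta>" for x
    using that unfolding solutions_def by auto
  then have "(\<Union>x\<in>solutions \<theta>. jet A 1 (fst x) (snd x)) = (\<Union>x\<in>solutions \<theta>. \<theta>)"
    by (rule SUP_cong[OF refl])
  then show ?thesis unfolding jet_proj_def case_prod_unfold using s by blast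
qed

lemma R_plane2_solutions:
  assumes "\<theta> \<in> jets A 1"
  shows "R_plane2 A (solutions \<theta>) = horizontal_lift A D \<theta> (R_plane1 A \<theta>)"
proof -
  obtain L p where s: "(L, p) \<in> solutions \<theta>" using assms by (rule solution_exists)
  have "tangent_to (jet1_atlas A) (prolongation A 1 (fst x)) (jet A 1 (fst x) (snd x)) =
      horizontal_lift A D \<theta> (R_plane1 A \<theta>)" if "x \<in> solutions \<theta>" for x
    using that tangent_to_prolongation_geodesic[of "fst x" "snd x"] unfolding solutions_def by auto
  then have
      "(\<Union>x\<in>solutions \<theta>. tangent_to (jet1_atlas A) (prolongation A 1 (fst x)) (jet A 1 (fst x) (snd x))) =
      (\<Union>x\<in>solutions \<theta>. horizontal_lift A D \<theta> (R_plane1 A \<theta>))"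
    by (rule SUP_cong[OF refl])
  then show ?thesis unfolding R_plane2_def case_prod_unfold using s by blast
qed

lemma jet_coord_eqI:
  assumes "(L, p) \<in> \<theta>" "local_graph A c f L p"
    and "\<And>L p f. (L, p) \<in> \<theta> \<Longrightarrow> local_graph A c f L p \<Longrightarrow>
      partial \<sigma> (\<lambda>x. f x $ i) (greek (snd c p)) = y"
  shows "jet_coord A c i \<sigma> \<theta> = y"
  unfolding jet_coord_def
proof (rule the_equality)
  show "\<exists>L p f. (L, p) \<in> \<theta> \<and> local_graph A c f L p \<and> y = partial \<sigma> (\<lambda>x. f x $ i) (greek (snd c p))"
    using assms by metis
next
  fix x assume "\<exists>L p f. (L, p) \<in> \<theta> \<and> local_graph A c f L p \<and> x =
      partial \<sigma> (\<lambda>x. f x $ i) (greek (snd c p))"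
  then show "x = y" using assms(3) by blast
qed

text \<open>The fibre coordinates of the section are \<open>- normal_form\<close>; smoothness of the section will follow
  from that of the Christoffel symbols.\<close>

lemma jet2_coords_solutions:
  assumes c: "c \<in> A" "\<theta> \<in> jet_dom A 1 c"
  shows "solutions \<theta> \<in> jet_dom A 2 c"
    and "snd (jet2_chart A c) (solutions \<theta>) = (snd c (base_point \<theta>), snd (snd (J1 c) \<theta>),
      \<chi> i l \<xi>. - normal_form A D c (base_point \<theta>) (snd (snd (J1 c) \<theta>)) (axis l 1) (axis \<xi> 1) $ i)"
proof -
  have j: "\<theta> \<in> jets A 1" using c(2) by (simp add: jet_dom_def)
  obtain L p where s: "(L, p) \<in> solutions \<theta>" using j by (rule solution_exists)
  have L: "submanifold A L" "p \<in> L" "jet A 1 L p = \<theta>" using s by (auto simp: solutions_def)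
  have bp: "base_point \<theta> = p" "base_point (solutions \<theta>) = p"
    using base_point_jet[OF L(1,2)] L(3) jet_2_eq_solutions[OF s] by metis+
  obtain f where f: "local_graph A c f L p" using jet_dom_1_iff[OF L(1,2)] L(3) c(2) by blast
  show "solutions \<theta> \<in> jet_dom A 2 c"
    unfolding jet_dom_def using solutions_in_jets[OF j] s f by blast
  let ?u = "snd (snd (J1 c) \<theta>)"
  have all: "p' = p \<and> slope f' (greek (snd c p)) = ?u \<and> geodesic_at L' p"
    if s': "(L', p') \<in> solutions \<theta>" and f': "local_graph A c f' L' p'" for L' p' f'
  proof -
    have L': "submanifold A L'" "p' \<in> L'" "jet A 1 L' p' = \<theta>" "geodesic_at L' p'"
      using s' by (auto simp: solutions_def)
    have "p' = p" using base_point_jet[OF L'(1,2), of 1] L'(3) bp(1) by simp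
    then show ?thesis using J1_coords[OF L'(1,2) f'] L'(3,4) by simp
  qed
  have 1: "jet_coord A c i [l] (solutions \<theta>) = ?u $ i $ l" for i l
  proof (rule jet_coord_eqI[OF s f])
    fix L' p' f' assume *: "(L', p') \<in> solutions \<theta>" "local_graph A c f' L' p'"
    show "partial [l] (\<lambda>x. f' x $ i) (greek (snd c p')) = ?u $ i $ l"
      using partial_component[OF local_graph_differentiable[OF *(2)], of l i] all[OF *] by simp
  qed
  have 2: "jet_coord A c i [l, \<xi>] (solutions \<theta>) =
      - normal_form A D c p ?u (axis l 1) (axis \<xi> 1) $ i" for i l \<xi>
  proof (rule jet_coord_eqI[OF s f])
    fix L' p' f' assume *: "(L', p') \<in> solutions \<theta>" "local_graph A c f' L' p'"
    obtain V where V: "open V" "smooth_on V f'" "greek (snd c p') \<in> V"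
      using *(2) by (rule local_graph_smoothE)
    have "p' = p" using all[OF *] by blast
    then show "partial [l, \<xi>] (\<lambda>x. f' x $ i) (greek (snd c p')) =
        - normal_form A D c p ?u (axis l 1) (axis \<xi> 1) $ i"
      unfolding partial_2_component[OF V] using all[OF *] geodesic_at_iff[OF *(2)] by simp
  qed
  show "snd (jet2_chart A c) (solutions \<theta>) = (snd c (base_point \<theta>), ?u,
      \<chi> i l \<xi>. - normal_form A D c (base_point \<theta>) ?u (axis l 1) (axis \<xi> 1) $ i)"
    by (simp add: jet2_chart_def 1 2 bp)
qed

lemma smooth_on_normal_form:
  assumes "c \<in> A"
  shows "smooth_on ((snd c ` fst c) \<times> UNIV)
    (\<lambda>z. normal_form A D c (chart_inv c (fst z)) (snd z) (axis l 1) (axis \<xi> 1) $ i)"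
proof -
  let ?S = "(snd c ` fst c) \<times> (UNIV :: (real^'n^'m) set)"
  have o: "open (snd c ` fst c)" by (rule open_chart_image[OF assms])
  have oS: "open ?S" using o by (simp add: open_Times)
  have G: "smooth_on ?S (\<lambda>z. christoffel A D c a s b (chart_inv c (fst z)))" for a s b
    by (rule smooth_on_compose[OF oS o _ smooth_on_bounded_linear[OF oS bounded_linear_fst
            smooth_on_ident[OF oS]] smooth_on_christoffel[OF assms]]) auto
  have "smooth_on ?S (\<lambda>z. christoffel_form A D c (chart_inv c (fst z))
      (lift (snd z) (axis l 1)) (lift (snd z) (axis \<xi> 1)) $ s)" for s
    unfolding christoffel_form_def vec_lambda_beta
    by (intro smooth_on_sum smooth_on_mult smooth_on_lift_axis oS G)
  moreover have "smooth_on ?S (\<lambda>z. snd z $ i $ b)" for b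
    by (intro smooth_on_nth smooth_on_bounded_linear[OF _ bounded_linear_snd] smooth_on_ident oS)
  ultimately have "smooth_on ?S (\<lambda>z. christoffel_form A D c (chart_inv c (fst z))
      (lift (snd z) (axis l 1)) (lift (snd z) (axis \<xi> 1)) $ Inr i -
      (\<Sum>b\<in>UNIV. snd z $ i $ b * christoffel_form A D c (chart_inv c (fst z))
      (lift (snd z) (axis l 1)) (lift (snd z) (axis \<xi> 1)) $ Inl b))"
    by (intro smooth_on_diff smooth_on_sum smooth_on_mult oS)
  then show ?thesis
    by (simp add: normal_form_def normal_part_def matrix_vector_mult_def)
qed

lemma smooth_map_solutions:
  "smooth_map (jet1_atlas A) (jet2_atlas A) (jets A 1) (restrict solutions (jets A 1))"
  unfolding smooth_map_def
proof
  fix \<theta> assume "\<theta> \<in> jets A 1"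
  then obtain c where c: "c \<in> A" "\<theta> \<in> jet_dom A 1 c" by (rule jets_1_dom)
  let ?S = "(snd c ` fst c) \<times> (UNIV :: (real^'n^'m) set)"
  let ?s = "\<lambda>z. restrict solutions (jets A 1) (chart_inv (J1 c) z)"
  have oS: "open ?S" using open_chart_image[OF c(1)] by (simp add: open_Times)
  have z: "?s z = solutions (jet_at c z)" "jet_at c z \<in> jet_dom A 1 c"
    "base_point (jet_at c z) = chart_inv c (fst z)" "snd (J1 c) (jet_at c z) = z"
        "snd c (chart_inv c (fst z)) = fst z"
    if "z \<in> ?S" for z
  proof -
    have fz: "fst z \<in> snd c ` fst c" using that by auto
    note j = jet_at[OF c(1) fz]
    show "jet_at c z \<in> jet_dom A 1 c" "base_point (jet_at c z) = chart_inv c (fst z)"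
      "snd (J1 c) (jet_at c z) = z" "snd c (chart_inv c (fst z)) = fst z"
      by (fact j(1), fact j(3), fact j(2), fact chart_chart_inv[OF fz])
    have "jet_at c z \<in> jets A 1" using j(1) by (simp add: jet_dom_def)
    then show "?s z = solutions (jet_at c z)" by (simp add: chart_inv_J1_jet_at[OF c(1) fz])
  qed
  have "smooth_on ?S (\<lambda>z. (fst z, snd z,
      \<chi> i l \<xi>. - normal_form A D c (chart_inv c (fst z)) (snd z) (axis l 1) (axis \<xi> 1) $ i))"
    by (intro smooth_on_Pair smooth_on_vec smooth_on_minus smooth_on_normal_form c(1) oS
        smooth_on_bounded_linear[OF _ bounded_linear_fst] smooth_on_bounded_linear[OF _
            bounded_linear_snd]
        smooth_on_ident)
  then have sm: "smooth_on ?S (\<lambda>z. snd (jet2_chart A c) (?s z))"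
  proof (rule smooth_on_cong[OF oS, rotated])
    fix z assume "z \<in> ?S"
    note z = z[OF this]
    show "(fst z, snd z, \<chi> i l \<xi>. - normal_form A D c (chart_inv c (fst z)) (snd z) (axis l 1) (axis \<xi> 1) $ i) =
        snd (jet2_chart A c) (?s z)"
      unfolding z(1) jet2_coords_solutions(2)[OF c(1) z(2)] z(3-5) ..
  qed
  show "\<exists>C\<in>jet1_atlas A. \<exists>E\<in>jet2_atlas A. \<exists>W. \<theta> \<in> fst C \<and> open W \<and> snd C \<theta> \<in> W \<and>
      W \<subseteq> snd C ` fst C \<and> (\<forall>z\<in>W. restrict solutions (jets A 1) (chart_inv C z) \<in> fst E) \<and>
      smooth_on W (\<lambda>z. snd E (restrict solutions (jets A 1) (chart_inv C z)))"
  proof (intro bexI[of _ "J1 c"] bexI[of _ "jet2_chart A c"] exI[of _ ?S] conjI ballI)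
    show "\<theta> \<in> fst (J1 c)" "snd (J1 c) \<theta> \<in> ?S" "?S \<subseteq> snd (J1 c) ` fst (J1 c)"
      unfolding fst_J1 J1_image[OF c(1), symmetric] using c(2) by auto
    show "?s z \<in> fst (jet2_chart A c)" if "z \<in> ?S" for z
      using z(1)[OF that] jet2_coords_solutions(1)[OF c(1) z(2)[OF that]]
          by (simp add: jet2_chart_def)
    show "jet2_chart A c \<in> jet2_atlas A" using c(1) by (simp add: jet2_atlas_def)
  qed (fact oS sm jet1_atlasI[OF c(1)])+
qed

text \<open>Any other section with the required \<open>R\<close>-planes takes at \<open>\<theta>\<close> the class of a submanifold with
  first order jet \<open>\<theta>\<close> and horizontal prolongation, hence of a solution.\<close>

lemma ddot_eq: "ddot A D = restrict solutions (jets A 1)"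
  unfolding ddot_def
proof (rule the_equality)
  show "smooth_section21 A (restrict solutions (jets A 1)) \<and> (\<forall>\<theta>\<in>jets A 1.
      R_plane2 A (restrict solutions (jets A 1) \<theta>) = horizontal_lift A D \<theta> (R_plane1 A \<theta>))"
    unfolding smooth_section21_def
    using smooth_map_solutions solutions_in_jets jet_proj_solutions R_plane2_solutions by auto
next
  fix s assume "smooth_section21 A s \<and>
    (\<forall>\<theta>\<in>jets A 1. R_plane2 A (s \<theta>) = horizontal_lift A D \<theta> (R_plane1 A \<theta>))"
  then have s: "s \<in> jets A 1 \<rightarrow>\<^sub>E jets A 2"
    and proj: "\<And>\<theta>. \<theta> \<in> jets A 1 \<Longrightarrow> jet_proj A 1 (s \<theta>) = \<theta>"
    and R: "\<And>\<theta>. \<theta> \<in> jets A 1 \<Longrightarrow> R_plane2 A (s \<theta>) = horizontal_lift A D \<theta> (R_plane1 A \<theta>)"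
    unfolding smooth_section21_def by auto
  show "s = restrict solutions (jets A 1)"
  proof (rule PiE_ext[OF s])
    show "restrict solutions (jets A 1) \<in> jets A 1 \<rightarrow>\<^sub>E jets A 2"
      using solutions_in_jets by simp
    fix \<theta> assume \<theta>: "\<theta> \<in> jets A 1"
    then have "s \<theta> \<in> jets A 2" using s by blast
    then obtain L p where L: "submanifold A L" "p \<in> L" "s \<theta> = jet A 2 L p" by (rule jets_cases)
    obtain L0 p0 where L0: "submanifold A L0" "p0 \<in> L0" "\<theta> = jet A 1 L0 p0" using \<theta>
        by (rule jets_cases)
    have mem: "(L, p) \<in> s \<theta>" using self_in_jet[OF L(1,2)] L(3) by simp
    have "(L, p) \<in> jet_proj A 1 (s \<theta>)"
      unfolding jet_proj_def using mem self_in_jet[OF L(1,2), of 1] by blast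
    then have "(L, p) \<in> jet A 1 L0 p0" using proj[OF \<theta>] L0(3) by simp
    then have j: "jet A 1 L p = \<theta>"
      unfolding L0(3) using jet_1_eq_iff[OF L(1,2) L0(1,2)] in_jet_1_iff[OF L0(1,2), of L p]
          by blast
    have "tangent_to (jet1_atlas A) (prolongation A 1 L) (jet A 1 L p) \<subseteq> R_plane2 A (s \<theta>)"
      unfolding R_plane2_def using mem by blast
    also have "\<dots> \<subseteq> horizontal_space A D (jet A 1 L p)"
      unfolding R[OF \<theta>] j horizontal_lift_def by blast
    finally have "geodesic_at L p"
      by (rule geodesic_at_if_horizontal[OF L(1,2)])
    then have "(L, p) \<in> solutions \<theta>" using L j by (simp add: solutions_def)
    then show "s \<theta> = restrict solutions (jets A 1) \<theta>"
      using jet_2_eq_solutions L(3) \<theta> by simp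
  qed
qed

lemma totally_geodesic_equation_eq: "totally_geodesic_equation T A D = ddot A D ` jets A 1"
proof (intro equalityI subsetI)
  fix x assume "x \<in> totally_geodesic_equation T A D"
  then obtain L p where L: "submanifold A L" "p \<in> L" "x = jet A 2 L p" "geodesic_at L p"
    unfolding totally_geodesic_equation_def geodesic_at_def by blast
  then have "(L, p) \<in> solutions (jet A 1 L p)" by (simp add: solutions_def)
  then show "x \<in> ddot A D ` jets A 1"
    using jet_2_eq_solutions L(3) jet_in_jets[OF L(1,2), of 1] by (simp add: ddot_eq)
next
  fix x assume "x \<in> ddot A D ` jets A 1"
  then obtain \<theta> where \<theta>: "\<theta> \<in> jets A 1" "x = solutions \<theta>" by (auto simp: ddot_eq)
  obtain L p where s: "(L, p) \<in> solutions \<theta>" using \<theta>(1) by (rule solution_exists)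
  have "x = jet A 2 L p" using jet_2_eq_solutions[OF s] \<theta>(2) by simp
  then show "x \<in> totally_geodesic_equation T A D"
    using s unfolding solutions_def totally_geodesic_equation_def geodesic_at_def by blast
qed

end

theorem theorem3:
  fixes T :: "'p topology"
    and A :: "('p, real^('n::finite + 'm::finite)) chart set"
    and D D' :: "('p, real^('n + 'm)) covariant_derivative"
  assumes "smooth_manifold T A"
    and "linear_connection T A D" and "torsion_free T A D"
    and "linear_connection T A D'" and "torsion_free T A D'"
  shows "grassmannian_equivalent T A D D' \<longleftrightarrow> ddot A D = ddot A D'"
proof -
  interpret C: connection T A D by unfold_locales fact+
  interpret C': connection T A D' by unfold_locales fact+
  show ?thesis
  proof
    assume "ddot A D = ddot A D'"
    then show "grassmannian_equivalent T A D D'"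
      by (simp add: grassmannian_equivalent_def C.totally_geodesic_equation_eq
          C'.totally_geodesic_equation_eq)
  next
    assume "grassmannian_equivalent T A D D'"
    then have eq: "ddot A D ` jets A 1 = ddot A D' ` jets A 1"
      by (simp add: grassmannian_equivalent_def C.totally_geodesic_equation_eq
          C'.totally_geodesic_equation_eq)
    show "ddot A D = ddot A D'"
    proof
      fix \<theta>
      show "ddot A D \<theta> = ddot A D' \<theta>"
      proof (cases "\<theta> \<in> jets A 1")
        case True
        then obtain \<eta> where \<eta>: "\<eta> \<in> jets A 1" "ddot A D \<theta> = ddot A D' \<eta>" using eq by blast
        \<comment> \<open>The first order jet is recovered from the value of a section.\<close>
        have "jet_proj A 1 (ddot A D \<theta>) = \<theta>" "jet_proj A 1 (ddot A D' \<eta>) = \<eta>"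
          unfolding C.ddot_eq C'.ddot_eq
          using True \<eta>(1) C.jet_proj_solutions C'.jet_proj_solutions by simp_all
        then show ?thesis using \<eta>(2) by simp
      next
        case False
        then show ?thesis by (simp add: C.ddot_eq C'.ddot_eq)
      qed
    qed
  qed
qed

end
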